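(* Consider the following system of second order partial differential equations for $u=u(x,y,z,t)$, with parameters $a,b,c,e_1,e_2,e_3,e_4$: $$\begin{aligned} &x(1-x)u_{xx}-y^2u_{yy}-t^2u_{tt}-2xyu_{xy}-xzu_{xz}-2xtu_{xt}-yzu_{yz}-2ytu_{yt}-ztu_{zt}\\ &\quad+[e_1-(a+b+1)x]u_x-(a+b+1)yu_y-bzu_z-(a+b+1)tu_t-abu=0,\\ &y(1-y)u_{yy}-x^2u_{xx}-t^2u_{tt}-2xyu_{xy}-xzu_{xz}-2xtu_{xt}-yzu_{yz}-2ytu_{yt}-ztu_{zt}\\ &\quad-(a+b+1)xu_x+[e_2-(a+b+1)y]u_y-bzu_z-(a+b+1)tu_t-abu=0,\\ &z(1-z)u_{zz}-xzu_{xz}-yzu_{yz}-ztu_{zt}-cxu_x-cyu_y+[e_3-(a+c+1)z]u_z-ctu_t-acu=0,\\ &t(1-t)u_{tt}-x^2u_{xx}-y^2u_{yy}-2xyu_{xy}-xzu_{xz}-2xtu_{xt}-yzu_{yz}-2ytu_{yt}-ztu_{zt}\\ &\quad-(a+b+1)xu_x-(a+b+1)yu_y-bzu_z+[e_4-(a+b+1)t]u_t-abu=0. \end{aligned}$$ The following sixteen functions are linearly independent solutions of this system: $$\begin{aligned} u_1&=K_2(a,b,c;e_1,e_2,e_3,e_4;x,y,z,t),\\ u_2&=x^{1-e_1}K_2(1-e_1+a,1-e_1+b,c;2-e_1,e_2,e_3,e_4;x,y,z,t),\\ u_3&=y^{1-e_2}K_2(1-e_2+a,1-e_2+b,c;e_1,2-e_2,e_3,e_4;x,y,z,t),\\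 u_4&=z^{1-e_3}K_2(1-e_3+a,b,1-e_3+c;e_1,e_2,2-e_3,e_4;x,y,z,t),\\ u_5&=t^{1-e_4}K_2(1-e_4+a,1-e_4+b,c;e_1,e_2,e_3,2-e_4;x,y,z,t),\\ u_6&=x^{1-e_1}y^{1-e_2}K_2(2-e_1-e_2+a,2-e_1-e_2+b,c;2-e_1,2-e_2,e_3,e_4;x,y,z,t),\\ u_7&=x^{1-e_1}z^{1-e_3}K_2(2-e_1-e_3+a,1-e_1+b,1-e_3+c;2-e_1,e_2,2-e_3,e_4;x,y,z,t),\\ u_8&=x^{1-e_1}t^{1-e_4}K_2(2-e_1-e_4+a,2-e_1-e_4+b,c;2-e_1,e_2,e_3,2-e_4;x,y,z,t),\\ u_9&=y^{1-e_2}z^{1-e_3}K_2(2-e_2-e_3+a,1-e_2+b,1-e_3+c;e_1,2-e_2,2-e_3,e_4;x,y,z,t),\\ u_{10}&=y^{1-e_2}t^{1-e_4}K_2(2-e_2-e_4+a,2-e_2-e_4+b,c;e_1,2-e_2,e_3,2-e_4;x,y,z,t),\\ u_{11}&=z^{1-e_3}t^{1-e_4}K_2(2-e_3-e_4+a,1-e_4+b,1-e_3+c;e_1,e_2,2-e_3,2-e_4;x,y,z,t),\\ u_{12}&=x^{1-e_1}y^{1-e_2}z^{1-e_3}K_2(3-e_1-e_2-e_3+a,2-e_1-e_2+b,1-e_3+c;2-e_1,2-e_2,2-e_3,e_4;x,y,z,t),\\ u_{13}&=x^{1-e_1}y^{1-e_2}t^{1-e_4}K_2(3-e_1-e_2-e_4+a,3-e_1-e_2-e_4+b,c;2-e_1,2-e_2,e_3,2-e_4;x,y,z,t),\\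 u_{14}&=x^{1-e_1}z^{1-e_3}t^{1-e_4}K_2(3-e_1-e_3-e_4+a,2-e_1-e_4+b,1-e_3+c;2-e_1,e_2,2-e_3,2-e_4;x,y,z,t),\\ u_{15}&=y^{1-e_2}z^{1-e_3}t^{1-e_4}K_2(3-e_2-e_3-e_4+a,2-e_2-e_4+b,1-e_3+c;e_1,2-e_2,2-e_3,2-e_4;x,y,z,t),\\ u_{16}&=x^{1-e_1}y^{1-e_2}z^{1-e_3}t^{1-e_4}K_2(4-e_1-e_2-e_3-e_4+a,3-e_1-e_2-e_4+b,1-e_3+c;\\ &\qquad\qquad 2-e_1,2-e_2,2-e_3,2-e_4;x,y,z,t). \end{aligned}$$ Moreover, the global solution of the system is of the form $$u=\sum_{j=1}^{16}k_j\,u_j,$$ where $k_1,\dots,k_{16}$ are constants.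
   Context: $(\lambda)_n=\lambda(\lambda+1)\cdots(\lambda+n-1)$, $(\lambda)_0=1$, is the Pochhammer symbol. Exton's quadruple hypergeometric function $K_2$ is defined by $$K_2(a,b,c;e_1,e_2,e_3,e_4;x,y,z,t)=\sum_{m,n,p,q=0}^{\infty}\frac{(a)_{m+n+p+q}(b)_{m+n+q}(c)_p}{(e_1)_m(e_2)_n(e_3)_p(e_4)_q}\frac{x^m}{m!}\frac{y^n}{n!}\frac{z^p}{p!}\frac{t^q}{q!}.$$ Subscripts $x,y,z,t$ on $u$ denote partial derivatives.
   Formalization: The parameters e_1,…,e_4 are assumed not to be integers (for e_1=1, u_1=u_2; at other integers some u_j is undefined); solutions are holomorphic on a connected open set inside the convergence region of K_2, with principal powers off their cuts. *)

theory Defs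
  imports "HOL-Analysis.Analysis"
begin

type_synonym c4 = "complex \<times> complex \<times> complex \<times> complex"

definition exton_K2 ::
  "complex \<Rightarrow> complex \<Rightarrow> complex \<Rightarrow> complex \<Rightarrow> complex \<Rightarrow> complex \<Rightarrow> complex \<Rightarrow> c4 \<Rightarrow> complex" where
  "exton_K2 a b c e1 e2 e3 e4 = (\<lambda>(x, y, z, t).
     (\<Sum>\<^sub>\<infinity>(m, n, p, q)\<in>UNIV.
        pochhammer a (m + n + p + q) * pochhammer b (m + n + q) * pochhammer c p /
        (pochhammer e1 m * pochhammer e2 n * pochhammer e3 p * pochhammer e4 q) *
        (x ^ m / fact m) * (y ^ n / fact n) * (z ^ p / fact p) * (t ^ q / fact q)))"

text \<open>
  The quadruple series converges absolutely when
  \<open>(\<surd>|x| + \<surd>|y| + \<surd>|t|)\<^sup>2 + |z| < 1\<close>.  The powers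
  \<open>x\<^sup>1\<^sup>-\<^sup>e\<close> occurring in the solutions are multivalued; we take principal branches
  (this is what \<open>powr\<close> means on the complex numbers), so every variable avoids the
  cut along the nonpositive real axis, on which \<open>powr\<close> is not holomorphic.
\<close>

definition K2_domain :: "c4 set" where
  "K2_domain = {(x, y, z, t).
     (sqrt (norm x) + sqrt (norm y) + sqrt (norm t))\<^sup>2 + norm z < 1 \<and>
     x \<notin> \<real>\<^sub>\<le>\<^sub>0 \<and> y \<notin> \<real>\<^sub>\<le>\<^sub>0 \<and> z \<notin> \<real>\<^sub>\<le>\<^sub>0 \<and> t \<notin> \<real>\<^sub>\<le>\<^sub>0}"

definition d_x :: "(c4 \<Rightarrow> complex) \<Rightarrow> c4 \<Rightarrow> complex" where
  "d_x u = (\<lambda>(x, y, z, t). deriv (\<lambda>s. u (s, y, z, t)) x)"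

definition d_y :: "(c4 \<Rightarrow> complex) \<Rightarrow> c4 \<Rightarrow> complex" where
  "d_y u = (\<lambda>(x, y, z, t). deriv (\<lambda>s. u (x, s, z, t)) y)"

definition d_z :: "(c4 \<Rightarrow> complex) \<Rightarrow> c4 \<Rightarrow> complex" where
  "d_z u = (\<lambda>(x, y, z, t). deriv (\<lambda>s. u (x, y, s, t)) z)"

definition d_t :: "(c4 \<Rightarrow> complex) \<Rightarrow> c4 \<Rightarrow> complex" where
  "d_t u = (\<lambda>(x, y, z, t). deriv (\<lambda>s. u (x, y, z, s)) t)"

text \<open>
  Holomorphy in four variables: complex (Frechet) differentiability, that is, the
  real derivative exists and is complex linear.  Partial derivatives of all orders
  then exist on an open set, so none of the \<open>deriv\<close> terms below is a junk value.
\<close>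

definition holomorphic4_on :: "(c4 \<Rightarrow> complex) \<Rightarrow> c4 set \<Rightarrow> bool" where
  "holomorphic4_on u D \<longleftrightarrow> (\<forall>P\<in>D. \<exists>A B C E.
     (u has_derivative (\<lambda>(h1, h2, h3, h4). A * h1 + B * h2 + C * h3 + E * h4)) (at P))"

definition K2_system_solution ::
  "complex \<Rightarrow> complex \<Rightarrow> complex \<Rightarrow> complex \<Rightarrow> complex \<Rightarrow> complex \<Rightarrow> complex
    \<Rightarrow> c4 set \<Rightarrow> (c4 \<Rightarrow> complex) \<Rightarrow> bool" where
  "K2_system_solution a b c e1 e2 e3 e4 D u \<longleftrightarrow>
     holomorphic4_on u D \<and>
     (\<forall>x y z t. (x, y, z, t) \<in> D \<longrightarrow>
       (let P = (x, y, z, t);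
            U = u P;
            ux = d_x u P; uy = d_y u P; uz = d_z u P; ut = d_t u P;
            uxx = d_x (d_x u) P; uyy = d_y (d_y u) P;
            uzz = d_z (d_z u) P; utt = d_t (d_t u) P;
            uxy = d_y (d_x u) P; uxz = d_z (d_x u) P; uxt = d_t (d_x u) P;
            uyz = d_z (d_y u) P; uyt = d_t (d_y u) P; uzt = d_t (d_z u) P
        in
          x * (1 - x) * uxx - y\<^sup>2 * uyy - t\<^sup>2 * utt - 2 * x * y * uxy - x * z * uxz
            - 2 * x * t * uxt - y * z * uyz - 2 * y * t * uyt - z * t * uzt
            + (e1 - (a + b + 1) * x) * ux - (a + b + 1) * y * uy - b * z * uz
            - (a + b + 1) * t * ut - a * b * U = 0 \<and>
          y * (1 - y) * uyy - x\<^sup>2 * uxx - t\<^sup>2 * utt - 2 * x * y * uxy - x * z * uxz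
            - 2 * x * t * uxt - y * z * uyz - 2 * y * t * uyt - z * t * uzt
            - (a + b + 1) * x * ux + (e2 - (a + b + 1) * y) * uy - b * z * uz
            - (a + b + 1) * t * ut - a * b * U = 0 \<and>
          z * (1 - z) * uzz - x * z * uxz - y * z * uyz - z * t * uzt
            - c * x * ux - c * y * uy + (e3 - (a + c + 1) * z) * uz
            - c * t * ut - a * c * U = 0 \<and>
          t * (1 - t) * utt - x\<^sup>2 * uxx - y\<^sup>2 * uyy - 2 * x * y * uxy - x * z * uxz
            - 2 * x * t * uxt - y * z * uyz - 2 * y * t * uyt - z * t * uzt
            - (a + b + 1) * x * ux - (a + b + 1) * y * uy - b * z * uz
            + (e4 - (a + b + 1) * t) * ut - a * b * U = 0))"

text \<open>The functions \<open>u\<^sub>1, \<dots>, u\<^sub>1\<^sub>6\<close>; the index \<open>j\<close> ranges over \<open>{1..16}\<close>.\<close>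

definition K2_sol ::
  "complex \<Rightarrow> complex \<Rightarrow> complex \<Rightarrow> complex \<Rightarrow> complex \<Rightarrow> complex \<Rightarrow> complex
    \<Rightarrow> nat \<Rightarrow> c4 \<Rightarrow> complex" where
  "K2_sol a b c e1 e2 e3 e4 j = (\<lambda>(x, y, z, t).
    [
     exton_K2 a b c
         e1 e2 e3 e4 (x, y, z, t),
     x powr (1 - e1) *
       exton_K2 (1 - e1 + a) (1 - e1 + b) c
         (2 - e1) e2 e3 e4 (x, y, z, t),
     y powr (1 - e2) *
       exton_K2 (1 - e2 + a) (1 - e2 + b) c
         e1 (2 - e2) e3 e4 (x, y, z, t),
     z powr (1 - e3) *
       exton_K2 (1 - e3 + a) b (1 - e3 + c)
         e1 e2 (2 - e3) e4 (x, y, z, t),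
     t powr (1 - e4) *
       exton_K2 (1 - e4 + a) (1 - e4 + b) c
         e1 e2 e3 (2 - e4) (x, y, z, t),
     x powr (1 - e1) * y powr (1 - e2) *
       exton_K2 (2 - e1 - e2 + a) (2 - e1 - e2 + b) c
         (2 - e1) (2 - e2) e3 e4 (x, y, z, t),
     x powr (1 - e1) * z powr (1 - e3) *
       exton_K2 (2 - e1 - e3 + a) (1 - e1 + b) (1 - e3 + c)
         (2 - e1) e2 (2 - e3) e4 (x, y, z, t),
     x powr (1 - e1) * t powr (1 - e4) *
       exton_K2 (2 - e1 - e4 + a) (2 - e1 - e4 + b) c
         (2 - e1) e2 e3 (2 - e4) (x, y, z, t),
     y powr (1 - e2) * z powr (1 - e3) *
       exton_K2 (2 - e2 - e3 + a) (1 - e2 + b) (1 - e3 + c)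
         e1 (2 - e2) (2 - e3) e4 (x, y, z, t),
     y powr (1 - e2) * t powr (1 - e4) *
       exton_K2 (2 - e2 - e4 + a) (2 - e2 - e4 + b) c
         e1 (2 - e2) e3 (2 - e4) (x, y, z, t),
     z powr (1 - e3) * t powr (1 - e4) *
       exton_K2 (2 - e3 - e4 + a) (1 - e4 + b) (1 - e3 + c)
         e1 e2 (2 - e3) (2 - e4) (x, y, z, t),
     x powr (1 - e1) * y powr (1 - e2) * z powr (1 - e3) *
       exton_K2 (3 - e1 - e2 - e3 + a) (2 - e1 - e2 + b) (1 - e3 + c)
         (2 - e1) (2 - e2) (2 - e3) e4 (x, y, z, t),
     x powr (1 - e1) * y powr (1 - e2) * t powr (1 - e4) *
       exton_K2 (3 - e1 - e2 - e4 + a) (3 - e1 - e2 - e4 + b) c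
         (2 - e1) (2 - e2) e3 (2 - e4) (x, y, z, t),
     x powr (1 - e1) * z powr (1 - e3) * t powr (1 - e4) *
       exton_K2 (3 - e1 - e3 - e4 + a) (2 - e1 - e4 + b) (1 - e3 + c)
         (2 - e1) e2 (2 - e3) (2 - e4) (x, y, z, t),
     y powr (1 - e2) * z powr (1 - e3) * t powr (1 - e4) *
       exton_K2 (3 - e2 - e3 - e4 + a) (2 - e2 - e4 + b) (1 - e3 + c)
         e1 (2 - e2) (2 - e3) (2 - e4) (x, y, z, t),
     x powr (1 - e1) * y powr (1 - e2) * z powr (1 - e3) * t powr (1 - e4) *
       exton_K2 (4 - e1 - e2 - e3 - e4 + a) (3 - e1 - e2 - e4 + b) (1 - e3 + c)
         (2 - e1) (2 - e2) (2 - e3) (2 - e4) (x, y, z, t)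
    ] ! (j - 1))"

definition lin_indep_on :: "c4 set \<Rightarrow> nat set \<Rightarrow> (nat \<Rightarrow> c4 \<Rightarrow> complex) \<Rightarrow> bool" where
  "lin_indep_on D J f \<longleftrightarrow>
     (\<forall>k :: nat \<Rightarrow> complex. (\<forall>P\<in>D. (\<Sum>j\<in>J. k j * f j P) = 0) \<longrightarrow> (\<forall>j\<in>J. k j = 0))"

end

theory Submission
  imports Defs "HOL-Complex_Analysis.Complex_Analysis" "HOL-Real_Asymp.Real_Asymp"
begin

text \<open>
  In terms of the Euler operators \<open>\<theta>\<^sub>w = w \<partial>\<^sub>w\<close> the system reads \<open>w u\<^sub>w\<^sub>w + e u\<^sub>w = A B u\<close> for \<open>w\<close> among
  \<open>x, y, t\<close> and \<open>z u\<^sub>z\<^sub>z + e\<^sub>3 u\<^sub>z = A C u\<close>, where \<open>A = \<theta>\<^sub>x + \<theta>\<^sub>y + \<theta>\<^sub>z + \<theta>\<^sub>t + a\<close>,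
  \<open>B = \<theta>\<^sub>x + \<theta>\<^sub>y + \<theta>\<^sub>t + b\<close> and \<open>C = \<theta>\<^sub>z + c\<close>. On a monomial the right side is multiplication by a
  scalar and the left side lowers one exponent, so a series of monomials solves the system when its
  coefficients satisfy a two-term recurrence in each variable and its initial exponents are \<open>0\<close> or
  \<open>1 - e\<close>. The sixteen choices of initial exponents give the sixteen functions. The series converges
  locally normally, because its terms are dominated by \<open>C (R\<^sup>3 ((\<surd>|x| + \<surd>|y| + \<surd>|t|)\<^sup>2 + |z|))\<^sup>N\<close> in
  total degree \<open>N\<close> (\<open>K2_term_bound\<close>), and may therefore be differentiated term by term
  (\<open>loc_summable_dir_deriv\<close>, \<open>branch_solves\<close>).

  That there are no further solutions rests on the observation that the same inequality
  \<open>(\<surd>|x| + \<surd>|y| + \<surd>|t|)\<^sup>2 + |z| < 1\<close> makes the principal part of the system a contraction. If all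
  derivatives of a solution of order less than \<open>n\<close> vanish at a point, the equations express each
  derivative of order \<open>n\<close> that contains a repeated variable through the others of order \<open>n\<close>, and in a
  suitably weighted sup norm this has norm less than \<open>1\<close>. Hence a solution whose sixteen derivatives
  along squarefree words vanish at one point is flat there (\<open>squarefree_flat\<close>), so it is zero near
  that point and, the domain being connected, everywhere (\<open>jet_determines\<close>).

  For linear independence, a relation on \<open>D\<close> extends by this uniqueness to the connected slit domain
  \<open>K2_domain\<close>. There the variables are separated one at a time: the values of
  \<open>g\<^sub>0(s) + s powr (1 - e) g\<^sub>1(s)\<close> on the two sides of the negative axis force \<open>g\<^sub>0(0) = g\<^sub>1(0) = 0\<close>
  when \<open>e\<close> is not an integer (\<open>slit_separation\<close>, \<open>branch_peeling\<close>), and at the origin only the single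
  coefficient is left. So the \<open>16 \<times> 16\<close> matrix of squarefree jets of the sixteen functions is
  invertible; any solution has the jet of some combination of them, and equals it
  (\<open>solution_is_combination\<close>).
\<close>

section \<open>Directional derivatives of holomorphic functions of four variables\<close>

definition cscale :: "complex \<Rightarrow> c4 \<Rightarrow> c4" where
  "cscale s = (\<lambda>(a, b, c, d). (s * a, s * b, s * c, s * d))"

lemma cscale_add_left: "cscale (s + t) v = cscale s v + cscale t v"
  by (cases v) (simp add: cscale_def algebra_simps)

lemma cscale_zero [simp]: "cscale 0 v = 0"
  by (cases v) (simp add: cscale_def zero_prod_def)

lemma norm_cscale: "norm (cscale s v) = norm s * norm v"
proof -
  have *: "norm (s * a, y) = norm s * norm (a, x)" if "norm y = norm s * norm x"
    for a :: complex and x y :: "'a::real_normed_vector"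
  proof -
    have "norm (s * a, y) = sqrt ((norm s)\<^sup>2 * ((norm a)\<^sup>2 + (norm x)\<^sup>2))"
      by (simp add: norm_Pair norm_mult that power_mult_distrib algebra_simps)
    also have "\<dots> = norm s * norm (a, x)"
      by (simp add: real_sqrt_mult norm_Pair)
    finally show ?thesis .
  qed
  obtain a b c d where v: "v = (a, b, c, d)"
    by (metis prod.exhaust)
  show ?thesis
    unfolding v cscale_def prod.case
    by (intro *) (simp add: norm_mult)
qed

lemma continuous_on_cscale [continuous_intros]:
  "continuous_on S f \<Longrightarrow> continuous_on S (\<lambda>x. cscale (f x) v)"
  by (cases v) (auto simp: cscale_def intro!: continuous_intros)

text \<open>
  Complex lines through \<open>P\<close> are parametrised by \<open>s \<mapsto> P + cscale s v\<close>. Working with all directions \<open>v\<close> at once treats the four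
  partial derivatives uniformly and makes restriction to lines through a point available.
\<close>
definition dir_deriv :: "c4 \<Rightarrow> (c4 \<Rightarrow> complex) \<Rightarrow> c4 \<Rightarrow> complex" where
  "dir_deriv v u P = deriv (\<lambda>s. u (P + cscale s v)) 0"

lemma line_derivative_shift:
  "((\<lambda>s. u (P + cscale s v)) has_field_derivative c) (at s0) \<longleftrightarrow>
   ((\<lambda>s. u (P + cscale s0 v + cscale s v)) has_field_derivative c) (at 0)"
  using DERIV_shift[of "\<lambda>s. u (P + cscale s v)" c 0 s0]
  by (simp add: cscale_add_left algebra_simps)

lemma deriv_line: "deriv (\<lambda>s. u (P + cscale s v)) s0 = dir_deriv v u (P + cscale s0 v)"
  unfolding dir_deriv_def deriv_def line_derivative_shift[of u P v _ s0] ..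

definition sliced :: "c4 \<Rightarrow> (c4 \<Rightarrow> complex) \<Rightarrow> c4 set \<Rightarrow> bool" where
  "sliced v u D \<longleftrightarrow> (\<forall>P\<in>D. (\<lambda>s. u (P + cscale s v)) field_differentiable at 0)"

lemma sliced_has_derivative:
  assumes "sliced v u D" "P + cscale s0 v \<in> D"
  shows "((\<lambda>s. u (P + cscale s v)) has_field_derivative dir_deriv v u (P + cscale s0 v)) (at s0)"
proof -
  have "(\<lambda>s. u (P + cscale s0 v + cscale s v)) field_differentiable at 0"
    using assms unfolding sliced_def by blast
  then show ?thesis
    unfolding line_derivative_shift[of u P v _ s0] dir_deriv_def
    by (simp add: DERIV_deriv_iff_field_differentiable)
qed

lemma line_in_open:
  assumes "open D" "P \<in> D"
  obtains r where "0 < r" "\<And>Q s. Q \<in> cball P r \<Longrightarrow> norm s \<le> r \<Longrightarrow> Q + cscale s v \<in> D"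
proof -
  obtain e where e: "0 < e" "cball P e \<subseteq> D"
    using assms open_contains_cball by blast
  define r where "r = e / (2 * (1 + norm v))"
  have pos: "0 < 1 + norm v"
    using norm_ge_zero[of v] by linarith
  have r0: "0 < r" using e pos by (simp add: r_def)
  have rr: "r * (1 + norm v) = e / 2" using pos unfolding r_def by (simp add: field_simps)
  have "Q + cscale s v \<in> D" if "Q \<in> cball P r" "norm s \<le> r" for Q s
  proof -
    have "norm (cscale s v) \<le> r * norm v"
      unfolding norm_cscale using that by (simp add: mult_right_mono)
    moreover have "dist P (Q + cscale s v) \<le> dist P Q + norm (cscale s v)"
      using dist_triangle[of P "Q + cscale s v" Q] by (simp add: dist_norm)
    ultimately have "dist P (Q + cscale s v) \<le> r + r * norm v" using that by auto
    then have "Q + cscale s v \<in> cball P e" using rr e by (simp add: algebra_simps)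
    then show ?thesis using e by blast
  qed
  then show ?thesis using that r0 by blast
qed

lemma line_holomorphic:
  assumes "sliced v u D" and inD: "\<And>s. norm s \<le> r \<Longrightarrow> P + cscale s v \<in> D"
  shows "continuous_on (cball 0 r) (\<lambda>s. u (P + cscale s v))"
    and "(\<lambda>s. u (P + cscale s v)) holomorphic_on ball 0 r"
proof -
  define g where "g = (\<lambda>s. u (P + cscale s v))"
  have der: "(g has_field_derivative dir_deriv v u (P + cscale s v)) (at s)" if "norm s \<le> r" for s
    unfolding g_def by (intro sliced_has_derivative[OF assms(1)] inD that)
  have "isCont g s" if "s \<in> cball 0 r" for s
    using that by (intro DERIV_isCont[OF der]) simp
  then show "continuous_on (cball 0 r) (\<lambda>s. u (P + cscale s v))"
    unfolding g_def by (simp add: continuous_at_imp_continuous_on)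
  have "g field_differentiable at s within ball 0 r" if "s \<in> ball 0 r" for s
    using der[of s] that unfolding field_differentiable_def
    by (auto intro: has_field_derivative_at_within)
  then show "(\<lambda>s. u (P + cscale s v)) holomorphic_on ball 0 r"
    unfolding g_def holomorphic_on_def by blast
qed

text \<open>
  Cauchy's formula on the circle of radius \<open>r\<close> in the complex line through \<open>P\<close>. Written as an
  integral over a fixed interval, it can be differentiated and its continuity in \<open>P\<close> can be read off;
  this is how regularity in the other variables is transferred to the derivative.
\<close>
lemma dir_deriv_integral:
  assumes "sliced v u D" "0 < r" and inD: "\<And>s. norm s \<le> r \<Longrightarrow> P + cscale s v \<in> D"
  shows "dir_deriv v u P =
    integral (cbox 0 1) (\<lambda>\<theta>::real. u (P + cscale (r * exp (2 * of_real pi * \<i> * of_real \<theta>)) v)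
       * exp (- (2 * of_real pi * \<i> * of_real \<theta>)) / r)"
proof -
  define g where "g = (\<lambda>s. u (P + cscale s v))"
  have gh: "continuous_on (cball 0 r) g" "g holomorphic_on ball 0 r"
    unfolding g_def by (rule line_holomorphic[OF assms(1)], rule inD, assumption)+
  have "contour_integral (circlepath 0 r) (\<lambda>s. g s / s\<^sup>2) = 2 * pi * \<i> * deriv g 0"
    using Cauchy_contour_integral_circlepath_2[OF gh, of 0] \<open>0 < r\<close> by simp
  moreover have "deriv g 0 = dir_deriv v u P"
    unfolding g_def dir_deriv_def ..
  moreover have "contour_integral (circlepath 0 r) (\<lambda>s. g s / s\<^sup>2) =
     integral (cbox 0 1) (\<lambda>\<theta>::real. 2 * pi * \<i> * (g (r * exp (2 * of_real pi * \<i> * of_real \<theta>))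
       * exp (- (2 * of_real pi * \<i> * of_real \<theta>)) / r))"
  proof -
    have "g w / w\<^sup>2 * vector_derivative (circlepath 0 r) (at x) =
       2 * pi * \<i> * (g w * exp (- (2 * of_real pi * \<i> * of_real x)) / r)"
      if "x \<in> {0..1}" and w: "w = circlepath 0 r x" for x w
    proof -
      have *: "vector_derivative (circlepath 0 r) (at x)
          = 2 * pi * \<i> * r * exp (2 * of_real pi * \<i> * x)"
        by (simp add: vector_derivative_circlepath)
      show ?thesis
        using \<open>0 < r\<close> unfolding * unfolding w circlepath by (simp add: exp_minus field_simps power2_eq_square)
    qed
    then show ?thesis
      unfolding contour_integral_integral box_real
      by (intro integral_cong) (simp add: circlepath)
  qed
  ultimately have "2 * pi * \<i> * dir_deriv v u P = 2 * pi * \<i> *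
    integral (cbox 0 1) (\<lambda>\<theta>::real. g (r * exp (2 * of_real pi * \<i> * of_real \<theta>))
       * exp (- (2 * of_real pi * \<i> * of_real \<theta>)) / r)"
    by (simp only: integral_mult_right)
  then show ?thesis
    by (simp only: g_def mult_cancel_left) simp
qed

lemma dir_deriv_continuous:
  assumes "open D" "continuous_on D u" "sliced v u D"
  shows "continuous_on D (dir_deriv v u)"
proof -
  have "isCont (dir_deriv v u) P" if PD: "P \<in> D" for P
  proof -
    obtain r where r: "0 < r" "\<And>Q s. Q \<in> cball P r \<Longrightarrow> norm s \<le> r \<Longrightarrow> Q + cscale s v \<in> D"
      using line_in_open[OF assms(1) PD] by metis
    define F where "F = (\<lambda>Q (\<theta>::real). u (Q + cscale (r * exp (2 * of_real pi * \<i> * of_real \<theta>)) v)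
       * exp (- (2 * of_real pi * \<i> * of_real \<theta>)) / r)"
    have "continuous_on (ball P r \<times> cbox 0 1) (\<lambda>(Q, \<theta>). F Q \<theta>)"
      unfolding F_def case_prod_beta
      using r by (intro continuous_intros continuous_on_compose2[OF assms(2)])
         (auto simp: norm_mult norm_exp_eq_Re)
    then have "continuous_on (ball P r) (\<lambda>Q. integral (cbox 0 1) (F Q))"
      by (rule integral_continuous_on_param)
    moreover have "dir_deriv v u Q = integral (cbox 0 1) (F Q)" if "Q \<in> ball P r" for Q
      unfolding F_def using r that by (intro dir_deriv_integral[OF assms(3)]) auto
    ultimately have "continuous_on (ball P r) (dir_deriv v u)"
      by (subst continuous_on_cong[OF refl]) auto
    then show ?thesis
      using r by (simp add: continuous_on_eq_continuous_at)
  qed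
  then show ?thesis
    by (simp add: continuous_at_imp_continuous_on)
qed

text \<open>
  Differentiation under the integral sign. The integral on the right is not yet recognised as
  \<open>dir_deriv v (dir_deriv w u) P\<close>: that needs \<open>dir_deriv w u\<close> to be differentiable along \<open>v\<close>, which is
  this very lemma with the two directions exchanged. Hence existence and symmetry of second
  derivatives are obtained in two steps below.
\<close>
lemma dir_deriv_dir_deriv_integral:
  assumes "open D" "continuous_on D u" "sliced v u D" "sliced w u D"
    and "0 < r" and inD: "\<And>s. norm s \<le> r \<Longrightarrow> P + cscale s v \<in> D"
  shows "((\<lambda>s. dir_deriv v u (P + cscale s w)) has_field_derivative
    integral (cbox 0 1) (\<lambda>\<theta>::real. dir_deriv w u (P + cscale (r * exp (2 * of_real pi * \<i> * of_real \<theta>)) v)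
       * exp (- (2 * of_real pi * \<i> * of_real \<theta>)) / r)) (at 0)"
proof -
  \<comment> \<open>A tube around the closed disc, so that the disc may be moved along \<open>w\<close> inside \<open>D\<close>.\<close>
  define K where "K = (\<lambda>s. P + cscale s v) ` cball 0 r"
  have "compact K"
    unfolding K_def by (intro compact_continuous_image continuous_intros compact_cball)
  moreover have "K \<subseteq> D" using inD by (auto simp: K_def)
  ultimately obtain e where e: "0 < e" "(\<Union>x\<in>K. cball x e) \<subseteq> D"
    using compact_subset_open_imp_cball_epsilon_subset[OF _ assms(1)] by metis
  define d where "d = e / (1 + norm w)"
  have d0: "0 < d" using e by (simp add: d_def add_pos_nonneg)
  have dw: "d * norm w \<le> e"
    unfolding d_def using e by (simp add: field_simps add_pos_nonneg)
  have inD2: "P + cscale s w + cscale t v \<in> D" if "norm s < d" "norm t \<le> r" for s t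
  proof -
    have "norm (cscale s w) \<le> d * norm w"
      unfolding norm_cscale using that by (intro mult_right_mono) auto
    then have "P + cscale t v + cscale s w \<in> cball (P + cscale t v) e"
      using dw by (simp add: dist_norm)
    moreover have "P + cscale t v \<in> K" using that by (auto simp: K_def)
    ultimately have "P + cscale t v + cscale s w \<in> D" using e by blast
    then show ?thesis by (simp add: algebra_simps)
  qed
  define F where "F = (\<lambda>s (\<theta>::real). u (P + cscale s w + cscale (r * exp (2 * of_real pi * \<i> * of_real \<theta>)) v)
       * exp (- (2 * of_real pi * \<i> * of_real \<theta>)) / r)"
  define F' where "F' = (\<lambda>s (\<theta>::real). dir_deriv w u (P + cscale s w + cscale (r * exp (2 * of_real pi * \<i> * of_real \<theta>)) v)
       * exp (- (2 * of_real pi * \<i> * of_real \<theta>)) / r)"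
  have nr: "norm (r * exp (2 * of_real pi * \<i> * of_real \<theta>)) \<le> r" for \<theta> :: real
    using \<open>0 < r\<close> by (simp add: norm_mult norm_exp_eq_Re)
  have cF: "continuous_on (ball 0 d \<times> cbox 0 1) (\<lambda>(s, \<theta>). F s \<theta>)"
    unfolding F_def case_prod_beta using inD2 nr \<open>0 < r\<close>
    by (intro continuous_intros continuous_on_compose2[OF assms(2)]) auto
  have cF': "continuous_on (ball 0 d \<times> cbox 0 1) (\<lambda>(s, \<theta>). F' s \<theta>)"
    unfolding F'_def case_prod_beta using inD2 nr \<open>0 < r\<close>
    by (intro continuous_intros continuous_on_compose2[OF dir_deriv_continuous[OF assms(1,2,4)]]) auto
  have "((\<lambda>s. integral (cbox 0 1) (F s)) has_field_derivative integral (cbox 0 1) (F' 0)) (at 0 within ball 0 d)"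
  proof (rule leibniz_rule_field_derivative[OF _ _ cF'])
    show "((\<lambda>x. F x t) has_field_derivative F' x t) (at x within ball 0 d)"
      if "x \<in> ball 0 d" "t \<in> cbox 0 1" for x and t :: real
    proof -
      let ?c = "cscale (r * exp (2 * of_real pi * \<i> * of_real t)) v"
      have "((\<lambda>s. u (P + ?c + cscale s w)) has_field_derivative dir_deriv w u (P + ?c + cscale x w)) (at x)"
        using that inD2[OF _ nr, of x t] by (intro sliced_has_derivative[OF assms(4)]) (simp add: add.assoc add.commute[of "cscale x w"])
      then have "((\<lambda>s. u (P + cscale s w + ?c)) has_field_derivative dir_deriv w u (P + cscale x w + ?c)) (at x)"
        by (simp add: algebra_simps)
      then have "((\<lambda>s. u (P + cscale s w + ?c)) has_field_derivative dir_deriv w u (P + cscale x w + ?c)) (at x within ball 0 d)"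
        by (rule has_field_derivative_at_within)
      from DERIV_cmult_right[OF this, of "exp (- (2 * of_real pi * \<i> * of_real t)) / r"]
      show ?thesis unfolding F_def F'_def by simp
    qed
    show "F x integrable_on cbox 0 1" if "x \<in> ball 0 d" for x
    proof -
      have "continuous_on (cbox 0 1) (\<lambda>t. case (x, t) of (s, \<theta>) \<Rightarrow> F s \<theta>)"
        using that by (intro continuous_on_compose2[OF cF]) (auto intro!: continuous_intros)
      then show ?thesis by (intro integrable_continuous) simp
    qed
  qed (use d0 in auto)
  then have "((\<lambda>s. integral (cbox 0 1) (F s)) has_field_derivative integral (cbox 0 1) (F' 0)) (at 0)"
    using d0 by (simp add: at_within_open[of 0 "ball 0 d"])
  moreover have "integral (cbox 0 1) (F s) = dir_deriv v u (P + cscale s w)" if "s \<in> ball 0 d" for s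
    unfolding F_def using inD2 that \<open>0 < r\<close> by (intro dir_deriv_integral[OF assms(3), symmetric]) auto
  ultimately have "((\<lambda>s. dir_deriv v u (P + cscale s w)) has_field_derivative integral (cbox 0 1) (F' 0)) (at 0)"
    using d0 by (elim has_field_derivative_transform_within_open[where S = "ball 0 d"]) auto
  then show ?thesis by (simp add: F'_def)
qed

lemma dir_deriv_sliced:
  assumes "open D" "continuous_on D u" "sliced v u D" "sliced w u D"
  shows "sliced w (dir_deriv v u) D"
  unfolding sliced_def
proof
  fix P assume "P \<in> D"
  then obtain r where "0 < r" "\<And>Q s. Q \<in> cball P r \<Longrightarrow> norm s \<le> r \<Longrightarrow> Q + cscale s v \<in> D"
    using line_in_open[OF assms(1)] by metis
  then show "(\<lambda>s. dir_deriv v u (P + cscale s w)) field_differentiable at 0"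
    using dir_deriv_dir_deriv_integral[OF assms, of r P] unfolding field_differentiable_def by auto
qed

lemma dir_deriv_commute:
  assumes "open D" "continuous_on D u" "sliced v u D" "sliced w u D" "P \<in> D"
  shows "dir_deriv w (dir_deriv v u) P = dir_deriv v (dir_deriv w u) P"
proof -
  obtain r where r: "0 < r" "\<And>Q s. Q \<in> cball P r \<Longrightarrow> norm s \<le> r \<Longrightarrow> Q + cscale s v \<in> D"
    using line_in_open[OF assms(1,5)] by metis
  then have *: "P + cscale s v \<in> D" if "norm s \<le> r" for s
    using that by auto
  have "dir_deriv w (dir_deriv v u) P = 
    integral (cbox 0 1) (\<lambda>\<theta>::real. dir_deriv w u (P + cscale (r * exp (2 * of_real pi * \<i> * of_real \<theta>)) v)
       * exp (- (2 * of_real pi * \<i> * of_real \<theta>)) / r)"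
    using DERIV_imp_deriv[OF dir_deriv_dir_deriv_integral[OF assms(1-4) r(1) *]] unfolding dir_deriv_def[of w "dir_deriv v u"] .
  also have "\<dots> = dir_deriv v (dir_deriv w u) P"
    by (rule dir_deriv_integral[symmetric, OF dir_deriv_sliced[OF assms(1,2,4,3)] r(1) *])
  finally show ?thesis .
qed

lemma holomorphic4_subset: "holomorphic4_on u D \<Longrightarrow> E \<subseteq> D \<Longrightarrow> holomorphic4_on u E"
  unfolding holomorphic4_on_def by blast

lemma holomorphic4_continuous:
  assumes "holomorphic4_on u D" shows "continuous_on D u"
  using assms unfolding holomorphic4_on_def
  by (meson continuous_at_imp_continuous_on has_derivative_continuous)

datatype var = VX | VY | VZ | VT

lemma UNIV_var: "UNIV = {VX, VY, VZ, VT}"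
  using var.exhaust by auto

instance var :: finite
  by standard (simp add: UNIV_var)

fun unit_vec :: "var \<Rightarrow> c4" where
  "unit_vec VX = (1, 0, 0, 0)"
| "unit_vec VY = (0, 1, 0, 0)"
| "unit_vec VZ = (0, 0, 1, 0)"
| "unit_vec VT = (0, 0, 0, 1)"

fun coord :: "var \<Rightarrow> c4 \<Rightarrow> complex" where
  "coord VX (x, y, z, t) = x"
| "coord VY (x, y, z, t) = y"
| "coord VZ (x, y, z, t) = z"
| "coord VT (x, y, z, t) = t"

abbreviation part_deriv :: "var \<Rightarrow> (c4 \<Rightarrow> complex) \<Rightarrow> c4 \<Rightarrow> complex" where
  "part_deriv i \<equiv> dir_deriv (unit_vec i)"

lemma sum_var: "(\<Sum>i\<in>UNIV. f i) = f VX + f VY + f VZ + f VT"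
  by (simp add: UNIV_var add.assoc)

lemma norm_unit_vec [simp]: "norm (unit_vec i) = 1"
  by (cases i) (simp_all add: norm_Pair)

lemma norm_cscale_unit_vec: "norm (cscale s (unit_vec i)) = norm s"
  by (simp add: norm_cscale del: unit_vec.simps)

lemma bounded_linear_cscale: "bounded_linear (\<lambda>s. cscale s v)"
  by (cases v) (auto simp: cscale_def intro!: bounded_linear_Pair bounded_linear_mult_left)

lemma holomorphic4_line_derivative:
  assumes "(u has_derivative (\<lambda>(h1, h2, h3, h4). A * h1 + B * h2 + C * h3 + E * h4)) (at P)"
  shows "((\<lambda>s. u (P + cscale s v)) has_field_derivative
    (A * coord VX v + B * coord VY v + C * coord VZ v + E * coord VT v)) (at 0)"
proof -
  let ?L = "\<lambda>(h1, h2, h3, h4). A * h1 + B * h2 + C * h3 + E * h4"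
  have "((\<lambda>s. P + cscale s v) has_derivative (\<lambda>s. cscale s v)) (at 0)"
    by (auto intro!: derivative_eq_intros bounded_linear.has_derivative[OF bounded_linear_cscale])
  then have "((\<lambda>s. u (P + cscale s v)) has_derivative (\<lambda>s. ?L (cscale s v))) (at 0)"
    by (rule has_derivative_compose) (use assms in simp)
  moreover have "(\<lambda>s. ?L (cscale s v)) = (*) (A * coord VX v + B * coord VY v + C * coord VZ v + E * coord VT v)"
    by (cases v) (auto simp: cscale_def algebra_simps)
  ultimately show ?thesis
    unfolding has_field_derivative_def by simp
qed

lemma holomorphic4_sliced:
  assumes "holomorphic4_on u D" shows "sliced v u D"
  unfolding sliced_def field_differentiable_def
proof
  fix P assume "P \<in> D"
  then obtain A B C E where
    "(u has_derivative (\<lambda>(h1, h2, h3, h4). A * h1 + B * h2 + C * h3 + E * h4)) (at P)"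
    using assms unfolding holomorphic4_on_def by blast
  from holomorphic4_line_derivative[OF this]
  show "\<exists>c. ((\<lambda>s. u (P + cscale s v)) has_field_derivative c) (at 0)" by blast
qed

lemma dir_deriv_eq_sum:
  assumes "holomorphic4_on u D" "P \<in> D"
  shows "dir_deriv v u P = (\<Sum>i\<in>UNIV. coord i v * part_deriv i u P)"
proof -
  obtain A B C E where
    "(u has_derivative (\<lambda>(h1, h2, h3, h4). A * h1 + B * h2 + C * h3 + E * h4)) (at P)"
    using assms unfolding holomorphic4_on_def by blast
  note * = holomorphic4_line_derivative[OF this, THEN DERIV_imp_deriv, folded dir_deriv_def]
  show ?thesis
    unfolding sum_var * by simp
qed

text \<open>
  The mean value inequality along \<open>v\<close>, uniform in the base point \<open>Q\<close>. Uniformity is what allows the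
  increments in the four coordinates to be added one after the other.
\<close>
lemma increment_bound:
  assumes "open D" "continuous_on D u" "sliced v u D" "norm v = 1" "P \<in> D" "0 < \<epsilon>"
  obtains \<delta> where "0 < \<delta>" "\<And>Q s. norm (Q - P) < \<delta> \<Longrightarrow> norm s < \<delta> \<Longrightarrow>
    norm (u (Q + cscale s v) - u Q - s * dir_deriv v u P) \<le> \<epsilon> * norm s"
proof -
  have "isCont (dir_deriv v u) P"
    using dir_deriv_continuous[OF assms(1-3)] assms(1,5) continuous_on_eq_continuous_at by blast
  then obtain d1 where d1: "0 < d1" "\<And>Q. norm (Q - P) < d1 \<Longrightarrow> norm (dir_deriv v u Q - dir_deriv v u P) < \<epsilon>"
    unfolding continuous_at_eps_delta using assms(6) by (metis dist_norm)
  obtain d2 where d2: "0 < d2" "ball P d2 \<subseteq> D"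
    using assms(1,5) open_contains_ball by blast
  define \<delta> where "\<delta> = min d1 d2 / 2"
  have "norm (u (Q + cscale s v) - u Q - s * dir_deriv v u P) \<le> \<epsilon> * norm s"
    if Q: "norm (Q - P) < \<delta>" and s: "norm s < \<delta>" for Q s
  proof -
    have near: "norm (Q + cscale w v - P) < 2 * \<delta>" if "norm w < \<delta>" for w
    proof -
      have "norm (Q + cscale w v - P) \<le> norm (Q - P) + norm (cscale w v)"
        using norm_triangle_ineq[of "Q - P" "cscale w v"] by (simp add: algebra_simps)
      then show ?thesis using Q that assms(4) by (simp add: norm_cscale)
    qed
    \<comment> \<open>The derivative of \<open>f\<close> is small, because \<open>dir_deriv v u\<close> is continuous at \<open>P\<close>.\<close>
    define f where "f = (\<lambda>w. u (Q + cscale w v) - w * dir_deriv v u P)"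
    have "norm (f s - f 0) \<le> \<epsilon> * norm (s - 0)"
    proof (rule field_differentiable_bound[of "ball 0 \<delta>" f "\<lambda>w. dir_deriv v u (Q + cscale w v) - dir_deriv v u P"])
      fix w :: complex assume "w \<in> ball 0 \<delta>"
      then have n: "norm (Q + cscale w v - P) < 2 * \<delta>" using near by simp
      then have "Q + cscale w v \<in> D"
        using d2 by (auto simp: \<delta>_def dist_norm norm_minus_commute)
      then have "((\<lambda>w. u (Q + cscale w v)) has_field_derivative dir_deriv v u (Q + cscale w v)) (at w within ball 0 \<delta>)"
        by (rule has_field_derivative_at_within[OF sliced_has_derivative[OF assms(3)]])
      then show "(f has_field_derivative dir_deriv v u (Q + cscale w v) - dir_deriv v u P) (at w within ball 0 \<delta>)"
        unfolding f_def by (auto intro!: derivative_eq_intros)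
      show "norm (dir_deriv v u (Q + cscale w v) - dir_deriv v u P) \<le> \<epsilon>"
        using d1(2)[of "Q + cscale w v"] n by (simp add: \<delta>_def)
    qed (use s le_less_trans[OF norm_ge_zero s] in auto)
    then show ?thesis by (simp add: f_def algebra_simps)
  qed
  moreover have "0 < \<delta>" using d1 d2 by (simp add: \<delta>_def)
  ultimately show ?thesis using that by blast
qed

text \<open>
  Osgood's lemma. The increment of \<open>u\<close> is split into four increments parallel to the axes, and the
  partial derivatives are continuous by Cauchy's formula. It is the criterion by which derivatives
  and infinite sums are shown to be holomorphic again.
\<close>
lemma osgood:
  assumes "open D" "continuous_on D u" "\<And>i. sliced (unit_vec i) u D"
  shows "holomorphic4_on u D"
  unfolding holomorphic4_on_def
proof
  fix P assume P: "P \<in> D"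
  let ?L = "\<lambda>(h1, h2, h3, h4). part_deriv VX u P * h1 + part_deriv VY u P * h2 + part_deriv VZ u P * h3 + part_deriv VT u P * h4"
  have "(u has_derivative ?L) (at P)"
    unfolding has_derivative_at_alt
  proof (intro conjI allI impI)
    show "bounded_linear ?L"
      unfolding case_prod_beta
      by (intro bounded_linear_add bounded_linear_const_mult bounded_linear_fst_comp bounded_linear_snd_comp bounded_linear_ident
          bounded_linear_fst bounded_linear_snd)
    fix e :: real assume e: "0 < e"
    have "\<forall>i. \<exists>\<delta>>0. \<forall>Q s. norm (Q - P) < \<delta> \<longrightarrow> norm s < \<delta> \<longrightarrow>
        norm (u (Q + cscale s (unit_vec i)) - u Q - s * part_deriv i u P) \<le> e / 4 * norm s"
    proof
      fix i
      obtain \<delta> where "0 < \<delta>" "\<And>Q s. norm (Q - P) < \<delta> \<Longrightarrow> norm s < \<delta> \<Longrightarrow>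
          norm (u (Q + cscale s (unit_vec i)) - u Q - s * part_deriv i u P) \<le> e / 4 * norm s"
        using increment_bound[OF assms(1,2,3) norm_unit_vec P, of "e / 4" i] e by auto
      then show "\<exists>\<delta>>0. \<forall>Q s. norm (Q - P) < \<delta> \<longrightarrow> norm s < \<delta> \<longrightarrow>
        norm (u (Q + cscale s (unit_vec i)) - u Q - s * part_deriv i u P) \<le> e / 4 * norm s" by blast
    qed
    then obtain d where d: "\<And>i. 0 < d i" and inc: "\<And>i Q s. norm (Q - P) < d i \<Longrightarrow> norm s < d i \<Longrightarrow>
        norm (u (Q + cscale s (unit_vec i)) - u Q - s * part_deriv i u P) \<le> e / 4 * norm s"
      by metis
    define \<delta> where "\<delta> = min (min (d VX) (d VY)) (min (d VZ) (d VT)) / 4"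
    have \<delta>: "0 < \<delta>" "\<And>i. 4 * \<delta> \<le> d i"
    proof -
      show "0 < \<delta>" using d unfolding \<delta>_def by simp
      show "4 * \<delta> \<le> d i" for i by (cases i) (auto simp: \<delta>_def)
    qed
    have "norm (u Y - u P - ?L (Y - P)) \<le> e * norm (Y - P)" if Y: "norm (Y - P) < \<delta>" for Y
    proof -
      obtain h1 h2 h3 h4 where h: "Y - P = (h1, h2, h3, h4)" by (metis prod.exhaust)
      define n where "n = norm (Y - P)"
      have n1: "norm h1 \<le> n" "norm (h2, h3, h4) \<le> n"
        using norm_fst_le[of h1 "(h2, h3, h4)"] norm_snd_le[of "(h2, h3, h4)" h1] unfolding n_def h by auto
      have n2: "norm h2 \<le> n" "norm (h3, h4) \<le> n"
        using norm_fst_le[of h2 "(h3, h4)"] norm_snd_le[of "(h3, h4)" h2] n1 by auto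
      have n3: "norm h3 \<le> n" "norm h4 \<le> n"
        using norm_fst_le[of h3 h4] norm_snd_le[of h4 h3] n2 by auto
      have nd: "n < \<delta>" using Y by (simp add: n_def)
      define P1 where "P1 = P + cscale h1 (unit_vec VX)"
      define P2 where "P2 = P1 + cscale h2 (unit_vec VY)"
      define P3 where "P3 = P2 + cscale h3 (unit_vec VZ)"
      have Y4: "Y = P3 + cscale h4 (unit_vec VT)"
      proof -
        have "Y = P + (h1, h2, h3, h4)" using h by (metis add.commute diff_add_cancel)
        then show ?thesis unfolding P3_def P2_def P1_def by (simp add: cscale_def add.assoc)
      qed
      have m1: "norm (P1 - P) \<le> n" using n1 by (simp add: P1_def norm_cscale_unit_vec del: unit_vec.simps)
      have m2: "norm (P2 - P) \<le> 2 * n"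
        using norm_triangle_ineq[of "P1 - P" "cscale h2 (unit_vec VY)"] n2 m1
        by (simp add: P2_def norm_cscale_unit_vec algebra_simps del: unit_vec.simps)
      have m3: "norm (P3 - P) \<le> 3 * n"
        using norm_triangle_ineq[of "P2 - P" "cscale h3 (unit_vec VZ)"] n3 m2
        by (simp add: P3_def norm_cscale_unit_vec algebra_simps del: unit_vec.simps)
      have step: "norm (u (Q + cscale s (unit_vec i)) - u Q - s * part_deriv i u P) \<le> e / 4 * n"
        if "norm (Q - P) \<le> 3 * n" "norm s \<le> n" for Q s i
      proof -
        have "norm (Q - P) < d i" "norm s < d i"
          using that nd \<delta>(2)[of i] norm_ge_zero[of s] by linarith+
        from inc[OF this] show ?thesis
          using mult_left_mono[OF that(2), of "e / 4"] e by linarith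
      qed
      have n0: "0 \<le> n" by (simp add: n_def)
      have s1: "norm (u P1 - u P - h1 * part_deriv VX u P) \<le> e / 4 * n"
        unfolding P1_def using n1 n0 by (intro step) auto
      have s2: "norm (u P2 - u P1 - h2 * part_deriv VY u P) \<le> e / 4 * n"
        unfolding P2_def using m1 n2 n0 by (intro step) auto
      have s3: "norm (u P3 - u P2 - h3 * part_deriv VZ u P) \<le> e / 4 * n"
        unfolding P3_def using m2 n3 n0 by (intro step) auto
      have s4: "norm (u Y - u P3 - h4 * part_deriv VT u P) \<le> e / 4 * n"
        unfolding Y4 using m3 n3 n0 by (intro step) auto
      have eq: "u Y - u P - ?L (Y - P) =
        (u P1 - u P - h1 * part_deriv VX u P) + (u P2 - u P1 - h2 * part_deriv VY u P) +
        ((u P3 - u P2 - h3 * part_deriv VZ u P) + (u Y - u P3 - h4 * part_deriv VT u P))"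
        unfolding h by (simp add: algebra_simps)
      have "norm (u Y - u P - ?L (Y - P)) \<le> (e / 4 * n + e / 4 * n) + (e / 4 * n + e / 4 * n)"
        unfolding eq by (intro norm_triangle_mono s1 s2 s3 s4)
      then show ?thesis by (simp add: n_def)
    qed
    then show "\<exists>d>0. \<forall>Y. norm (Y - P) < d \<longrightarrow> norm (u Y - u P - ?L (Y - P)) \<le> e * norm (Y - P)"
      using \<delta>(1) by blast
  qed
  then show "\<exists>A B C E. (u has_derivative (\<lambda>(h1, h2, h3, h4). A * h1 + B * h2 + C * h3 + E * h4)) (at P)"
    by blast
qed

lemma holomorphic4_dir_deriv:
  assumes "open D" "holomorphic4_on u D"
  shows "holomorphic4_on (dir_deriv v u) D"
proof (rule osgood[OF assms(1)])
  note c = holomorphic4_continuous[OF assms(2)] and s = holomorphic4_sliced[OF assms(2)]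
  show "continuous_on D (dir_deriv v u)" by (rule dir_deriv_continuous[OF assms(1) c s])
  show "sliced (unit_vec i) (dir_deriv v u) D" for i by (rule dir_deriv_sliced[OF assms(1) c s s])
qed

lemma part_deriv_commute:
  assumes "open D" "holomorphic4_on u D" "P \<in> D"
  shows "part_deriv i (part_deriv j u) P = part_deriv j (part_deriv i u) P"
  by (rule dir_deriv_commute[OF assms(1) holomorphic4_continuous holomorphic4_sliced holomorphic4_sliced assms(3)])
    (rule assms(2))+

section \<open>Locally normally summable families\<close>

text \<open>
  Local normal convergence, for a family over an unordered index type.
\<close>
definition loc_summable :: "('i \<Rightarrow> c4 \<Rightarrow> complex) \<Rightarrow> c4 set \<Rightarrow> bool" where
  "loc_summable f D \<longleftrightarrow> (\<forall>i. holomorphic4_on (f i) D) \<and>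
     (\<forall>P\<in>D. \<exists>\<delta>>0. \<exists>M. M summable_on UNIV \<and> (\<forall>i. \<forall>Q\<in>ball P \<delta>. norm (f i Q) \<le> M i))"

lemma loc_summableE:
  assumes "loc_summable f D" "P \<in> D"
  obtains \<delta> M where "0 < \<delta>" "M summable_on UNIV" "\<And>i Q. Q \<in> ball P \<delta> \<Longrightarrow> norm (f i Q) \<le> M i"
proof -
  have "\<exists>\<delta>>0. \<exists>M. M summable_on UNIV \<and> (\<forall>i. \<forall>Q\<in>ball P \<delta>. norm (f i Q) \<le> M i)"
    using assms unfolding loc_summable_def by (elim conjE bspec)
  then show ?thesis
    using that by (elim exE conjE) (simp del: mem_ball split_paired_All split_paired_Ex)
qed

lemma loc_summable_has_sum:
  assumes "loc_summable f D" "P \<in> D"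
  shows "((\<lambda>i. f i P) has_sum (\<Sum>\<^sub>\<infinity>i. f i P)) UNIV"
proof -
  obtain \<delta> M where *: "0 < \<delta>" "M summable_on UNIV" "\<And>i Q. Q \<in> ball P \<delta> \<Longrightarrow> norm (f i Q) \<le> M i"
    by (fact loc_summableE[OF assms])
  have "(\<lambda>i. norm (f i P)) summable_on UNIV"
    by (rule summable_on_comparison_test[OF *(2)]) (use *(1) in \<open>auto intro: *(3)\<close>)
  then show ?thesis
    by (rule has_sum_infsum[OF abs_summable_summable])
qed

lemma loc_summable_dir_deriv_has_sum:
  assumes "open D" "loc_summable f D" and P: "P \<in> D"
  shows "(\<lambda>s. \<Sum>\<^sub>\<infinity>i. f i (P + cscale s v)) field_differentiable at 0"
    and "((\<lambda>i. dir_deriv v (f i) P) has_sum dir_deriv v (\<lambda>Q. \<Sum>\<^sub>\<infinity>i. f i Q) P) UNIV"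
proof -
  obtain \<delta> M where *: "0 < \<delta>" "M summable_on UNIV" "\<And>i Q. Q \<in> ball P \<delta> \<Longrightarrow> norm (f i Q) \<le> M i"
    by (fact loc_summableE[OF assms(2) P])
  have op: "open (D \<inter> ball P \<delta>)" and PD: "P \<in> D \<inter> ball P \<delta>"
    using assms *(1) by auto
  obtain r where r0: "0 < r" and "\<And>Q s. Q \<in> cball P r \<Longrightarrow> norm s \<le> r \<Longrightarrow> Q + cscale s v \<in> D \<inter> ball P \<delta>"
    using line_in_open[OF op PD] by metis
  then have r: "P + cscale s v \<in> D" "P + cscale s v \<in> ball P \<delta>" if "norm s \<le> r" for s
    using that by auto
  have sl: "sliced v (f i) D" for i
    using assms(2) holomorphic4_sliced unfolding loc_summable_def by blast
  have der: "((\<lambda>s. f i (P + cscale s v)) has_field_derivative dir_deriv v (f i) (P + cscale s v)) (at s)"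
    if "norm s \<le> r" for s i
    using sliced_has_derivative[OF sl r(1)[OF that]] .
  let ?F = "finite_subsets_at_top UNIV"
  have ul: "uniform_limit (cball 0 r) (\<lambda>X s. \<Sum>i\<in>X. f i (P + cscale s v)) (\<lambda>s. \<Sum>\<^sub>\<infinity>i. f i (P + cscale s v)) ?F"
    by (rule Weierstrass_m_test_general[OF _ *(2)]) (use r *(3) in auto)
  have eventually_der: "\<forall>\<^sub>F X in ?F. continuous_on (cball 0 r) (\<lambda>s. \<Sum>i\<in>X. f i (P + cscale s v)) \<and>
     (\<forall>w\<in>ball 0 r. ((\<lambda>s. \<Sum>i\<in>X. f i (P + cscale s v)) has_field_derivative (\<Sum>i\<in>X. dir_deriv v (f i) (P + cscale w v))) (at w))"
  proof (intro always_eventually allI conjI ballI)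
    fix X
    show "continuous_on (cball 0 r) (\<lambda>s. \<Sum>i\<in>X. f i (P + cscale s v))"
      by (intro continuous_on_sum line_holomorphic(1)[OF sl r(1)]) auto
    show "((\<lambda>s. \<Sum>i\<in>X. f i (P + cscale s v)) has_field_derivative (\<Sum>i\<in>X. dir_deriv v (f i) (P + cscale w v))) (at w)"
      if "w \<in> ball 0 r" for w
      using that by (intro DERIV_sum der) auto
  qed
  obtain g' where g': "\<And>w. w \<in> ball 0 r \<Longrightarrow>
      ((\<lambda>s. \<Sum>\<^sub>\<infinity>i. f i (P + cscale s v)) has_field_derivative g' w) (at w) \<and>
      ((\<lambda>X. \<Sum>i\<in>X. dir_deriv v (f i) (P + cscale w v)) \<longlongrightarrow> g' w) ?F"
    using has_complex_derivative_uniform_limit[OF eventually_der ul _ r0] by (metis finite_subsets_at_top_neq_bot)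
  have g0: "((\<lambda>s. \<Sum>\<^sub>\<infinity>i. f i (P + cscale s v)) has_field_derivative g' 0) (at 0)"
      "((\<lambda>X. \<Sum>i\<in>X. dir_deriv v (f i) P) \<longlongrightarrow> g' 0) ?F"
    using g'[of 0] r0 by simp_all
  then show "(\<lambda>s. \<Sum>\<^sub>\<infinity>i. f i (P + cscale s v)) field_differentiable at 0"
    unfolding field_differentiable_def by blast
  have "dir_deriv v (\<lambda>Q. \<Sum>\<^sub>\<infinity>i. f i Q) P = g' 0"
    using DERIV_imp_deriv[OF g0(1)] unfolding dir_deriv_def .
  then show "((\<lambda>i. dir_deriv v (f i) P) has_sum dir_deriv v (\<lambda>Q. \<Sum>\<^sub>\<infinity>i. f i Q) P) UNIV"
    using g0(2) by (simp add: has_sum_def)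
qed

lemma loc_summable_holomorphic:
  assumes "open D" "loc_summable f D"
  shows "holomorphic4_on (\<lambda>Q. \<Sum>\<^sub>\<infinity>i. f i Q) D"
proof (rule osgood[OF assms(1)])
  show "sliced (unit_vec i) (\<lambda>Q. \<Sum>\<^sub>\<infinity>i. f i Q) D" for i
    unfolding sliced_def using loc_summable_dir_deriv_has_sum(1)[OF assms] by blast
  have "isCont (\<lambda>Q. \<Sum>\<^sub>\<infinity>i. f i Q) P" if P: "P \<in> D" for P
  proof -
    obtain \<delta> M where *: "0 < \<delta>" "M summable_on UNIV" "\<And>i Q. Q \<in> ball P \<delta> \<Longrightarrow> norm (f i Q) \<le> M i"
      by (fact loc_summableE[OF assms(2) P])
    have "uniform_limit (D \<inter> ball P \<delta>) (\<lambda>X Q. \<Sum>i\<in>X. f i Q) (\<lambda>Q. \<Sum>\<^sub>\<infinity>i. f i Q) (finite_subsets_at_top UNIV)"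
      by (rule Weierstrass_m_test_general[OF _ *(2)]) (use *(3) in auto)
    moreover have "continuous_on (D \<inter> ball P \<delta>) (\<lambda>Q. \<Sum>i\<in>X. f i Q)" for X
      using assms(2) unfolding loc_summable_def
      by (intro continuous_on_sum continuous_on_subset[OF holomorphic4_continuous]) auto
    ultimately have "continuous_on (D \<inter> ball P \<delta>) (\<lambda>Q. \<Sum>\<^sub>\<infinity>i. f i Q)"
      by (intro uniform_limit_theorem[where F = "finite_subsets_at_top UNIV"]) auto
    then show ?thesis
      using P *(1) assms(1) by (simp add: continuous_on_eq_continuous_at open_Int)
  qed
  then show "continuous_on D (\<lambda>Q. \<Sum>\<^sub>\<infinity>i. f i Q)"
    by (simp add: continuous_at_imp_continuous_on)
qed

text \<open>
  Cauchy's estimate bounds the derivatives by the majorant divided by a radius, so a family of this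
  kind may be differentiated term by term any number of times.
\<close>
lemma loc_summable_dir_deriv:
  assumes "open D" "loc_summable f D"
  shows "loc_summable (\<lambda>i. dir_deriv v (f i)) D"
  unfolding loc_summable_def
proof (intro conjI allI ballI)
  show "holomorphic4_on (dir_deriv v (f i)) D" for i
    using assms holomorphic4_dir_deriv unfolding loc_summable_def by blast
  fix P assume P: "P \<in> D"
  obtain \<delta> M where *: "0 < \<delta>" "M summable_on UNIV" "\<And>i Q. Q \<in> ball P \<delta> \<Longrightarrow> norm (f i Q) \<le> M i"
    by (fact loc_summableE[OF assms(2) P])
  have op: "open (D \<inter> ball P \<delta>)" and PD: "P \<in> D \<inter> ball P \<delta>"
    using assms *(1) P by auto
  obtain r where r0: "0 < r" and r: "\<And>Q s. Q \<in> cball P r \<Longrightarrow> norm s \<le> r \<Longrightarrow> Q + cscale s v \<in> D \<inter> ball P \<delta>"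
    using line_in_open[OF op PD] by metis
  have sl: "sliced v (f i) D" for i
    using assms(2) holomorphic4_sliced unfolding loc_summable_def by blast
  have bound: "norm (dir_deriv v (f i) Q) \<le> M i / r" if Q: "Q \<in> ball P r" for i Q
  proof -
    have inD: "Q + cscale s v \<in> D" "Q + cscale s v \<in> ball P \<delta>" if "norm s \<le> r" for s
      using r[of Q s] Q that by auto
    note lh = line_holomorphic[OF sl inD(1)]
    have "norm ((deriv ^^ 1) (\<lambda>s. f i (Q + cscale s v)) 0) \<le> fact 1 * M i / r ^ 1"
      by (rule Cauchy_inequality[OF lh(2) lh(1) r0]) (auto intro!: *(3) inD(2))
    then show ?thesis by (simp add: dir_deriv_def)
  qed
  show "\<exists>\<delta>>0. \<exists>M. M summable_on UNIV \<and> (\<forall>i. \<forall>Q\<in>ball P \<delta>. norm (dir_deriv v (f i) Q) \<le> M i)"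
    using r0 bound by (intro exI[of _ r] exI[of _ "\<lambda>i. M i * (1 / r)"] conjI ballI allI summable_on_cmult_left *(2)) auto
qed

lemma loc_summable_mult:
  assumes "open D" "loc_summable f D" "holomorphic4_on g D" "\<And>i. holomorphic4_on (\<lambda>P. g P * f i P) D"
  shows "loc_summable (\<lambda>i P. g P * f i P) D"
  unfolding loc_summable_def
proof (intro conjI allI ballI assms(4))
  fix P assume P: "P \<in> D"
  obtain \<delta> M where *: "0 < \<delta>" "M summable_on UNIV" "\<And>i Q. Q \<in> ball P \<delta> \<Longrightarrow> norm (f i Q) \<le> M i"
    by (fact loc_summableE[OF assms(2) P])
  have "isCont g P"
    using holomorphic4_continuous[OF assms(3)] assms(1) P continuous_on_eq_continuous_at by blast
  then obtain d where d: "0 < d" "\<And>Q. dist Q P < d \<Longrightarrow> dist (g Q) (g P) < 1"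
    unfolding continuous_at_eps_delta using zero_less_one by metis
  have "norm (g Q * f i Q) \<le> (norm (g P) + 1) * M i" if "Q \<in> ball P (min d \<delta>)" for i Q
  proof -
    have "norm (g Q) \<le> norm (g P) + 1"
      using d(2)[of Q] norm_triangle_sub[of "g Q" "g P"] that
      by (simp add: dist_norm norm_minus_commute)
    then show ?thesis
      unfolding norm_mult using *(3)[of Q i] that by (intro mult_mono) auto
  qed
  then show "\<exists>\<delta>>0. \<exists>M. M summable_on UNIV \<and> (\<forall>i. \<forall>Q\<in>ball P \<delta>. norm (g Q * f i Q) \<le> M i)"
    using d(1) *(1) by (intro exI[of _ "min d \<delta>"] exI[of _ "\<lambda>i. (norm (g P) + 1) * M i"] conjI ballI allI summable_on_cmult_right *(2)) auto
qed

section \<open>Algebra of holomorphic functions and iterated partial derivatives\<close>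

lemma dir_deriv_cong:
  assumes "open D" "\<And>P. P \<in> D \<Longrightarrow> f P = g P" "P \<in> D"
  shows "dir_deriv v f P = dir_deriv v g P"
proof -
  obtain r where r: "0 < r" "\<And>Q s. Q \<in> cball P r \<Longrightarrow> norm s \<le> r \<Longrightarrow> Q + cscale s v \<in> D"
    using line_in_open[OF assms(1,3)] by metis
  have "f (P + cscale s v) = g (P + cscale s v)" if "s \<in> ball 0 r" for s
    using r(1) that by (intro assms(2) r(2)) auto
  then have "\<forall>\<^sub>F s in nhds 0. f (P + cscale s v) = g (P + cscale s v)"
    using r(1) by (intro eventually_mono[OF eventually_nhds_in_open[of "ball 0 r" 0]]) auto
  then show ?thesis
    unfolding dir_deriv_def by (rule deriv_cong_ev) simp
qed

lemma holomorphic4_cong: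
  assumes "open D" "\<And>P. P \<in> D \<Longrightarrow> f P = g P" "holomorphic4_on f D"
  shows "holomorphic4_on g D"
  unfolding holomorphic4_on_def
proof
  fix P assume P: "P \<in> D"
  then obtain A B C E where
    "(f has_derivative (\<lambda>(h1, h2, h3, h4). A * h1 + B * h2 + C * h3 + E * h4)) (at P)"
    using assms(3) unfolding holomorphic4_on_def by blast
  then have "(g has_derivative (\<lambda>(h1, h2, h3, h4). A * h1 + B * h2 + C * h3 + E * h4)) (at P)"
    by (rule has_derivative_transform_within_open[OF _ assms(1) P]) (rule assms(2))
  then show "\<exists>A B C E. (g has_derivative (\<lambda>(h1, h2, h3, h4). A * h1 + B * h2 + C * h3 + E * h4)) (at P)"
    by blast
qed

lemma dir_deriv_mult:
  assumes "holomorphic4_on f D" "holomorphic4_on g D" "P \<in> D"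
  shows "dir_deriv v (\<lambda>P. g P * f P) P = dir_deriv v g P * f P + g P * dir_deriv v f P"
proof -
  have f: "((\<lambda>s. f (P + cscale s v)) has_field_derivative dir_deriv v f P) (at 0)"
    using sliced_has_derivative[OF holomorphic4_sliced[OF assms(1)], of P 0] assms(3) by simp
  have g: "((\<lambda>s. g (P + cscale s v)) has_field_derivative dir_deriv v g P) (at 0)"
    using sliced_has_derivative[OF holomorphic4_sliced[OF assms(2)], of P 0] assms(3) by simp
  have "((\<lambda>s. g (P + cscale s v) * f (P + cscale s v)) has_field_derivative dir_deriv v g P * f P + g P * dir_deriv v f P) (at 0)"
    using DERIV_mult[OF g f] by (simp add: mult.commute)
  then show ?thesis
    unfolding dir_deriv_def[of v "\<lambda>P. g P * f P"] by (rule DERIV_imp_deriv)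
qed

lemma dir_deriv_sum:
  assumes "\<And>i. i \<in> I \<Longrightarrow> holomorphic4_on (f i) D" "P \<in> D"
  shows "dir_deriv v (\<lambda>P. \<Sum>i\<in>I. f i P) P = (\<Sum>i\<in>I. dir_deriv v (f i) P)"
proof -
  have "((\<lambda>s. f i (P + cscale s v)) has_field_derivative dir_deriv v (f i) P) (at 0)" if "i \<in> I" for i
    using sliced_has_derivative[OF holomorphic4_sliced[OF assms(1)[OF that]], of P 0] assms(2) by simp
  then show ?thesis
    unfolding dir_deriv_def[of v "\<lambda>P. \<Sum>i\<in>I. f i P"] by (intro DERIV_imp_deriv DERIV_sum)
qed

lemma holomorphic4_const [simp]: "holomorphic4_on (\<lambda>P. c) D"
  unfolding holomorphic4_on_def
proof
  fix P
  have "(\<lambda>(h1, h2, h3, h4). 0 * h1 + 0 * h2 + 0 * h3 + 0 * h4) = (\<lambda>h::c4. 0::complex)"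
    by auto
  then show "\<exists>A B C E. ((\<lambda>P. c) has_derivative (\<lambda>(h1, h2, h3, h4). A * h1 + B * h2 + C * h3 + E * h4)) (at P)"
    using has_derivative_const by metis
qed

lemma holomorphic4_add:
  assumes "holomorphic4_on f D" "holomorphic4_on g D"
  shows "holomorphic4_on (\<lambda>P. f P + g P) D"
  unfolding holomorphic4_on_def
proof
  fix P assume P: "P \<in> D"
  obtain A B C E where f: "(f has_derivative (\<lambda>(h1, h2, h3, h4). A * h1 + B * h2 + C * h3 + E * h4)) (at P)"
    using assms P unfolding holomorphic4_on_def by blast
  obtain A' B' C' E' where g: "(g has_derivative (\<lambda>(h1, h2, h3, h4). A' * h1 + B' * h2 + C' * h3 + E' * h4)) (at P)"
    using assms P unfolding holomorphic4_on_def by blast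
  have "((\<lambda>P. f P + g P) has_derivative
    (\<lambda>(h1, h2, h3, h4). (A + A') * h1 + (B + B') * h2 + (C + C') * h3 + (E + E') * h4)) (at P)"
    by (rule has_derivative_eq_rhs[OF has_derivative_add[OF f g]]) (auto simp: algebra_simps)
  then show "\<exists>A B C E. ((\<lambda>P. f P + g P) has_derivative (\<lambda>(h1, h2, h3, h4). A * h1 + B * h2 + C * h3 + E * h4)) (at P)"
    by blast
qed

lemma holomorphic4_mult:
  assumes "holomorphic4_on f D" "holomorphic4_on g D"
  shows "holomorphic4_on (\<lambda>P. f P * g P) D"
  unfolding holomorphic4_on_def
proof
  fix P assume P: "P \<in> D"
  obtain A B C E where f: "(f has_derivative (\<lambda>(h1, h2, h3, h4). A * h1 + B * h2 + C * h3 + E * h4)) (at P)"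
    using assms P unfolding holomorphic4_on_def by blast
  obtain A' B' C' E' where g: "(g has_derivative (\<lambda>(h1, h2, h3, h4). A' * h1 + B' * h2 + C' * h3 + E' * h4)) (at P)"
    using assms P unfolding holomorphic4_on_def by blast
  have "((\<lambda>P. f P * g P) has_derivative
    (\<lambda>(h1, h2, h3, h4). (f P * A' + A * g P) * h1 + (f P * B' + B * g P) * h2
       + (f P * C' + C * g P) * h3 + (f P * E' + E * g P) * h4)) (at P)"
    by (rule has_derivative_eq_rhs[OF has_derivative_mult[OF f g]]) (auto simp: algebra_simps)
  then show "\<exists>A B C E. ((\<lambda>P. f P * g P) has_derivative (\<lambda>(h1, h2, h3, h4). A * h1 + B * h2 + C * h3 + E * h4)) (at P)"
    by blast
qed

lemma holomorphic4_sum: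
  "(\<And>i. i \<in> I \<Longrightarrow> holomorphic4_on (f i) D) \<Longrightarrow> holomorphic4_on (\<lambda>P. \<Sum>i\<in>I. f i P) D"
  by (induction I rule: infinite_finite_induct) (auto intro!: holomorphic4_add)

lemma holomorphic4_coord [simp]: "holomorphic4_on (coord i) D"
proof -
  have eq: "coord VX = fst" "coord VY = (\<lambda>P. fst (snd P))" "coord VZ = (\<lambda>P. fst (snd (snd P)))" "coord VT = (\<lambda>P. snd (snd (snd P)))"
    by auto
  have *: "holomorphic4_on f D" if "bounded_linear f"
      and "f = (\<lambda>(h1, h2, h3, h4). A * h1 + B * h2 + C * h3 + E * h4)" for f A B C E
    unfolding holomorphic4_on_def using that bounded_linear_imp_has_derivative by blast
  show ?thesis
  proof (cases i)
    case VX show ?thesis unfolding VX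
      by (rule *[where A = 1 and B = 0 and C = 0 and E = 0]) (auto simp: eq bounded_linear_fst)
  next
    case VY show ?thesis unfolding VY
      by (rule *[where A = 0 and B = 1 and C = 0 and E = 0]) (auto simp: eq intro!: bounded_linear_fst_comp bounded_linear_snd)
  next
    case VZ show ?thesis unfolding VZ
      by (rule *[where A = 0 and B = 0 and C = 1 and E = 0]) (auto simp: eq intro!: bounded_linear_fst_comp bounded_linear_snd_comp bounded_linear_snd)
  next
    case VT show ?thesis unfolding VT
      by (rule *[where A = 0 and B = 0 and C = 0 and E = 1]) (auto simp: eq intro!: bounded_linear_snd_comp bounded_linear_snd)
  qed
qed

text \<open>
  The first letter is applied first, so that differentiating further means appending letters.
\<close>
primrec word_deriv :: "var list \<Rightarrow> (c4 \<Rightarrow> complex) \<Rightarrow> c4 \<Rightarrow> complex" where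
  "word_deriv [] f = f"
| "word_deriv (i # w) f = word_deriv w (part_deriv i f)"

lemma word_deriv_append: "word_deriv (v @ w) f = word_deriv w (word_deriv v f)"
  by (induction v arbitrary: f) auto

lemma holomorphic4_word_deriv:
  "open D \<Longrightarrow> holomorphic4_on f D \<Longrightarrow> holomorphic4_on (word_deriv w f) D"
  by (induction w arbitrary: f) (auto simp: holomorphic4_dir_deriv)

lemma word_deriv_cong:
  "open D \<Longrightarrow> (\<And>P. P \<in> D \<Longrightarrow> f P = g P) \<Longrightarrow> P \<in> D \<Longrightarrow> word_deriv w f P = word_deriv w g P"
proof (induction w arbitrary: f g P)
  case (Cons i w)
  have "part_deriv i f Q = part_deriv i g Q" if "Q \<in> D" for Q
    by (rule dir_deriv_cong[OF Cons.prems(1,2) that])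
  then show ?case
    using Cons.IH[OF Cons.prems(1) _ Cons.prems(3), of "part_deriv i f" "part_deriv i g"] by simp
qed simp

lemma word_deriv_move_front:
  assumes "open D"
  shows "holomorphic4_on f D \<Longrightarrow> P \<in> D \<Longrightarrow> word_deriv (v @ i # w) f P = word_deriv (i # v @ w) f P"
proof (induction v arbitrary: f)
  case (Cons j v)
  have "word_deriv (v @ i # w) (part_deriv j f) P = word_deriv (v @ w) (part_deriv i (part_deriv j f)) P"
    using Cons.IH[of "part_deriv j f"] Cons.prems holomorphic4_dir_deriv[OF assms] by simp
  also have "\<dots> = word_deriv (v @ w) (part_deriv j (part_deriv i f)) P"
    by (rule word_deriv_cong[OF assms _ Cons.prems(2)]) (rule part_deriv_commute[OF assms Cons.prems(1)])
  finally show ?case by simp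
qed simp

lemma word_deriv_perm:
  assumes "open D"
  shows "holomorphic4_on f D \<Longrightarrow> P \<in> D \<Longrightarrow> mset v = mset w \<Longrightarrow> word_deriv v f P = word_deriv w f P"
proof (induction v arbitrary: f w)
  case (Cons i v)
  then have "i \<in> set w" by (metis list.set_intros(1) mset_eq_setD)
  then obtain a b where w: "w = a @ i # b" by (meson split_list)
  have "mset v = mset (a @ b)" using Cons.prems(3) by (simp add: w)
  then have "word_deriv (i # v) f P = word_deriv (i # a @ b) f P"
    using Cons.IH[OF holomorphic4_dir_deriv[OF assms Cons.prems(1)] Cons.prems(2)] by simp
  also have "\<dots> = word_deriv w f P"
    unfolding w using word_deriv_move_front[OF assms Cons.prems(1,2)] by simp
  finally show ?case .
qed simp

lemma word_deriv_sum:
  assumes "open D"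
  shows "(\<And>i. i \<in> I \<Longrightarrow> holomorphic4_on (f i) D) \<Longrightarrow> P \<in> D \<Longrightarrow>
    word_deriv w (\<lambda>P. \<Sum>i\<in>I. f i P) P = (\<Sum>i\<in>I. word_deriv w (f i) P)"
proof (induction w arbitrary: f)
  case (Cons j w)
  have "word_deriv w (part_deriv j (\<lambda>P. \<Sum>i\<in>I. f i P)) P = word_deriv w (\<lambda>P. \<Sum>i\<in>I. part_deriv j (f i) P) P"
    by (rule word_deriv_cong[OF assms _ Cons.prems(2)]) (rule dir_deriv_sum[OF Cons.prems(1)])
  also have "\<dots> = (\<Sum>i\<in>I. word_deriv w (part_deriv j (f i)) P)"
    by (rule Cons.IH[OF holomorphic4_dir_deriv[OF assms Cons.prems(1)] Cons.prems(2)])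
  finally show ?case by simp
qed simp

lemma word_deriv_cmult:
  assumes "open D"
  shows "holomorphic4_on f D \<Longrightarrow> P \<in> D \<Longrightarrow> word_deriv w (\<lambda>P. c * f P) P = c * word_deriv w f P"
proof (induction w arbitrary: f)
  case (Cons j w)
  have "part_deriv j (\<lambda>P. c * f P) Q = c * part_deriv j f Q" if "Q \<in> D" for Q
    using dir_deriv_mult[OF Cons.prems(1) holomorphic4_const that, of "unit_vec j" c]
    by (simp add: dir_deriv_def)
  then have "word_deriv w (part_deriv j (\<lambda>P. c * f P)) P = word_deriv w (\<lambda>P. c * part_deriv j f P) P"
    by (intro word_deriv_cong[OF assms _ Cons.prems(2)])
  then show ?case
    using Cons.IH[OF holomorphic4_dir_deriv[OF assms Cons.prems(1)] Cons.prems(2)] by simp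
qed simp

text \<open>
  Leibniz' rule at a point where \<open>f\<close> vanishes to order \<open>length w\<close>: every term in which a derivative
  falls on \<open>g\<close> is zero. It isolates the principal part of a differential operator.
\<close>
lemma word_deriv_mult_vanishing:
  assumes "open D" "P \<in> D"
  shows "holomorphic4_on f D \<Longrightarrow> holomorphic4_on g D \<Longrightarrow>
    (\<And>v. length v < length w \<Longrightarrow> word_deriv v f P = 0) \<Longrightarrow> word_deriv w (\<lambda>P. g P * f P) P = g P * word_deriv w f P"
proof (induction w arbitrary: f g)
  case (Cons j w)
  note pf = holomorphic4_dir_deriv[OF assms(1) Cons.prems(1)] and pg = holomorphic4_dir_deriv[OF assms(1) Cons.prems(2)]
  \<comment> \<open>The two terms of the product rule as a sum over \<open>bool\<close>, to use linearity for sums.\<close>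
  let ?F = "\<lambda>b. if b then (\<lambda>P. part_deriv j g P * f P) else (\<lambda>P. g P * part_deriv j f P)"
  have "word_deriv w (part_deriv j (\<lambda>P. g P * f P)) P = word_deriv w (\<lambda>P. \<Sum>b\<in>UNIV. ?F b P) P"
    by (rule word_deriv_cong[OF assms(1) _ assms(2)]) (simp add: dir_deriv_mult[OF Cons.prems(1,2)] UNIV_bool)
  also have "\<dots> = (\<Sum>b\<in>UNIV. word_deriv w (?F b) P)"
    by (rule word_deriv_sum[OF assms(1) _ assms(2)]) (auto intro: holomorphic4_mult Cons.prems pf pg)
  also have "\<dots> = word_deriv w (\<lambda>P. part_deriv j g P * f P) P + word_deriv w (\<lambda>P. g P * part_deriv j f P) P"
    by (simp add: UNIV_bool)
  also have "word_deriv w (\<lambda>P. part_deriv j g P * f P) P = part_deriv j g P * word_deriv w f P"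
    using Cons.prems(3) by (intro Cons.IH[OF Cons.prems(1) pg]) auto
  also have "word_deriv w f P = 0"
    using Cons.prems(3) by simp
  also have "word_deriv w (\<lambda>P. g P * part_deriv j f P) P = g P * word_deriv w (part_deriv j f) P"
    using Cons.prems(3)[of "j # v" for v] by (intro Cons.IH[OF pf Cons.prems(2)]) simp
  finally show ?case by simp
qed simp

text \<open>
  On the line through \<open>P\<close> and \<open>Q\<close> all derivatives at \<open>P\<close> are combinations of the given partial
  derivatives, so the restriction to that line is a function of one variable with zero Taylor series.
\<close>
lemma flat_imp_zero:
  assumes "open D" "holomorphic4_on u D" "ball P r \<subseteq> D" "\<And>w. word_deriv w u P = 0" "Q \<in> ball P r"
  shows "u Q = 0"
proof (cases "Q = P")
  case True
  then show ?thesis using assms(4)[of "[]"] by simp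
next
  case False
  define h where "h = Q - P"
  have h0: "0 < norm h" using False by (simp add: h_def)
  have r0: "0 < r" using assms(5) by (simp add: le_less_trans[OF zero_le_dist])
  have PD: "P \<in> D" using assms(3) r0 by auto
  define g where "g = (\<lambda>s. u (P + cscale s h))"
  have it: "(deriv ^^ n) g = (\<lambda>s. (dir_deriv h ^^ n) u (P + cscale s h))" for n
  proof (induction n)
    case (Suc n)
    show ?case unfolding funpow.simps o_apply Suc.IH by (rule ext) (rule deriv_line)
  qed (simp add: g_def)
  have zero: "(dir_deriv h ^^ n) f P = 0" if "holomorphic4_on f D" "\<And>w. word_deriv w f P = 0" for f n
    using that
  proof (induction n arbitrary: f)
    case 0
    then show ?case using 0(2)[of "[]"] by simp
  next
    case (Suc n)
    have "word_deriv w (dir_deriv h f) P = 0" for w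
    proof -
      have "word_deriv w (dir_deriv h f) P = word_deriv w (\<lambda>Q. \<Sum>i\<in>UNIV. coord i h * part_deriv i f Q) P"
        by (rule word_deriv_cong[OF assms(1) _ PD]) (rule dir_deriv_eq_sum[OF Suc.prems(1)])
      also have "\<dots> = (\<Sum>i\<in>UNIV. word_deriv w (\<lambda>Q. coord i h * part_deriv i f Q) P)"
        by (rule word_deriv_sum[OF assms(1) _ PD]) (auto intro!: holomorphic4_mult holomorphic4_dir_deriv assms Suc.prems)
      also have "\<dots> = (\<Sum>i\<in>UNIV. coord i h * word_deriv (i # w) f P)"
        by (intro sum.cong refl, subst word_deriv_cmult[OF assms(1) _ PD]) (auto intro!: holomorphic4_dir_deriv assms Suc.prems)
      finally show ?thesis by (simp only: Suc.prems(2)) simp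
    qed
    then have "(dir_deriv h ^^ n) (dir_deriv h f) P = 0"
      by (intro Suc.IH holomorphic4_dir_deriv assms Suc.prems)
    then show ?case by (simp add: funpow_swap1)
  qed
  have "g holomorphic_on ball 0 (r / norm h)"
  proof (rule holomorphic_onI)
    fix s :: complex assume "s \<in> ball 0 (r / norm h)"
    then have "norm (cscale s h) < r" using h0 by (simp add: norm_cscale field_simps)
    then have "P + cscale s h \<in> D" using assms(3) by (auto simp: dist_norm)
    from sliced_has_derivative[OF holomorphic4_sliced[OF assms(2)] this]
    show "g field_differentiable at s within ball 0 (r / norm h)"
      unfolding g_def field_differentiable_def using has_field_derivative_at_within by blast
  qed
  moreover have "(1::complex) \<in> ball 0 (r / norm h)"
  proof -
    have "norm h < r" using assms(5) by (simp add: h_def dist_norm norm_minus_commute)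
    then have "1 < r / norm h" using h0 by (simp add: field_simps)
    then show ?thesis by (simp add: dist_norm)
  qed
  moreover have "(deriv ^^ n) g 0 = 0" for n
    using zero[OF assms(2,4)] by (simp add: it)
  ultimately have "g 1 = 0"
    by (rule holomorphic_fun_eq_0_on_ball)
  moreover have "cscale 1 h = h" by (simp add: cscale_def case_prod_beta)
  ultimately show ?thesis
    by (simp add: g_def h_def)
qed

section \<open>The differential system\<close>

text \<open>
  Operators are kept as syntax, lists of coefficients and derivative words, so that the order of their
  terms can be inspected and the principal part singled out.
\<close>
definition diff_op :: "((c4 \<Rightarrow> complex) \<times> var list) list \<Rightarrow> (c4 \<Rightarrow> complex) \<Rightarrow> c4 \<Rightarrow> complex" where
  "diff_op L u P = (\<Sum>(g, s)\<leftarrow>L. g P * word_deriv s u P)"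

text \<open>
  With \<open>\<theta>\<close> the Euler operators, \<open>A = \<theta>\<^sub>x + \<theta>\<^sub>y + \<theta>\<^sub>z + \<theta>\<^sub>t + a\<close>, \<open>B = \<theta>\<^sub>x + \<theta>\<^sub>y + \<theta>\<^sub>t + b\<close> and \<open>C = \<theta>\<^sub>z + c\<close>,
  this is \<open>-AB\<close> and the next operator is \<open>-AC\<close>. The system says that \<open>w u\<^sub>w\<^sub>w + e u\<^sub>w\<close> equals
  \<open>A B u\<close> for \<open>w\<close> among \<open>x, y, t\<close>, and \<open>A C u\<close> for \<open>w = z\<close>.
\<close>
definition op_AB :: "complex \<Rightarrow> complex \<Rightarrow> ((c4 \<Rightarrow> complex) \<times> var list) list" where
  "op_AB a b =
    [(\<lambda>P. - (coord VX P * coord VX P), [VX, VX]),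
     (\<lambda>P. - (coord VY P * coord VY P), [VY, VY]),
     (\<lambda>P. - (coord VT P * coord VT P), [VT, VT]),
     (\<lambda>P. - (2 * coord VX P * coord VY P), [VX, VY]),
     (\<lambda>P. - (coord VX P * coord VZ P), [VX, VZ]),
     (\<lambda>P. - (2 * coord VX P * coord VT P), [VX, VT]),
     (\<lambda>P. - (coord VY P * coord VZ P), [VY, VZ]),
     (\<lambda>P. - (2 * coord VY P * coord VT P), [VY, VT]),
     (\<lambda>P. - (coord VZ P * coord VT P), [VZ, VT]),
     (\<lambda>P. - ((a + b + 1) * coord VX P), [VX]),
     (\<lambda>P. - ((a + b + 1) * coord VY P), [VY]),
     (\<lambda>P. - (b * coord VZ P), [VZ]),
     (\<lambda>P. - ((a + b + 1) * coord VT P), [VT]),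
     (\<lambda>P. - (a * b), [])]"

definition op_AC :: "complex \<Rightarrow> complex \<Rightarrow> ((c4 \<Rightarrow> complex) \<times> var list) list" where
  "op_AC a c =
    [(\<lambda>P. - (coord VZ P * coord VZ P), [VZ, VZ]),
     (\<lambda>P. - (coord VX P * coord VZ P), [VX, VZ]),
     (\<lambda>P. - (coord VY P * coord VZ P), [VY, VZ]),
     (\<lambda>P. - (coord VZ P * coord VT P), [VZ, VT]),
     (\<lambda>P. - (c * coord VX P), [VX]),
     (\<lambda>P. - (c * coord VY P), [VY]),
     (\<lambda>P. - ((a + c + 1) * coord VZ P), [VZ]),
     (\<lambda>P. - (c * coord VT P), [VT]),
     (\<lambda>P. - (a * c), [])]"

definition left_op :: "var \<Rightarrow> complex \<Rightarrow> ((c4 \<Rightarrow> complex) \<times> var list) list" where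
  "left_op i e = [(coord i, [i, i]), (\<lambda>P. e, [i])]"

definition right_op :: "complex \<Rightarrow> complex \<Rightarrow> complex \<Rightarrow> var \<Rightarrow> ((c4 \<Rightarrow> complex) \<times> var list) list" where
  "right_op a b c i = (if i = VZ then op_AC a c else op_AB a b)"

definition K2_eq :: "complex \<Rightarrow> complex \<Rightarrow> complex \<Rightarrow> (var \<Rightarrow> complex) \<Rightarrow> var \<Rightarrow> ((c4 \<Rightarrow> complex) \<times> var list) list" where
  "K2_eq a b c e i = left_op i (e i) @ right_op a b c i"

fun by_var :: "'a \<Rightarrow> 'a \<Rightarrow> 'a \<Rightarrow> 'a \<Rightarrow> var \<Rightarrow> 'a" where
  "by_var e1 e2 e3 e4 VX = e1"
| "by_var e1 e2 e3 e4 VY = e2"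
| "by_var e1 e2 e3 e4 VZ = e3"
| "by_var e1 e2 e3 e4 VT = e4"

lemma partials_eq: "d_x = part_deriv VX" "d_y = part_deriv VY" "d_z = part_deriv VZ" "d_t = part_deriv VT"
  by (auto simp: fun_eq_iff d_x_def d_y_def d_z_def d_t_def dir_deriv_def cscale_def o_def add.commute
      intro: deriv_shift_0[THEN trans])

lemma system_iff:
  "K2_system_solution a b c e1 e2 e3 e4 D u \<longleftrightarrow>
    holomorphic4_on u D \<and> (\<forall>P\<in>D. \<forall>i. diff_op (K2_eq a b c (by_var e1 e2 e3 e4) i) u P = 0)"
proof -
  have all: "(\<forall>i. Q i) \<longleftrightarrow> Q VX \<and> Q VY \<and> Q VZ \<and> Q VT" for Q
    by (metis var.exhaust)
  have ball: "(\<forall>P\<in>D. Q P) \<longleftrightarrow> (\<forall>x y z t. (x, y, z, t) \<in> D \<longrightarrow> Q (x, y, z, t))" for Q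
    by auto
  show ?thesis
    unfolding K2_system_solution_def Let_def partials_eq ball all
    by (simp add: diff_op_def K2_eq_def left_op_def right_op_def op_AB_def op_AC_def power2_eq_square
        algebra_simps del: unit_vec.simps)
qed

lemma word_deriv_zero: "word_deriv w (\<lambda>P. 0) P = 0"
proof (induction w)
  case (Cons i w)
  have "part_deriv i (\<lambda>P. 0) = (\<lambda>P. 0)" by (auto simp: dir_deriv_def fun_eq_iff)
  then show ?case using Cons by (simp del: unit_vec.simps)
qed simp

lemma diff_op_holomorphic:
  assumes "open D" "holomorphic4_on u D" "\<And>g s. (g, s) \<in> set L \<Longrightarrow> holomorphic4_on g D"
  shows "holomorphic4_on (diff_op L u) D"
proof -
  have "holomorphic4_on (\<lambda>P. \<Sum>(g, s)\<leftarrow>L. g P * word_deriv s u P) D"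
    using assms(3)
    by (induction L) (auto intro!: holomorphic4_add holomorphic4_mult holomorphic4_word_deriv assms(1,2))
  then show ?thesis unfolding diff_op_def[abs_def] .
qed

lemma word_deriv_add:
  assumes "open D" "holomorphic4_on f D" "holomorphic4_on g D" "P \<in> D"
  shows "word_deriv w (\<lambda>P. f P + g P) P = word_deriv w f P + word_deriv w g P"
  using word_deriv_sum[OF assms(1) _ assms(4), of UNIV "\<lambda>b. if b then f else g" w] assms(2,3)
  by (simp add: UNIV_bool add.commute)

text \<open>
  By Leibniz' rule in the vanishing form above, every derivative of a coefficient is multiplied by a
  derivative of \<open>u\<close> of order below \<open>length w + 2\<close>.
\<close>
lemma word_deriv_diff_op_principal:
  assumes "open D" "P \<in> D" "holomorphic4_on u D" "\<And>v. length v < length w + 2 \<Longrightarrow> word_deriv v u P = 0"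
    and "\<And>g s. (g, s) \<in> set L \<Longrightarrow> holomorphic4_on g D \<and> length s \<le> 2"
  shows "word_deriv w (diff_op L u) P = (\<Sum>(g, s)\<leftarrow>L. g P * word_deriv (s @ w) u P)"
  using assms(5)
proof (induction L)
  case Nil
  then show ?case by (simp add: diff_op_def[abs_def] word_deriv_zero)
next
  case (Cons gs L)
  obtain g s where gs: "gs = (g, s)" by (cases gs)
  have g: "holomorphic4_on g D" "length s \<le> 2" using Cons.prems[of g s] by (simp_all add: gs)
  have "word_deriv w (\<lambda>P. g P * word_deriv s u P) P = g P * word_deriv w (word_deriv s u) P"
  proof (rule word_deriv_mult_vanishing[OF assms(1,2) holomorphic4_word_deriv[OF assms(1,3)] g(1)])
    show "word_deriv v (word_deriv s u) P = 0" if "length v < length w" for v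
      unfolding word_deriv_append[symmetric] using that g(2) by (intro assms(4)) simp
  qed
  moreover have "word_deriv w (diff_op (gs # L) u) P = word_deriv w (\<lambda>P. g P * word_deriv s u P) P + word_deriv w (diff_op L u) P"
  proof -
    have "diff_op (gs # L) u = (\<lambda>P. g P * word_deriv s u P + diff_op L u P)"
      by (simp add: diff_op_def[abs_def] gs)
    moreover have "holomorphic4_on (diff_op L u) D"
      using Cons.prems by (intro diff_op_holomorphic[OF assms(1,3)]) auto
    ultimately show ?thesis
      using word_deriv_add[OF assms(1) holomorphic4_mult[OF g(1) holomorphic4_word_deriv[OF assms(1,3)]] _ assms(2), of "diff_op L u" w s]
      by simp
  qed
  moreover have "word_deriv w (diff_op L u) P = (\<Sum>(g, s)\<leftarrow>L. g P * word_deriv (s @ w) u P)"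
    using Cons.prems by (intro Cons.IH) auto
  ultimately show ?case
    by (simp add: gs word_deriv_append)
qed

lemma K2_eq_coeffs:
  assumes "(g, s) \<in> set (K2_eq a b c e i)"
  shows "holomorphic4_on g D \<and> length s \<le> 2"
proof -
  have *: "holomorphic4_on (\<lambda>P. - f P) D" if "holomorphic4_on f D" for f
    using holomorphic4_mult[OF holomorphic4_const[of "-1"] that] by simp
  show ?thesis
    using assms unfolding K2_eq_def left_op_def right_op_def op_AB_def op_AC_def
    by (auto split: if_splits intro!: * holomorphic4_mult)
qed

section \<open>Solutions are determined by their squarefree jets\<close>

text \<open>
  This is where the region of convergence enters the uniqueness proof. With \<open>\<tau> = \<sigma> + \<kappa>\<close> the two
  inequalities with \<open>\<theta> = 1\<close> read \<open>\<tau> < 1 / \<sigma>\<close> and \<open>\<sigma> / (1 - |z|) < \<tau>\<close>, and such a \<open>\<tau>\<close> exists exactly when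
  \<open>\<sigma>\<^sup>2 + |z| < 1\<close>.
\<close>
lemma contraction_weights:
  assumes "(x, y, z, t) \<in> K2_domain"
  defines "\<sigma> \<equiv> sqrt (norm x) + sqrt (norm y) + sqrt (norm t)"
  obtains \<kappa> \<theta> where "0 < \<kappa>" "0 \<le> \<theta>" "\<theta> < 1" "\<sigma> * (\<sigma> + \<kappa>) \<le> \<theta>" "norm z * (\<sigma> + \<kappa>) \<le> \<theta> * \<kappa>"
proof -
  have "x \<noteq> 0" using assms unfolding K2_domain_def by auto
  then have \<sigma>: "0 < \<sigma>" unfolding \<sigma>_def by (simp add: add_pos_nonneg)
  have dom: "\<sigma>\<^sup>2 + norm z < 1" using assms unfolding K2_domain_def \<sigma>_def by auto
  then have z1: "norm z < 1" by (smt (verit) zero_le_power2)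
  have "\<sigma> / (1 - norm z) < 1 / \<sigma>"
    using \<sigma> z1 dom by (simp add: field_simps power2_eq_square)
  then obtain \<tau> where \<tau>: "\<sigma> / (1 - norm z) < \<tau>" "\<tau> < 1 / \<sigma>"
    using dense by blast
  have "\<sigma> \<le> \<sigma> / (1 - norm z)" using \<sigma> z1 by (simp add: field_simps)
  then have k: "0 < \<tau> - \<sigma>" using \<tau> by simp
  have 1: "\<sigma> * \<tau> < 1" using \<tau> \<sigma> by (simp add: field_simps)
  have 2: "norm z * \<tau> < \<tau> - \<sigma>" using \<tau> z1 by (simp add: field_simps)
  define \<theta> where "\<theta> = max (\<sigma> * \<tau>) (norm z * \<tau> / (\<tau> - \<sigma>))"
  have "norm z * \<tau> \<le> \<theta> * (\<tau> - \<sigma>)"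
    using k by (simp add: \<theta>_def field_simps max_def) 
  moreover have "\<theta> < 1" using 1 2 k by (simp add: \<theta>_def)
  moreover have "0 \<le> \<theta>" using \<sigma> k by (simp add: \<theta>_def le_max_iff_disj)
  ultimately show ?thesis
    using k by (intro that[of "\<tau> - \<sigma>" \<theta>]) (simp_all add: \<theta>_def)
qed

text \<open>
  The principal symbols of the four equations, after scaling each derivative by its coordinates.
\<close>
lemma principal_equation:
  assumes "open D" "P \<in> D" "holomorphic4_on u D" "\<And>Q. Q \<in> D \<Longrightarrow> diff_op (K2_eq a b c e i) u Q = 0"
    and "\<And>v. length v < length w + 2 \<Longrightarrow> word_deriv v u P = 0"
  defines "V \<equiv> \<lambda>i j. coord i P * coord j P * word_deriv (i # j # w) u P"
  shows "V i i = coord i P * (if i = VZ then V VZ VZ + V VX VZ + V VY VZ + V VZ VT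
    else V VX VX + V VY VY + V VT VT + 2 * V VX VY + V VX VZ + 2 * V VX VT + V VY VZ + 2 * V VY VT + V VZ VT)"
proof -
  have "word_deriv w (diff_op (K2_eq a b c e i) u) P = word_deriv w (\<lambda>P. 0) P"
    by (rule word_deriv_cong[OF assms(1) _ assms(2)]) (rule assms(4))
  then have "word_deriv w (diff_op (K2_eq a b c e i) u) P = 0"
    by (simp add: word_deriv_zero)
  then have "(\<Sum>(g, s)\<leftarrow>K2_eq a b c e i. g P * word_deriv (s @ w) u P) = 0"
    using word_deriv_diff_op_principal[OF assms(1-3,5) K2_eq_coeffs] by simp
  moreover have "word_deriv w (part_deriv j u) P = 0" "word_deriv w u P = 0" for j
    using assms(5)[of "j # w"] assms(5)[of w] by simp_all
  ultimately show ?thesis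
    unfolding V_def K2_eq_def left_op_def right_op_def op_AB_def op_AC_def
    by (cases i) (simp_all add: algebra_simps del: unit_vec.simps)
qed

text \<open>
  Suppose all derivatives of order below \<open>n\<close> vanish at \<open>P\<close>, and let \<open>V w\<close> be the derivative along a word
  \<open>w\<close> of length \<open>n\<close> times the product of the corresponding coordinates. If a letter occurs twice in
  \<open>w\<close>, the principal equation expresses \<open>V w\<close> through other words of length \<open>n\<close>. In the sup norm
  weighted by \<open>\<surd>|x|, \<surd>|y|, \<kappa>, \<surd>|t|\<close> this expression has norm at most \<open>\<theta> < 1\<close>, and words without
  repetition contribute nothing; so the norm of \<open>V\<close> is at most \<open>\<theta>\<close> times itself.
\<close>
lemma squarefree_flat:
  assumes "open D" "P \<in> D" "D \<subseteq> K2_domain" "holomorphic4_on u D"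
    and eqs: "\<And>Q i. Q \<in> D \<Longrightarrow> diff_op (K2_eq a b c e i) u Q = 0"
    and flat: "\<And>w. distinct w \<Longrightarrow> word_deriv w u P = 0"
  shows "word_deriv w u P = 0"
proof (induction w rule: length_induct)
  case (1 w0)
  obtain x y z t where P: "P = (x, y, z, t)" by (metis prod.exhaust)
  have dom: "(x, y, z, t) \<in> K2_domain" using assms(2,3) by (auto simp: P)
  define \<sigma> where "\<sigma> = sqrt (norm x) + sqrt (norm y) + sqrt (norm t)"
  obtain \<kappa> \<theta> where k: "0 < \<kappa>" "0 \<le> \<theta>" "\<theta> < 1" "\<sigma> * (\<sigma> + \<kappa>) \<le> \<theta>" "norm z * (\<sigma> + \<kappa>) \<le> \<theta> * \<kappa>"
    using contraction_weights[OF dom] unfolding \<sigma>_def by metis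
  define \<rho> where "\<rho> = by_var (sqrt (norm x)) (sqrt (norm y)) \<kappa> (sqrt (norm t))"
  have co0: "coord i P \<noteq> 0" for i
    using dom unfolding K2_domain_def P by (cases i) auto
  have \<rho>: "0 < \<rho> i" for i
    using co0[of i] k(1) unfolding \<rho>_def P by (cases i) auto
  define W where "W = {w :: var list. length w = length w0}"
  define V where "V = (\<lambda>w. prod_list (map (\<lambda>i. coord i P) w) * word_deriv w u P)"
  define R where "R = (\<lambda>w. prod_list (map \<rho> w))"
  have R: "0 < R w" for w
    unfolding R_def using \<rho> by (induction w) auto
  have finW: "finite W"
    using finite_lists_length_eq[of "UNIV :: var set" "length w0"] by (simp add: W_def)
  have perm: "V v = V w \<and> R v = R w" if "mset v = mset w" for v w
  proof -
    have "prod_list (map f v) = prod_list (map f w)" for f :: "var \<Rightarrow> 'x::comm_monoid_mult"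
      using that by (metis mset_map prod_mset_prod_list)
    then show ?thesis
      using word_deriv_perm[OF assms(1,4,2) that] unfolding V_def R_def by metis
  qed
  \<comment> \<open>The weighted sup norm of the derivatives of order \<open>n\<close>.\<close>
  define N where "N = Max ((\<lambda>w. norm (V w) / R w) ` W)"
  have bound: "norm (V w) \<le> N * R w" if "w \<in> W" for w
  proof -
    have "norm (V w) / R w \<le> N"
      unfolding N_def using that finW by (intro Max_ge) auto
    then show ?thesis using R[of w] by (simp add: field_simps)
  qed
  have N0: "0 \<le> N"
    using bound[of w0] R[of w0] by (smt (verit) W_def mem_Collect_eq norm_ge_zero zero_le_mult_iff)
  have contract: "norm (V w) \<le> \<theta> * N * R w" if w: "w \<in> W" for w
  proof (cases "distinct w")
    case True
    then show ?thesis using flat[of w] k(2) N0 R[of w] by (simp add: V_def)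
  next
    case False
    then obtain as i bs cs where "w = as @ [i] @ bs @ [i] @ cs"
      using not_distinct_decomp by blast
    then have ms: "mset w = mset (i # i # as @ bs @ cs)" by simp
    define v where "v = as @ bs @ cs"
    have lv: "length w0 = length v + 2"
      using arg_cong[OF ms, of size] w by (simp add: W_def v_def)
    define X where "X = prod_list (map (\<lambda>i. coord i P) v)"
    define U where "U = (\<lambda>i j. coord i P * coord j P * word_deriv (i # j # v) u P)"
    have U: "V (i # j # v) = X * U i j" for i j
      by (simp add: V_def U_def X_def)
    have b: "norm (X * U i j) \<le> N * R v * (\<rho> i * \<rho> j)" for i j
      using bound[of "i # j # v"] lv unfolding U by (simp add: W_def R_def mult_ac)
    have b2: "norm (2 * (X * U i j)) \<le> 2 * (N * R v * (\<rho> i * \<rho> j))" for i j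
      using b[of i j] by (simp add: norm_mult)
    have "U i i = coord i P * (if i = VZ then U VZ VZ + U VX VZ + U VY VZ + U VZ VT
      else U VX VX + U VY VY + U VT VT + 2 * U VX VY + U VX VZ + 2 * U VX VT + U VY VZ + 2 * U VY VT + U VZ VT)"
      unfolding U_def
    proof (rule principal_equation[OF assms(1,2,4) eqs])
      show "word_deriv w' u P = 0" if "length w' < length v + 2" for w'
        using 1 that lv by simp
    qed
    then have eq: "X * U i i = coord i P * (if i = VZ then X * U VZ VZ + X * U VX VZ + X * U VY VZ + X * U VZ VT
      else X * U VX VX + X * U VY VY + X * U VT VT + 2 * (X * U VX VY) + X * U VX VZ + 2 * (X * U VX VT)
        + X * U VY VZ + 2 * (X * U VY VT) + X * U VZ VT)"
      by (auto simp: algebra_simps)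
    have NR: "0 \<le> N * R v" using N0 R[of v] by simp
    have "norm (X * U i i) \<le> \<theta> * N * (R v * (\<rho> i * \<rho> i))"
    proof (cases "i = VZ")
      case True
      let ?S = "X * U VZ VZ + X * U VX VZ + X * U VY VZ + X * U VZ VT"
      have "norm ?S \<le> N * R v * (\<rho> VZ * \<rho> VZ) + N * R v * (\<rho> VX * \<rho> VZ) + N * R v * (\<rho> VY * \<rho> VZ) + N * R v * (\<rho> VZ * \<rho> VT)"
        by (intro norm_triangle_mono b)
      also have "\<dots> = N * R v * (\<kappa> * (\<sigma> + \<kappa>))"
        by (simp add: \<rho>_def \<sigma>_def algebra_simps)
      finally have S: "norm ?S \<le> N * R v * (\<kappa> * (\<sigma> + \<kappa>))" .
      have "X * U i i = z * ?S" using eq True by (simp add: P)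
      then have "norm (X * U i i) = norm z * norm ?S" by (simp only: norm_mult)
      then have "norm (X * U i i) \<le> norm z * (N * R v * (\<kappa> * (\<sigma> + \<kappa>)))"
        using S by (simp only: mult_left_mono norm_ge_zero)
      also have "\<dots> = N * R v * \<kappa> * (norm z * (\<sigma> + \<kappa>))" by simp
      also have "\<dots> \<le> N * R v * \<kappa> * (\<theta> * \<kappa>)"
        using k(1,5) NR by (intro mult_left_mono) auto
      finally show ?thesis using True by (simp add: \<rho>_def mult_ac)
    next
      case False
      let ?S = "X * U VX VX + X * U VY VY + X * U VT VT + 2 * (X * U VX VY) + X * U VX VZ + 2 * (X * U VX VT)
        + X * U VY VZ + 2 * (X * U VY VT) + X * U VZ VT"
      have "norm ?S \<le> N * R v * (\<rho> VX * \<rho> VX) + N * R v * (\<rho> VY * \<rho> VY) + N * R v * (\<rho> VT * \<rho> VT)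
          + 2 * (N * R v * (\<rho> VX * \<rho> VY)) + N * R v * (\<rho> VX * \<rho> VZ) + 2 * (N * R v * (\<rho> VX * \<rho> VT))
          + N * R v * (\<rho> VY * \<rho> VZ) + 2 * (N * R v * (\<rho> VY * \<rho> VT)) + N * R v * (\<rho> VZ * \<rho> VT)"
        by (intro norm_triangle_mono b b2)
      also have "\<dots> = N * R v * (\<sigma> * (\<sigma> + \<kappa>))"
        by (simp add: \<rho>_def \<sigma>_def algebra_simps)
      also have "\<dots> \<le> N * R v * \<theta>"
        using k(4) NR by (intro mult_left_mono)
      finally have S: "norm ?S \<le> N * R v * \<theta>" .
      have "X * U i i = coord i P * ?S" using eq False by simp
      then have "norm (X * U i i) = norm (coord i P) * norm ?S" by (simp only: norm_mult)
      then have "norm (X * U i i) \<le> norm (coord i P) * (N * R v * \<theta>)"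
        using S by (simp only: mult_left_mono norm_ge_zero)
      moreover have "norm (coord i P) = \<rho> i * \<rho> i"
        using False by (cases i) (simp_all add: P \<rho>_def)
      ultimately show ?thesis by (simp add: mult_ac)
    qed
    moreover have "V w = X * U i i" "R w = R v * (\<rho> i * \<rho> i)"
      using perm[OF ms] U[of i i] by (simp_all add: v_def R_def mult_ac)
    ultimately show ?thesis by (simp add: mult_ac)
  qed
  have "W \<noteq> {}" by (auto simp: W_def)
  obtain w1 where w1: "w1 \<in> W" "N = norm (V w1) / R w1"
  proof -
    have "N \<in> (\<lambda>w. norm (V w) / R w) ` W"
      unfolding N_def using \<open>W \<noteq> {}\<close> finW by (intro Max_in) auto
    then show ?thesis using that by blast
  qed
  have "N * R w1 \<le> \<theta> * N * R w1"
    using contract[OF w1(1)] w1(2) R[of w1] by simp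
  then have "N \<le> \<theta> * N" using R[of w1] by (rule mult_right_le_imp_le)
  then have "N * (1 - \<theta>) \<le> 0" by (simp add: algebra_simps)
  then have "N = 0" using N0 k(3) by (simp add: mult_le_0_iff)
  then have "V w0 = 0" using bound[of w0] by (simp add: W_def)
  moreover have "prod_list (map (\<lambda>i. coord i P) w0) \<noteq> 0"
    using co0 by (auto simp: prod_list_zero_iff)
  ultimately show ?case by (simp add: V_def)
qed

text \<open>
  The sixteen subsets of the variables index both the initial data of a solution at a point (the
  derivatives along squarefree words) and, later, the sixteen series solutions.
\<close>
definition sqfree_word :: "var set \<Rightarrow> var list" where
  "sqfree_word S = filter (\<lambda>i. i \<in> S) [VX, VY, VZ, VT]"

lemma set_sqfree_word: "set (sqfree_word S) = S"
proof -
  have "set (sqfree_word S) = UNIV \<inter> S" unfolding sqfree_word_def UNIV_var by auto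
  then show ?thesis by simp
qed

text \<open>
  The zeros of the squarefree jet form a closed set, and an open one because the solution vanishes
  near each of them. Consequently the solution space has dimension at most sixteen on any
  connected open subset of \<open>K2_domain\<close>.
\<close>
lemma jet_determines:
  assumes "open D" "connected D" "D \<subseteq> K2_domain" "holomorphic4_on u D"
    and eqs: "\<And>Q i. Q \<in> D \<Longrightarrow> diff_op (K2_eq a b c e i) u Q = 0"
    and "P0 \<in> D" "\<And>S. word_deriv (sqfree_word S) u P0 = 0" "P \<in> D"
  shows "u P = 0"
proof -
  define Z where "Z = {P\<in>D. \<forall>S. word_deriv (sqfree_word S) u P = 0}"
  have locally_zero: "\<exists>r>0. ball Q r \<subseteq> D \<and> (\<forall>Q'\<in>ball Q r. u Q' = 0)" if "Q \<in> Z" for Q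
  proof -
    have Q: "Q \<in> D" "\<And>S. word_deriv (sqfree_word S) u Q = 0" using that by (auto simp: Z_def)
    have "word_deriv w u Q = 0" if "distinct w" for w
    proof -
      have "set w = set (sqfree_word (set w))"
        by (simp add: set_sqfree_word)
      then have "mset w = mset (sqfree_word (set w))"
        using that by (subst set_eq_iff_mset_eq_distinct[symmetric]) (auto simp: sqfree_word_def)
      then show ?thesis
        using word_deriv_perm[OF assms(1,4) Q(1)] Q(2) by metis
    qed
    then have flat: "word_deriv w u Q = 0" for w
      using squarefree_flat[OF assms(1) Q(1) assms(3,4) eqs] by blast
    obtain r where "0 < r" "ball Q r \<subseteq> D"
      using assms(1) Q(1) open_contains_ball by blast
    then show ?thesis
      using flat_imp_zero[OF assms(1,4) _ flat] by blast
  qed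
  have "openin (top_of_set D) Z"
  proof -
    have "\<exists>r>0. ball Q r \<subseteq> Z" if QZ: "Q \<in> Z" for Q
    proof -
      obtain r where r: "0 < r" "ball Q r \<subseteq> D" "\<And>Q'. Q' \<in> ball Q r \<Longrightarrow> u Q' = 0"
        using locally_zero[OF QZ] by blast
      have "word_deriv w u Q' = 0" if "Q' \<in> ball Q r" for w Q'
      proof -
        have "word_deriv w u Q' = word_deriv w (\<lambda>P. 0) Q'"
          by (rule word_deriv_cong[OF open_ball _ that]) (rule r(3))
        then show ?thesis by (simp add: word_deriv_zero)
      qed
      then show ?thesis using r by (auto simp: Z_def simp del: mem_ball)
    qed
    then have "open Z" by (simp add: open_contains_ball)
    moreover have "Z \<subseteq> D" by (auto simp: Z_def)
    ultimately show ?thesis using assms(1) openin_open_eq by blast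
  qed
  moreover have "closedin (top_of_set D) Z"
  proof -
    have "Z = (\<Inter>S. {P\<in>D. word_deriv (sqfree_word S) u P = 0})" by (auto simp: Z_def)
    moreover have "closedin (top_of_set D) {P\<in>D. word_deriv (sqfree_word S) u P = 0}" for S
      by (intro continuous_closedin_preimage_constant holomorphic4_continuous holomorphic4_word_deriv assms)
    ultimately show ?thesis by (simp only: closedin_INT) (intro closedin_INT; simp)
  qed
  moreover have "P0 \<in> Z" using assms by (simp add: Z_def)
  ultimately have "Z = D"
    using assms(2) unfolding connected_clopen by blast
  then obtain r where "0 < r" "\<forall>Q'\<in>ball P r. u Q' = 0"
    using locally_zero[of P] assms(8) by blast
  then show ?thesis by simp
qed

section \<open>Convergence of the quadruple series\<close>

text \<open>
  A ratio test that yields a bound instead of convergence.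
\<close>
lemma geometric_growth:
  fixes g :: "nat \<Rightarrow> real"
  assumes "\<And>n. 0 \<le> g n" "1 < R" "eventually (\<lambda>n. g (Suc n) \<le> R * g n) sequentially"
  obtains C where "0 < C" "\<And>n. g n \<le> C * R ^ n"
proof -
  obtain N where N: "\<And>n. n \<ge> N \<Longrightarrow> g (Suc n) \<le> R * g n"
    using assms(3) unfolding eventually_sequentially by blast
  define C where "C = 1 + (\<Sum>k\<le>N. g k)"
  have C: "0 < C" unfolding C_def using sum_nonneg[of "{..N}" g] assms(1) by simp
  have small: "g n \<le> C * R ^ n" if "n \<le> N" for n
  proof -
    have "g n \<le> C"
      using member_le_sum[of n "{..N}" g] assms(1) that by (simp add: C_def)
    also have "\<dots> \<le> C * R ^ n"
      using C assms(2) by (simp add: one_le_power)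
    finally show ?thesis .
  qed
  have "g n \<le> C * R ^ n" if "n \<ge> N" for n
    using that
  proof (induction n rule: dec_induct)
    case (step n)
    have "g (Suc n) \<le> R * (C * R ^ n)"
      using N[OF step(1)] step(3) assms(2) by (smt (verit) mult_left_mono)
    then show ?case by (simp add: mult_ac)
  qed (simp add: small)
  then have "g n \<le> C * R ^ n" for n
    using small by (meson nle_le)
  then show ?thesis using C that by blast
qed

lemma pochhammer_growth:
  fixes a :: complex
  assumes "1 < R"
  obtains C where "0 < C" "\<And>n. norm (pochhammer a n) \<le> C * R ^ n * fact n"
proof -
  have "eventually (\<lambda>n. norm a + real n \<le> R * (real n + 1)) sequentially"
    using assms by real_asymp
  then have "eventually (\<lambda>n. norm (pochhammer a (Suc n)) / fact (Suc n) \<le>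
      R * (norm (pochhammer a n) / fact n)) sequentially"
  proof eventually_elim
    case (elim n)
    have "norm (a + of_nat n) \<le> R * (real n + 1)"
      using elim norm_triangle_ineq[of a "of_nat n"] by simp
    then have "norm (a + of_nat n) / (real n + 1) \<le> R"
      by (simp add: field_simps)
    then have "norm (pochhammer a n) / fact n * (norm (a + of_nat n) / (real n + 1)) \<le> norm (pochhammer a n) / fact n * R"
      by (rule mult_left_mono) simp
    moreover have "norm (pochhammer a (Suc n)) / fact (Suc n) =
        norm (pochhammer a n) / fact n * (norm (a + of_nat n) / (real n + 1))"
      by (simp only: pochhammer_Suc norm_mult fact_Suc) simp
    ultimately show ?case
      by (simp only: mult.commute)
  qed
  then obtain C where "0 < C" "\<And>n. norm (pochhammer a n) / fact n \<le> C * R ^ n"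
    using geometric_growth[of "\<lambda>n. norm (pochhammer a n) / fact n" R] assms by auto
  then show ?thesis using that[of C] by (simp add: field_simps)
qed

lemma pochhammer_not_Ints:
  fixes e :: complex
  assumes "e \<notin> \<int>"
  shows "pochhammer e n \<noteq> 0"
  using assms pochhammer_eq_0_iff by (metis Ints_minus Ints_of_nat)

lemma inverse_pochhammer_growth:
  fixes e :: complex
  assumes "1 < R" "e \<notin> \<int>"
  obtains C where "0 < C" "\<And>n. fact n / norm (pochhammer e n) \<le> C * R ^ n"
proof -
  have "eventually (\<lambda>n. real n + 1 \<le> R * (real n - norm e)) sequentially"
    using assms by real_asymp
  then have "eventually (\<lambda>n. fact (Suc n) / norm (pochhammer e (Suc n)) \<le>
      R * (fact n / norm (pochhammer e n))) sequentially"
  proof eventually_elim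
    case (elim n)
    have ne: "pochhammer e n \<noteq> 0" "pochhammer e (Suc n) \<noteq> 0"
      using pochhammer_not_Ints[OF assms(2)] by blast+
    then have ne2: "e + of_nat n \<noteq> 0" by (auto simp: pochhammer_Suc)
    have "real n + 1 \<le> R * norm (e + of_nat n)"
    proof -
      have "real n - norm e \<le> norm (e + of_nat n)"
        using norm_diff_ineq[of "of_nat n" e] by (simp add: add.commute)
      then have "R * (real n - norm e) \<le> R * norm (e + of_nat n)"
        using assms(1) by (intro mult_left_mono) auto
      then show ?thesis using elim by linarith
    qed
    then have "(real n + 1) / norm (e + of_nat n) \<le> R"
      using ne2 by (simp add: field_simps)
    then have "fact n / norm (pochhammer e n) * ((real n + 1) / norm (e + of_nat n)) \<le> fact n / norm (pochhammer e n) * R"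
      by (rule mult_left_mono) simp
    moreover have "fact (Suc n) / norm (pochhammer e (Suc n)) =
        fact n / norm (pochhammer e n) * ((real n + 1) / norm (e + of_nat n))"
      by (simp only: pochhammer_Suc norm_mult fact_Suc) simp
    ultimately show ?case
      by (simp only: mult.commute)
  qed
  then show ?thesis
    using geometric_growth[of "\<lambda>n. fact n / norm (pochhammer e n)" R] assms(1) that by auto
qed

lemma binomial_term_bound:
  fixes A B :: real
  assumes "0 \<le> A" "0 \<le> B"
  shows "fact (m + n) / (fact m * fact n) * A ^ m * B ^ n \<le> (A + B) ^ (m + n)"
proof -
  have "of_nat ((m + n) choose m) * A ^ m * B ^ (m + n - m) \<le> (A + B) ^ (m + n)"
    unfolding binomial_ring
    by (rule member_le_sum[where f = "\<lambda>k. of_nat ((m + n) choose k) * A ^ k * B ^ (m + n - k)"])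
       (use assms in auto)
  then show ?thesis
    by (simp add: binomial_fact)
qed

text \<open>
  A single term of the expansion of the power on the right.
\<close>
lemma trinomial_term_bound:
  fixes A B T :: real
  assumes "0 \<le> A" "0 \<le> B" "0 \<le> T"
  shows "fact (m + n + q) / (fact m * fact n * fact q) * (A ^ m * B ^ n * T ^ q) \<le> (A + B + T) ^ (m + n + q)"
proof -
  have "fact (m + n + q) / (fact m * fact n * fact q) * (A ^ m * B ^ n * T ^ q) =
     fact (m + n + q) / (fact (m + n) * fact q) * (fact (m + n) / (fact m * fact n) * A ^ m * B ^ n) * T ^ q"
    by (simp add: mult_ac)
  also have "\<dots> \<le> fact (m + n + q) / (fact (m + n) * fact q) * (A + B) ^ (m + n) * T ^ q"
    using binomial_term_bound[OF assms(1,2)] assms by (intro mult_right_mono mult_left_mono) auto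
  also have "\<dots> \<le> (A + B + T) ^ (m + n + q)"
    using assms by (intro binomial_term_bound) auto
  finally show ?thesis .
qed

definition K2_gauge :: "c4 \<Rightarrow> real" where
  "K2_gauge = (\<lambda>(x, y, z, t). (sqrt (norm x) + sqrt (norm y) + sqrt (norm t))\<^sup>2 + norm z)"

definition K2_region :: "c4 set" where
  "K2_region = {P. K2_gauge P < 1}"

type_synonym idx = "nat \<times> nat \<times> nat \<times> nat"

definition K2_coeff :: "complex \<Rightarrow> complex \<Rightarrow> complex \<Rightarrow> (var \<Rightarrow> complex) \<Rightarrow> idx \<Rightarrow> complex" where
  "K2_coeff a b c e = (\<lambda>(m, n, p, q).
     pochhammer a (m + n + p + q) * pochhammer b (m + n + q) * pochhammer c p /
     (pochhammer (e VX) m * pochhammer (e VY) n * pochhammer (e VZ) p * pochhammer (e VT) q *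
      (fact m * fact n * fact p * fact q)))"

definition power4 :: "idx \<Rightarrow> c4 \<Rightarrow> complex" where
  "power4 = (\<lambda>(m, n, p, q) P. coord VX P ^ m * coord VY P ^ n * coord VZ P ^ p * coord VT P ^ q)"

definition degree4 :: "idx \<Rightarrow> nat" where
  "degree4 = (\<lambda>(m, n, p, q). m + n + p + q)"

lemma exton_K2_eq:
  "exton_K2 a b c (e VX) (e VY) (e VZ) (e VT) P = (\<Sum>\<^sub>\<infinity>k. K2_coeff a b c e k * power4 k P)"
proof -
  obtain x y z t where P: "P = (x, y, z, t)" by (metis prod.exhaust)
  show ?thesis
    unfolding P exton_K2_def prod.case
    by (rule infsum_cong) (auto simp: K2_coeff_def power4_def mult_ac)
qed

text \<open>
  Up to a factor \<open>C R\<^sup>3\<^sup>N\<close> with \<open>N = m + n + p + q\<close>, the coefficient is the binomial coefficient of \<open>N\<close> over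
  \<open>p\<close> times the square of the trinomial coefficient of \<open>(m, n, q)\<close>. Pairing the square with the square
  roots of \<open>|x|, |y|, |t|\<close> and bounding both coefficients by the powers in whose expansion they occur
  gives \<open>((\<surd>|x| + \<surd>|y| + \<surd>|t|)\<^sup>2 + |z|)\<^sup>N\<close>, hence a geometric majorant.
\<close>
lemma K2_term_bound:
  assumes "\<And>i. e i \<notin> \<int>" "1 < R"
  obtains C where "0 < C"
    "\<And>k P. norm (K2_coeff a b c e k * power4 k P) \<le> C * (R ^ 3 * K2_gauge P) ^ degree4 k"
proof -
  obtain Ca where Ca: "0 < Ca" "\<And>n. norm (pochhammer a n) \<le> Ca * R ^ n * fact n"
    using pochhammer_growth[OF assms(2)] by blast
  obtain Cb where Cb: "0 < Cb" "\<And>n. norm (pochhammer b n) \<le> Cb * R ^ n * fact n"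
    using pochhammer_growth[OF assms(2)] by blast
  obtain Cc where Cc: "0 < Cc" "\<And>n. norm (pochhammer c n) \<le> Cc * R ^ n * fact n"
    using pochhammer_growth[OF assms(2)] by blast
  have "\<exists>C. 0 < C \<and> (\<forall>n. fact n / norm (pochhammer (e i) n) \<le> C * R ^ n)" for i
    using inverse_pochhammer_growth[OF assms(2,1)] by blast
  then obtain Ce where Ce: "\<And>i. 0 < Ce i" "\<And>i n. fact n / norm (pochhammer (e i) n) \<le> Ce i * R ^ n"
    by metis
  have Ce': "1 / norm (pochhammer (e i) n) \<le> Ce i * R ^ n / fact n" for i n
    using Ce(2)[of n i] by (simp add: field_simps)
  define C where "C = Ca * Cb * Cc * (Ce VX * Ce VY * Ce VZ * Ce VT)"
  have "norm (K2_coeff a b c e k * power4 k P) \<le> C * (R ^ 3 * K2_gauge P) ^ degree4 k" for k P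
  proof -
    obtain x y z t where P: "P = (x, y, z, t)" by (metis prod.exhaust)
    obtain m n p q where k: "k = (m, n, p, q)" by (metis prod.exhaust)
    define A B T where "A = sqrt (norm x)" and "B = sqrt (norm y)" and "T = sqrt (norm t)"
    have sq: "norm x = A\<^sup>2" "norm y = B\<^sup>2" "norm t = T\<^sup>2" and nn: "0 \<le> A" "0 \<le> B" "0 \<le> T"
      by (simp_all add: A_def B_def T_def)
    define M where "M = m + n + q"
    define \<sigma> where "\<sigma> = A + B + T"
    have "norm (K2_coeff a b c e k) =
      norm (pochhammer a (M + p)) * norm (pochhammer b M) * norm (pochhammer c p) *
      ((1 / norm (pochhammer (e VX) m)) * (1 / norm (pochhammer (e VY) n)) *
       (1 / norm (pochhammer (e VZ) p)) * (1 / norm (pochhammer (e VT) q))) / (fact m * fact n * fact p * fact q)"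
      by (simp add: K2_coeff_def k norm_mult norm_divide M_def add_ac)
    also have "\<dots> \<le> (Ca * R ^ (M + p) * fact (M + p)) * (Cb * R ^ M * fact M) * (Cc * R ^ p * fact p) *
      ((Ce VX * R ^ m / fact m) * (Ce VY * R ^ n / fact n) * (Ce VZ * R ^ p / fact p) * (Ce VT * R ^ q / fact q))
       / (fact m * fact n * fact p * fact q)"
      using Ca Cb Cc Ce(1) Ce' assms(2)
      by (intro divide_right_mono mult_mono mult_nonneg_nonneg) (auto simp: less_imp_le)
    also have "\<dots> = C * R ^ (3 * (M + p)) * ((fact (M + p) / (fact M * fact p)) * (fact M / (fact m * fact n * fact q))\<^sup>2)"
    proof -
      have "R ^ (M + p) * R ^ M * R ^ p * (R ^ m * R ^ n * R ^ p * R ^ q) = R ^ (3 * (M + p))"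
        unfolding power_add[symmetric] by (rule arg_cong[of _ _ "power R"]) (simp add: M_def)
      then show ?thesis
        unfolding C_def by (simp add: field_simps power2_eq_square)
    qed
    finally have coeff: "norm (K2_coeff a b c e k) \<le>
      C * R ^ (3 * (M + p)) * ((fact (M + p) / (fact M * fact p)) * (fact M / (fact m * fact n * fact q))\<^sup>2)" .
    have pw: "norm (power4 k P) = (A ^ m * B ^ n * T ^ q)\<^sup>2 * norm z ^ p"
      by (simp add: power4_def k P norm_mult norm_power sq power_mult_distrib power_mult[symmetric] mult_ac)
    have "(fact (M + p) / (fact M * fact p)) * (fact M / (fact m * fact n * fact q))\<^sup>2 * ((A ^ m * B ^ n * T ^ q)\<^sup>2 * norm z ^ p)
       = fact (M + p) / (fact M * fact p) * (fact M / (fact m * fact n * fact q) * (A ^ m * B ^ n * T ^ q))\<^sup>2 * norm z ^ p"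
      by (simp only: power_mult_distrib mult.assoc mult.commute mult.left_commute)
    also have "\<dots> \<le> fact (M + p) / (fact M * fact p) * (\<sigma> ^ M)\<^sup>2 * norm z ^ p"
      using trinomial_term_bound[OF nn, of m n q] nn
      by (intro mult_right_mono mult_left_mono power_mono) (auto simp: M_def \<sigma>_def)
    also have "\<dots> = fact (M + p) / (fact M * fact p) * (\<sigma>\<^sup>2) ^ M * norm z ^ p"
      by (simp add: power_mult[symmetric] mult.commute)
    also have "\<dots> \<le> (\<sigma>\<^sup>2 + norm z) ^ (M + p)"
      by (intro binomial_term_bound) auto
    finally have comb: "(fact (M + p) / (fact M * fact p)) * (fact M / (fact m * fact n * fact q))\<^sup>2 * ((A ^ m * B ^ n * T ^ q)\<^sup>2 * norm z ^ p)
       \<le> (\<sigma>\<^sup>2 + norm z) ^ (M + p)" .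
    have C0: "0 \<le> C * R ^ (3 * (M + p))"
      using Ca(1) Cb(1) Cc(1) Ce(1) assms(2) by (simp add: C_def less_imp_le)
    have "norm (K2_coeff a b c e k * power4 k P) \<le>
       C * R ^ (3 * (M + p)) * ((fact (M + p) / (fact M * fact p)) * (fact M / (fact m * fact n * fact q))\<^sup>2) *
       ((A ^ m * B ^ n * T ^ q)\<^sup>2 * norm z ^ p)"
      unfolding norm_mult pw using coeff by (intro mult_right_mono) auto
    also have "\<dots> \<le> C * R ^ (3 * (M + p)) * (\<sigma>\<^sup>2 + norm z) ^ (M + p)"
      using mult_left_mono[OF comb C0] by (simp add: mult_ac)
    also have "\<dots> = C * (R ^ 3 * K2_gauge P) ^ degree4 k"
    proof -
      have "K2_gauge P = \<sigma>\<^sup>2 + norm z" "degree4 k = M + p"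
        by (simp_all add: K2_gauge_def P degree4_def k \<sigma>_def A_def B_def T_def M_def)
      then show ?thesis
        by (simp only: power_mult_distrib power_mult mult.assoc)
    qed
    finally show ?thesis .
  qed
  moreover have "0 < C" using Ca(1) Cb(1) Cc(1) Ce(1) by (simp add: C_def)
  ultimately show ?thesis using that by blast
qed

lemma continuous_on_K2_gauge: "continuous_on UNIV K2_gauge"
  unfolding K2_gauge_def case_prod_beta by (intro continuous_intros)

lemma open_K2_region: "open K2_region"
  unfolding K2_region_def
  using open_Collect_less[OF continuous_on_K2_gauge continuous_on_const] .

lemma K2_gauge_nonneg: "0 \<le> K2_gauge P"
  by (cases P) (simp add: K2_gauge_def)

lemma summable_on_prod_nonneg:
  fixes f :: "'a \<Rightarrow> real" and g :: "'b \<Rightarrow> real"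
  assumes "f summable_on UNIV" "g summable_on UNIV" "\<And>x. 0 \<le> f x" "\<And>y. 0 \<le> g y"
  shows "(\<lambda>(x, y). f x * g y) summable_on UNIV"
proof -
  have "(\<lambda>(x, y). f x * g y) summable_on (SIGMA x:UNIV. UNIV)"
  proof (rule summable_on_SigmaI[where g = "\<lambda>x. f x * infsum g UNIV"])
    show "((\<lambda>y. case (x, y) of (x, y) \<Rightarrow> f x * g y) has_sum f x * infsum g UNIV) UNIV" for x
      using has_sum_cmult_right[OF has_sum_infsum[OF assms(2)]] by simp
    show "(\<lambda>x. f x * infsum g UNIV) summable_on UNIV"
      by (intro summable_on_cmult_left assms)
  qed (use assms in auto)
  then show ?thesis by simp
qed

lemma summable_on_degree4:
  fixes r :: real
  assumes "0 \<le> r" "r < 1"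
  shows "(\<lambda>k. r ^ degree4 k) summable_on UNIV"
proof -
  have 1: "(\<lambda>n. r ^ n) summable_on UNIV"
    using assms by (intro norm_summable_imp_summable_on) (simp add: summable_geometric)
  have "(\<lambda>(m, n, p, q). r ^ m * (r ^ n * (r ^ p * r ^ q))) summable_on UNIV"
    using summable_on_prod_nonneg[OF 1 summable_on_prod_nonneg[OF 1 summable_on_prod_nonneg[OF 1 1]]] assms
    by (simp add: case_prod_unfold)
  then show ?thesis
    by (simp add: degree4_def power_add case_prod_unfold mult_ac)
qed

lemma holomorphic4_power: "holomorphic4_on f D \<Longrightarrow> holomorphic4_on (\<lambda>P. f P ^ n) D"
  by (induction n) (auto intro: holomorphic4_mult)

lemma loc_summable_K2_terms:
  assumes "\<And>i. e i \<notin> \<int>"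
  shows "loc_summable (\<lambda>k P. K2_coeff a b c e k * power4 k P) K2_region"
  unfolding loc_summable_def
proof (intro conjI allI ballI)
  show "holomorphic4_on (\<lambda>P. K2_coeff a b c e k * power4 k P) K2_region" for k
    by (cases k) (auto simp: power4_def intro!: holomorphic4_mult holomorphic4_power)
  fix P assume "P \<in> K2_region"
  then have g1: "K2_gauge P < 1" by (simp add: K2_region_def)
  then obtain r where r: "K2_gauge P < r" "r < 1" using dense by blast
  have r0: "0 < r" using r K2_gauge_nonneg[of P] by linarith
  \<comment> \<open>\<open>R > 1\<close> is chosen so that \<open>R\<^sup>3 r = 1 / R\<close> is still less than \<open>1\<close>.\<close>
  define R where "R = root 4 (1 / r)"
  have R: "1 < R" "R ^ 4 = 1 / r" using r r0 by (simp_all add: R_def)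
  obtain C where C: "0 < C"
    "\<And>k P. norm (K2_coeff a b c e k * power4 k P) \<le> C * (R ^ 3 * K2_gauge P) ^ degree4 k"
    by (fact K2_term_bound[OF assms R(1)])
  define S where "S = {Q. K2_gauge Q < r}"
  have "open S"
    unfolding S_def using open_Collect_less[OF continuous_on_K2_gauge continuous_on_const] .
  moreover have "P \<in> S" using r(1) by (simp add: S_def)
  ultimately obtain \<delta> where d: "0 < \<delta>" "ball P \<delta> \<subseteq> S"
    using open_contains_ball by blast
  have Rr: "R ^ 3 * r = 1 / R"
    using R r0 by (simp add: field_simps eval_nat_numeral)
  have bound: "norm (K2_coeff a b c e k * power4 k Q) \<le> C * (1 / R) ^ degree4 k" if "Q \<in> ball P \<delta>" for k Q
  proof -
    have "Q \<in> S" using d(2) that by (rule subsetD)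
    then have "K2_gauge Q \<le> r" by (simp add: S_def)
    then have "R ^ 3 * K2_gauge Q \<le> 1 / R"
      using R(1) mult_left_mono[of "K2_gauge Q" r "R ^ 3"] by (simp add: Rr)
    then have "(R ^ 3 * K2_gauge Q) ^ degree4 k \<le> (1 / R) ^ degree4 k"
      using R(1) K2_gauge_nonneg by (intro power_mono) auto
    then show ?thesis using C(2)[of k Q] C(1) by (smt (verit) mult_left_mono)
  qed
  have "(\<lambda>k. C * (1 / R) ^ degree4 k) summable_on UNIV"
    using R(1) by (intro summable_on_cmult_right summable_on_degree4) auto
  then show "\<exists>\<delta>>0. \<exists>M. M summable_on UNIV \<and> (\<forall>k. \<forall>Q\<in>ball P \<delta>. norm (K2_coeff a b c e k * power4 k Q) \<le> M k)"
    using d(1) bound by (intro exI[of _ \<delta>] exI[of _ "\<lambda>k. C * (1 / R) ^ degree4 k"] conjI allI ballI)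
qed

section \<open>Termwise action of the system on series of monomials\<close>

lemma loc_summable_cong:
  assumes "open D" "loc_summable f D" "\<And>i P. P \<in> D \<Longrightarrow> f i P = g i P"
  shows "loc_summable g D"
  unfolding loc_summable_def
proof (intro conjI allI ballI)
  show "holomorphic4_on (g i) D" for i
    by (rule holomorphic4_cong[OF assms(1) assms(3)]) (use assms(2) in \<open>auto simp: loc_summable_def\<close>)
  fix P assume P: "P \<in> D"
  obtain \<delta> M where *: "0 < \<delta>" "M summable_on UNIV" "\<And>i Q. Q \<in> ball P \<delta> \<Longrightarrow> norm (f i Q) \<le> M i"
    by (fact loc_summableE[OF assms(2) P])
  obtain d where d: "0 < d" "ball P d \<subseteq> D"
    using assms(1) P open_contains_ball by blast
  have "norm (g i Q) \<le> M i" if "Q \<in> ball P (min \<delta> d)" for i Q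
  proof -
    have "Q \<in> D" "Q \<in> ball P \<delta>" using that d(2) by (auto simp: subset_iff simp del: split_paired_All)
    then show ?thesis using *(3)[of Q i] assms(3)[of Q i] by simp
  qed
  then show "\<exists>\<delta>>0. \<exists>M. M summable_on UNIV \<and> (\<forall>i. \<forall>Q\<in>ball P \<delta>. norm (g i Q) \<le> M i)"
    using d(1) *(1,2) by (intro exI[of _ "min \<delta> d"] exI[of _ M] conjI allI ballI) auto
qed

lemma loc_summable_subset: "loc_summable f D \<Longrightarrow> E \<subseteq> D \<Longrightarrow> loc_summable f E"
  unfolding loc_summable_def by (meson holomorphic4_subset subsetD)

lemma word_deriv_has_sum:
  assumes "open D" "P \<in> D"
  shows "loc_summable f D \<Longrightarrow> ((\<lambda>k. word_deriv w (f k) P) has_sum word_deriv w (\<lambda>Q. \<Sum>\<^sub>\<infinity>k. f k Q) P) UNIV"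
proof (induction w arbitrary: f)
  case Nil
  then show ?case using loc_summable_has_sum[OF _ assms(2)] by simp
next
  case (Cons i w)
  have "word_deriv w (part_deriv i (\<lambda>Q. \<Sum>\<^sub>\<infinity>k. f k Q)) P = word_deriv w (\<lambda>Q. \<Sum>\<^sub>\<infinity>k. part_deriv i (f k) Q) P"
  proof (rule word_deriv_cong[OF assms(1) _ assms(2)])
    fix Q assume "Q \<in> D"
    from infsumI[OF loc_summable_dir_deriv_has_sum(2)[OF assms(1) Cons.prems this]]
    show "part_deriv i (\<lambda>Q. \<Sum>\<^sub>\<infinity>k. f k Q) Q = (\<Sum>\<^sub>\<infinity>k. part_deriv i (f k) Q)" by (rule sym)
  qed
  then show ?case
    using Cons.IH[OF loc_summable_dir_deriv[OF assms(1) Cons.prems]] by simp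
qed

lemma diff_op_has_sum:
  assumes "open D" "P \<in> D" "loc_summable f D"
  shows "((\<lambda>k. diff_op L (f k) P) has_sum diff_op L (\<lambda>Q. \<Sum>\<^sub>\<infinity>k. f k Q) P) UNIV"
proof (induction L)
  case Nil
  then show ?case by (simp add: diff_op_def)
next
  case (Cons gs L)
  obtain g s where gs: "gs = (g, s)" by (cases gs)
  show ?case
    using has_sum_add[OF has_sum_cmult_right[OF word_deriv_has_sum[OF assms, of s], of "g P"] Cons]
    by (simp add: diff_op_def gs)
qed

lemma holomorphic4_compose:
  assumes "holomorphic4_on f D" "\<And>P. P \<in> D \<Longrightarrow> \<exists>c. (g has_field_derivative c) (at (f P))"
  shows "holomorphic4_on (\<lambda>P. g (f P)) D"
  unfolding holomorphic4_on_def
proof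
  fix P assume P: "P \<in> D"
  obtain A B C E where f: "(f has_derivative (\<lambda>(h1, h2, h3, h4). A * h1 + B * h2 + C * h3 + E * h4)) (at P)"
    using assms P unfolding holomorphic4_on_def by blast
  obtain c where c: "(g has_field_derivative c) (at (f P))" using assms(2)[OF P] by blast
  have "((\<lambda>P. g (f P)) has_derivative
    (\<lambda>(h1, h2, h3, h4). (c * A) * h1 + (c * B) * h2 + (c * C) * h3 + (c * E) * h4)) (at P)"
    by (rule has_derivative_eq_rhs[OF has_derivative_compose[OF f c[unfolded has_field_derivative_def]]])
       (auto simp: algebra_simps)
  then show "\<exists>A B C E. ((\<lambda>P. g (f P)) has_derivative (\<lambda>(h1, h2, h3, h4). A * h1 + B * h2 + C * h3 + E * h4)) (at P)"
    by blast
qed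

definition cmonomial :: "(var \<Rightarrow> complex) \<Rightarrow> c4 \<Rightarrow> complex" where
  "cmonomial \<alpha> P = coord VX P powr \<alpha> VX * coord VY P powr \<alpha> VY * coord VZ P powr \<alpha> VZ * coord VT P powr \<alpha> VT"

lemma K2_domain_eq: "K2_domain = K2_region \<inter> {P. \<forall>i. coord i P \<notin> \<real>\<^sub>\<le>\<^sub>0}"
proof -
  have all: "(\<forall>i. Q i) \<longleftrightarrow> Q VX \<and> Q VY \<and> Q VZ \<and> Q VT" for Q
    by (metis var.exhaust)
  show ?thesis
    unfolding all by (auto simp: K2_domain_def K2_region_def K2_gauge_def)
qed

lemma coord_not_nonpos: "P \<in> K2_domain \<Longrightarrow> coord i P \<notin> \<real>\<^sub>\<le>\<^sub>0"
  by (simp add: K2_domain_eq)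

lemma coord_nonzero: "P \<in> K2_domain \<Longrightarrow> coord i P \<noteq> 0"
  using coord_not_nonpos[of P i] by auto

lemma K2_domain_subset: "K2_domain \<subseteq> K2_region"
  by (auto simp: K2_domain_eq)

lemma open_K2_domain: "open K2_domain"
proof -
  have "open ((coord i) -` (- \<real>\<^sub>\<le>\<^sub>0))" for i
    using holomorphic4_continuous[OF holomorphic4_coord[of i UNIV]]
    by (intro open_vimage) (auto simp: open_Compl)
  then have "open (\<Inter>i. (coord i) -` (- \<real>\<^sub>\<le>\<^sub>0))"
    by (intro open_INT) auto
  then have "open (K2_region \<inter> (\<Inter>i. (coord i) -` (- \<real>\<^sub>\<le>\<^sub>0)))"
    by (intro open_Int open_K2_region)
  moreover have "K2_domain = K2_region \<inter> (\<Inter>i. (coord i) -` (- \<real>\<^sub>\<le>\<^sub>0))"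
    unfolding K2_domain_eq by auto
  ultimately show ?thesis by (simp only:)
qed

lemma holomorphic4_coord_powr: "holomorphic4_on (\<lambda>P. coord i P powr c) K2_domain"
  using has_field_derivative_powr[OF coord_not_nonpos]
  by (intro holomorphic4_compose[where g = "\<lambda>s. s powr c"] holomorphic4_coord) blast

lemma holomorphic4_cmonomial: "holomorphic4_on (cmonomial \<alpha>) K2_domain"
  unfolding cmonomial_def[abs_def] by (intro holomorphic4_mult holomorphic4_coord_powr)

lemma part_deriv_cmonomial:
  assumes "P \<in> K2_domain"
  shows "part_deriv i (\<lambda>P. c * cmonomial \<alpha> P) P = c * \<alpha> i * cmonomial (\<alpha>(i := \<alpha> i - 1)) P"
proof -
  obtain x y z t where P: "P = (x, y, z, t)" by (metis prod.exhaust)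
  have nn: "x \<notin> \<real>\<^sub>\<le>\<^sub>0" "y \<notin> \<real>\<^sub>\<le>\<^sub>0" "z \<notin> \<real>\<^sub>\<le>\<^sub>0" "t \<notin> \<real>\<^sub>\<le>\<^sub>0"
    using assms by (auto simp: K2_domain_def P)
  have *: "((\<lambda>s. (x + s) powr r) has_field_derivative r * x powr (r - 1)) (at 0)" if "x \<notin> \<real>\<^sub>\<le>\<^sub>0" for x r :: complex
    using has_field_derivative_powr[of "x" r] that DERIV_shift[of "\<lambda>s. s powr r" "r * x powr (r - 1)" 0 x]
    by (simp add: add.commute)
  show ?thesis
    unfolding dir_deriv_def
  proof (rule DERIV_imp_deriv, cases i)
    case VX
    from DERIV_cmult[OF *[OF nn(1), of "\<alpha> VX"], of "c * (y powr \<alpha> VY * z powr \<alpha> VZ * t powr \<alpha> VT)"]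
    show "((\<lambda>s. c * cmonomial \<alpha> (P + cscale s (unit_vec i))) has_field_derivative c * \<alpha> i * cmonomial (\<alpha>(i := \<alpha> i - 1)) P) (at 0)"
      by (simp add: VX cmonomial_def P cscale_def mult_ac)
  next
    case VY
    from DERIV_cmult[OF *[OF nn(2), of "\<alpha> VY"], of "c * (x powr \<alpha> VX * z powr \<alpha> VZ * t powr \<alpha> VT)"]
    show "((\<lambda>s. c * cmonomial \<alpha> (P + cscale s (unit_vec i))) has_field_derivative c * \<alpha> i * cmonomial (\<alpha>(i := \<alpha> i - 1)) P) (at 0)"
      by (simp add: VY cmonomial_def P cscale_def mult_ac)
  next
    case VZ
    from DERIV_cmult[OF *[OF nn(3), of "\<alpha> VZ"], of "c * (x powr \<alpha> VX * y powr \<alpha> VY * t powr \<alpha> VT)"]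
    show "((\<lambda>s. c * cmonomial \<alpha> (P + cscale s (unit_vec i))) has_field_derivative c * \<alpha> i * cmonomial (\<alpha>(i := \<alpha> i - 1)) P) (at 0)"
      by (simp add: VZ cmonomial_def P cscale_def mult_ac)
  next
    case VT
    from DERIV_cmult[OF *[OF nn(4), of "\<alpha> VT"], of "c * (x powr \<alpha> VX * y powr \<alpha> VY * z powr \<alpha> VZ)"]
    show "((\<lambda>s. c * cmonomial \<alpha> (P + cscale s (unit_vec i))) has_field_derivative c * \<alpha> i * cmonomial (\<alpha>(i := \<alpha> i - 1)) P) (at 0)"
      by (simp add: VT cmonomial_def P cscale_def mult_ac)
  qed
qed

lemma cmonomial_lower:
  assumes "P \<in> K2_domain"
  shows "cmonomial (\<alpha>(i := \<alpha> i - 1)) P = cmonomial \<alpha> P / coord i P"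
proof -
  have "coord i P \<noteq> 0" for i using coord_nonzero[OF assms] .
  then show ?thesis
    by (cases i) (simp_all add: cmonomial_def powr_diff)
qed

lemma word_deriv_cmonomial:
  assumes "P \<in> K2_domain"
  shows "word_deriv [] (\<lambda>P. c * cmonomial \<alpha> P) P = c * cmonomial \<alpha> P"
    and "word_deriv [i] (\<lambda>P. c * cmonomial \<alpha> P) P = c * cmonomial \<alpha> P * \<alpha> i / coord i P"
    and "word_deriv [i, j] (\<lambda>P. c * cmonomial \<alpha> P) P =
      c * cmonomial \<alpha> P * (\<alpha> i * (if i = j then \<alpha> i - 1 else \<alpha> j)) / (coord i P * coord j P)"
proof -
  show "word_deriv [] (\<lambda>P. c * cmonomial \<alpha> P) P = c * cmonomial \<alpha> P" by simp
  show "word_deriv [i] (\<lambda>P. c * cmonomial \<alpha> P) P = c * cmonomial \<alpha> P * \<alpha> i / coord i P"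
    using part_deriv_cmonomial[OF assms] cmonomial_lower[OF assms] by simp
  have "word_deriv [i, j] (\<lambda>P. c * cmonomial \<alpha> P) P = part_deriv j (\<lambda>P. (c * \<alpha> i) * cmonomial (\<alpha>(i := \<alpha> i - 1)) P) P"
    unfolding word_deriv.simps by (rule dir_deriv_cong[OF open_K2_domain part_deriv_cmonomial assms])
  also have "\<dots> = c * \<alpha> i * (\<alpha>(i := \<alpha> i - 1)) j * (cmonomial (\<alpha>(i := \<alpha> i - 1)) P / coord j P)"
    by (simp only: part_deriv_cmonomial[OF assms] cmonomial_lower[OF assms, of "\<alpha>(i := \<alpha> i - 1)" j])
  finally show "word_deriv [i, j] (\<lambda>P. c * cmonomial \<alpha> P) P =
      c * cmonomial \<alpha> P * (\<alpha> i * (if i = j then \<alpha> i - 1 else \<alpha> j)) / (coord i P * coord j P)"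
    using cmonomial_lower[OF assms, of \<alpha> i] by simp
qed

text \<open>
  On monomials \<open>w \<partial>\<^sub>w\<^sup>2 + e \<partial>\<^sub>w\<close> lowers one exponent by one and multiplies by the indicial polynomial,
  while \<open>AB\<close> and \<open>AC\<close> are diagonal; so each equation couples only neighbouring coefficients.
\<close>
lemma left_op_cmonomial:
  assumes "P \<in> K2_domain"
  shows "diff_op (left_op i e) (\<lambda>P. c * cmonomial \<alpha> P) P = \<alpha> i * (\<alpha> i - 1 + e) * (c * (cmonomial \<alpha> P / coord i P))"
  using coord_nonzero[OF assms, of i]
  by (simp add: diff_op_def left_op_def word_deriv_cmonomial[OF assms] del: word_deriv.simps) (simp add: field_simps)

text \<open>
  The eigenvalues of \<open>A\<close>, and of \<open>B\<close> or \<open>C\<close> depending on the equation, on the monomial with exponent \<open>\<alpha>\<close>.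
\<close>
definition Aexp :: "complex \<Rightarrow> (var \<Rightarrow> complex) \<Rightarrow> complex" where
  "Aexp a \<alpha> = a + \<alpha> VX + \<alpha> VY + \<alpha> VZ + \<alpha> VT"

definition BCexp :: "complex \<Rightarrow> complex \<Rightarrow> var \<Rightarrow> (var \<Rightarrow> complex) \<Rightarrow> complex" where
  "BCexp b c i \<alpha> = (if i = VZ then c + \<alpha> VZ else b + \<alpha> VX + \<alpha> VY + \<alpha> VT)"

lemma right_op_cmonomial:
  assumes "P \<in> K2_domain"
  shows "diff_op (right_op a b c i) (\<lambda>P. k * cmonomial \<alpha> P) P = - (Aexp a \<alpha> * BCexp b c i \<alpha> * (k * cmonomial \<alpha> P))"
proof -
  have nz: "coord VX P \<noteq> 0" "coord VY P \<noteq> 0" "coord VZ P \<noteq> 0" "coord VT P \<noteq> 0"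
    using coord_nonzero[OF assms] by auto
  show ?thesis
    using nz
    by (cases "i = VZ")
      (simp_all add: diff_op_def right_op_def op_AB_def op_AC_def word_deriv_cmonomial[OF assms] Aexp_def BCexp_def field_simps del: word_deriv.simps)
qed

fun index_of :: "var \<Rightarrow> idx \<Rightarrow> nat" where
  "index_of VX (m, n, p, q) = m"
| "index_of VY (m, n, p, q) = n"
| "index_of VZ (m, n, p, q) = p"
| "index_of VT (m, n, p, q) = q"

fun incr :: "var \<Rightarrow> idx \<Rightarrow> idx" where
  "incr VX (m, n, p, q) = (Suc m, n, p, q)"
| "incr VY (m, n, p, q) = (m, Suc n, p, q)"
| "incr VZ (m, n, p, q) = (m, n, Suc p, q)"
| "incr VT (m, n, p, q) = (m, n, p, Suc q)"

lemma index_of_incr: "index_of j (incr i k) = (if i = j then Suc (index_of j k) else index_of j k)"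
  by (cases k; cases i; cases j) auto

lemma range_incr: "range (incr i) = {k. index_of i k \<noteq> 0}"
proof -
  have "\<exists>k'. k = incr i k'" if "index_of i k \<noteq> 0" for k
  proof -
    obtain m n p q where k: "k = (m, n, p, q)" by (metis prod.exhaust)
    show ?thesis
    proof (cases i)
      case VX then show ?thesis using that k by (intro exI[of _ "(m - 1, n, p, q)"]) auto
    next
      case VY then show ?thesis using that k by (intro exI[of _ "(m, n - 1, p, q)"]) auto
    next
      case VZ then show ?thesis using that k by (intro exI[of _ "(m, n, p - 1, q)"]) auto
    next
      case VT then show ?thesis using that k by (intro exI[of _ "(m, n, p, q - 1)"]) auto
    qed
  qed
  then show ?thesis
  proof (intro equalityI subsetI)
    fix k assume "k \<in> range (incr i)"
    then obtain k' where "k = incr i k'" by blast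
    then show "k \<in> {k. index_of i k \<noteq> 0}" by (simp add: index_of_incr)
  next
    fix k assume *: "\<And>k. index_of i k \<noteq> 0 \<Longrightarrow> \<exists>k'. k = incr i k'" and "k \<in> {k. index_of i k \<noteq> 0}"
    then obtain k' where "k = incr i k'" by blast
    then show "k \<in> range (incr i)" by simp
  qed
qed

lemma inj_incr: "inj (incr i)"
  by (cases i) (auto intro!: injI)

lemma has_sum_incr:
  assumes "(g has_sum s) UNIV" "\<And>k. F (incr i k) = g k" "\<And>k. index_of i k = 0 \<Longrightarrow> F k = 0"
  shows "(F has_sum s) UNIV"
proof -
  have "g = F \<circ> incr i" using assms(2) by (auto simp: fun_eq_iff simp del: split_paired_All)
  then have "(F has_sum s) (range (incr i))"
    unfolding has_sum_reindex[OF inj_incr] using assms(1) by simp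
  moreover have "(F has_sum s) (range (incr i)) \<longleftrightarrow> (F has_sum s) UNIV"
    by (rule has_sum_cong_neutral) (auto simp: range_incr assms(3))
  ultimately show ?thesis by simp
qed

text \<open>
  A branch starts at the exponent vector \<open>\<nu>\<close>, with \<open>\<nu> i\<close> either \<open>0\<close> or \<open>1 - e i\<close>. In both cases
  \<open>e i + 2 * \<nu> i\<close> is the lower parameter of the resulting series (\<open>e i\<close> or \<open>2 - e i\<close>), and its upper
  parameters are the eigenvalues above at \<open>\<nu>\<close>; this makes one formula cover all sixteen functions.
\<close>
definition expo :: "(var \<Rightarrow> complex) \<Rightarrow> idx \<Rightarrow> var \<Rightarrow> complex" where
  "expo \<nu> k i = \<nu> i + of_nat (index_of i k)"

definition branch_coeff where
  "branch_coeff a b c e \<nu> =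
    K2_coeff (Aexp a \<nu>) (BCexp b c VX \<nu>) (BCexp b c VZ \<nu>) (\<lambda>i. e i + 2 * \<nu> i)"

definition K2_branch where
  "K2_branch a b c e \<nu> P = cmonomial \<nu> P * 
     exton_K2 (Aexp a \<nu>) (BCexp b c VX \<nu>) (BCexp b c VZ \<nu>)
       (e VX + 2 * \<nu> VX) (e VY + 2 * \<nu> VY) (e VZ + 2 * \<nu> VZ) (e VT + 2 * \<nu> VT) P"

lemma cmonomial_expo:
  assumes "P \<in> K2_domain"
  shows "cmonomial (expo \<nu> k) P = cmonomial \<nu> P * power4 k P"
proof -
  have nz: "coord VX P \<noteq> 0" "coord VY P \<noteq> 0" "coord VZ P \<noteq> 0" "coord VT P \<noteq> 0"
    using coord_nonzero[OF assms] by auto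
  show ?thesis
    using nz by (cases k) (simp add: cmonomial_def expo_def power4_def powr_add powr_nat')
qed

lemma branch_series:
  assumes "P \<in> K2_domain"
  shows "K2_branch a b c e \<nu> P = (\<Sum>\<^sub>\<infinity>k. branch_coeff a b c e \<nu> k * cmonomial (expo \<nu> k) P)"
proof -
  have "K2_branch a b c e \<nu> P = cmonomial \<nu> P * (\<Sum>\<^sub>\<infinity>k. branch_coeff a b c e \<nu> k * power4 k P)"
    unfolding K2_branch_def branch_coeff_def
    using exton_K2_eq[of _ _ _ "\<lambda>i. e i + 2 * \<nu> i"] by simp
  also have "\<dots> = (\<Sum>\<^sub>\<infinity>k. cmonomial \<nu> P * (branch_coeff a b c e \<nu> k * power4 k P))"
    by (rule infsum_cmult_right'[symmetric])
  also have "\<dots> = (\<Sum>\<^sub>\<infinity>k. branch_coeff a b c e \<nu> k * cmonomial (expo \<nu> k) P)"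
    by (simp add: cmonomial_expo[OF assms] mult_ac)
  finally show ?thesis .
qed

lemma holomorphic4_power4: "holomorphic4_on (power4 k) D"
  by (cases k) (simp add: power4_def holomorphic4_mult holomorphic4_power)

lemma loc_summable_branch:
  assumes "\<And>i. e i + 2 * \<nu> i \<notin> \<int>"
  shows "loc_summable (\<lambda>k P. branch_coeff a b c e \<nu> k * cmonomial (expo \<nu> k) P) K2_domain"
proof -
  have "loc_summable (\<lambda>k P. branch_coeff a b c e \<nu> k * power4 k P) K2_domain"
    unfolding branch_coeff_def
    by (rule loc_summable_subset[OF loc_summable_K2_terms[of "\<lambda>i. e i + 2 * \<nu> i"] K2_domain_subset]) (rule assms)
  then have "loc_summable (\<lambda>k P. cmonomial \<nu> P * (branch_coeff a b c e \<nu> k * power4 k P)) K2_domain"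
    by (intro loc_summable_mult open_K2_domain holomorphic4_cmonomial holomorphic4_mult holomorphic4_power4 holomorphic4_const)
  then show ?thesis
    by (rule loc_summable_cong[OF open_K2_domain]) (simp add: cmonomial_expo mult_ac)
qed

text \<open>
  The indicial polynomial \<open>\<alpha> (\<alpha> - 1 + e)\<close> at \<open>\<alpha> = \<nu> + m + 1\<close> factors as \<open>(m + 1) (e + 2\<nu> + m)\<close> for
  either admissible \<open>\<nu>\<close>, which is the ratio of consecutive denominators of the coefficients.
\<close>
lemma branch_recurrence:
  assumes "\<And>i. e i + 2 * \<nu> i \<notin> \<int>" "\<nu> i = 0 \<or> \<nu> i = 1 - e i"
  shows "expo \<nu> (incr i k) i * (expo \<nu> (incr i k) i - 1 + e i) * branch_coeff a b c e \<nu> (incr i k) =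
    Aexp a (expo \<nu> k) * BCexp b c i (expo \<nu> k) * branch_coeff a b c e \<nu> k"
proof -
  obtain m n p q where k: "k = (m, n, p, q)" by (metis prod.exhaust)
  have nz: "pochhammer (e j + 2 * \<nu> j) r \<noteq> 0" for j r
    using pochhammer_not_Ints[OF assms(1)] .
  have nz': "e j + 2 * \<nu> j + of_nat r \<noteq> 0" for j r
    using assms(1)[of j] by (metis Ints_minus Ints_of_nat add_eq_0_iff2)
  have nz'': "1 + (of_nat r :: complex) \<noteq> 0" for r
    using of_nat_neq_0[of r, where 'a = complex] by simp
  have f: "expo \<nu> (incr i k) i * (expo \<nu> (incr i k) i - 1 + e i) =
      of_nat (Suc (index_of i k)) * (e i + 2 * \<nu> i + of_nat (index_of i k))"
  proof (cases "\<nu> i = 0")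
    case False
    then have e: "e i = 1 - \<nu> i" using assms(2) by (simp add: algebra_simps)
    show ?thesis unfolding e by (simp add: expo_def index_of_incr algebra_simps)
  qed (simp add: expo_def index_of_incr algebra_simps)
  show ?thesis
    unfolding f
    using nz nz' nz''
    by (cases i) (simp_all add: k branch_coeff_def K2_coeff_def Aexp_def BCexp_def expo_def
        pochhammer_Suc divide_simps, simp_all add: algebra_simps)
qed

text \<open>
  The left side of the equation, summed over the series, is the right side with the summation index
  shifted by one; the terms without a predecessor vanish because \<open>\<nu> i\<close> is a root of the indicial
  polynomial.
\<close>
lemma branch_solves:
  assumes "\<And>i. e i + 2 * \<nu> i \<notin> \<int>" "\<And>i. \<nu> i = 0 \<or> \<nu> i = 1 - e i" "P \<in> K2_domain"
  shows "diff_op (K2_eq a b c e i) (\<lambda>P. \<Sum>\<^sub>\<infinity>k. branch_coeff a b c e \<nu> k * cmonomial (expo \<nu> k) P) P = 0"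
proof -
  define f where "f = (\<lambda>k P. branch_coeff a b c e \<nu> k * cmonomial (expo \<nu> k) P)"
  define u where "u = (\<lambda>P. \<Sum>\<^sub>\<infinity>k. f k P)"
  have ls: "loc_summable f K2_domain"
    unfolding f_def by (rule loc_summable_branch[OF assms(1)])
  have "((\<lambda>k. diff_op (right_op a b c i) (f k) P) has_sum diff_op (right_op a b c i) u P) UNIV"
    unfolding u_def by (rule diff_op_has_sum[OF open_K2_domain assms(3) ls])
  then have r: "((\<lambda>k. - diff_op (right_op a b c i) (f k) P) has_sum - diff_op (right_op a b c i) u P) UNIV"
    by (simp add: has_sum_uminus)
  have "((\<lambda>k. diff_op (left_op i (e i)) (f k) P) has_sum - diff_op (right_op a b c i) u P) UNIV"
  proof (rule has_sum_incr[OF r])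
    fix k
    have low: "cmonomial (expo \<nu> (incr i k)) P / coord i P = cmonomial (expo \<nu> k) P"
    proof -
      have "expo \<nu> k = (expo \<nu> (incr i k))(i := expo \<nu> (incr i k) i - 1)"
        by (auto simp: fun_eq_iff expo_def index_of_incr)
      then show ?thesis using cmonomial_lower[OF assms(3), of "expo \<nu> (incr i k)" i] by simp
    qed
    show "diff_op (left_op i (e i)) (f (incr i k)) P = - diff_op (right_op a b c i) (f k) P"
      unfolding f_def left_op_cmonomial[OF assms(3)] right_op_cmonomial[OF assms(3)] low
      using branch_recurrence[of e \<nu> i k a b c, OF assms(1) assms(2)] by (simp add: mult.assoc[symmetric])
  next
    fix k assume "index_of i k = 0"
    then show "diff_op (left_op i (e i)) (f k) P = 0"
      unfolding f_def left_op_cmonomial[OF assms(3)] using assms(2)[of i] by (auto simp: expo_def)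
  qed
  moreover have "((\<lambda>k. diff_op (left_op i (e i)) (f k) P) has_sum diff_op (left_op i (e i)) u P) UNIV"
    unfolding u_def by (rule diff_op_has_sum[OF open_K2_domain assms(3) ls])
  ultimately have "diff_op (left_op i (e i)) u P = - diff_op (right_op a b c i) u P"
    using infsumI by metis
  then show ?thesis
    unfolding K2_eq_def diff_op_def u_def f_def by simp
qed

section \<open>The sixteen branches\<close>

lemma diff_op_cong:
  assumes "open D" "\<And>P. P \<in> D \<Longrightarrow> f P = g P" "P \<in> D"
  shows "diff_op L f P = diff_op L g P"
proof -
  have "word_deriv s f P = word_deriv s g P" for s
    by (rule word_deriv_cong[OF assms(1) _ assms(3)]) (rule assms(2))
  then show ?thesis by (simp add: diff_op_def)
qed

lemma word_deriv_lincomb: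
  assumes "open D" "\<And>i. i \<in> I \<Longrightarrow> holomorphic4_on (f i) D" "P \<in> D"
  shows "word_deriv w (\<lambda>P. \<Sum>i\<in>I. k i * f i P) P = (\<Sum>i\<in>I. k i * word_deriv w (f i) P)"
proof -
  have "word_deriv w (\<lambda>P. \<Sum>i\<in>I. k i * f i P) P = (\<Sum>i\<in>I. word_deriv w (\<lambda>P. k i * f i P) P)"
    by (rule word_deriv_sum[OF assms(1) _ assms(3)]) (intro holomorphic4_mult holomorphic4_const assms(2))
  also have "\<dots> = (\<Sum>i\<in>I. k i * word_deriv w (f i) P)"
    by (intro sum.cong refl word_deriv_cmult[OF assms(1) _ assms(3)] assms(2))
  finally show ?thesis .
qed

lemma diff_op_lincomb:
  assumes "open D" "\<And>i. i \<in> I \<Longrightarrow> holomorphic4_on (f i) D" "P \<in> D"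
  shows "diff_op L (\<lambda>P. \<Sum>i\<in>I. k i * f i P) P = (\<Sum>i\<in>I. k i * diff_op L (f i) P)"
proof (induction L)
  case (Cons gs L)
  then show ?case
    using word_deriv_lincomb[OF assms, where w = "snd gs" and k = k]
    by (simp add: diff_op_def case_prod_beta sum_distrib_left sum.distrib algebra_simps)
qed (simp add: diff_op_def)

lemma holomorphic4_lincomb:
  assumes "\<And>i. i \<in> I \<Longrightarrow> holomorphic4_on (f i) D"
  shows "holomorphic4_on (\<lambda>P. \<Sum>i\<in>I. k i * f i P) D"
  by (intro holomorphic4_sum holomorphic4_mult holomorphic4_const assms)

definition exps :: "(var \<Rightarrow> complex) \<Rightarrow> var set \<Rightarrow> var \<Rightarrow> complex" where
  "exps e S = (\<lambda>i. if i \<in> S then 1 - e i else 0)"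

lemma exps_nonint:
  assumes "\<And>i. e i \<notin> \<int>"
  shows "e i + 2 * exps e S i \<notin> \<int>"
proof (cases "i \<in> S")
  case True
  then have "e i = 2 - (e i + 2 * exps e S i)" by (simp add: exps_def)
  then show ?thesis using assms[of i] by (metis Ints_diff Ints_numeral)
qed (simp add: exps_def assms)

abbreviation branch where
  "branch a b c e S \<equiv> K2_branch a b c e (exps e S)"

lemma branch_holomorphic:
  assumes "\<And>i. e i \<notin> \<int>"
  shows "holomorphic4_on (branch a b c e S) K2_domain"
  by (rule holomorphic4_cong[OF open_K2_domain _
        loc_summable_holomorphic[OF open_K2_domain loc_summable_branch]])
     (rule branch_series[symmetric], assumption, rule exps_nonint[OF assms])

lemma branch_equation:
  assumes "\<And>i. e i \<notin> \<int>" "P \<in> K2_domain"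
  shows "diff_op (K2_eq a b c e i) (branch a b c e S) P = 0"
proof -
  have "diff_op (K2_eq a b c e i) (branch a b c e S) P =
      diff_op (K2_eq a b c e i) (\<lambda>P. \<Sum>\<^sub>\<infinity>k. branch_coeff a b c e (exps e S) k * cmonomial (expo (exps e S) k) P) P"
    by (rule diff_op_cong[OF open_K2_domain branch_series assms(2)])
  also have "\<dots> = 0"
    by (rule branch_solves[OF exps_nonint[OF assms(1)] _ assms(2)]) (simp add: exps_def)
  finally show ?thesis .
qed

section \<open>Linear independence of the branches\<close>

definition small :: real where "small = 1 / 100"

lemma small_pos: "0 < small" by (simp add: small_def)

lemma small_region:
  assumes "\<And>i. norm (coord i P) < small"
  shows "P \<in> K2_region"
proof -
  obtain x y z t where P: "P = (x, y, z, t)" by (metis prod.exhaust)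
  have n: "norm x < small" "norm y < small" "norm z < small" "norm t < small"
    using assms[of VX] assms[of VY] assms[of VZ] assms[of VT] by (simp_all add: P)
  have s: "sqrt r < 1 / 10" if "r < small" for r
  proof -
    have "sqrt r < sqrt ((1 / 10)\<^sup>2)" using that by (simp add: small_def power2_eq_square)
    then show ?thesis by simp
  qed
  have "sqrt (norm x) + sqrt (norm y) + sqrt (norm t) \<le> 3 / 10"
    using s[OF n(1)] s[OF n(2)] s[OF n(4)] by simp
  then have "(sqrt (norm x) + sqrt (norm y) + sqrt (norm t))\<^sup>2 \<le> (3 / 10)\<^sup>2"
    by (intro power_mono) auto
  then show ?thesis
    using n(3) by (simp add: K2_region_def K2_gauge_def P small_def power2_eq_square)
qed

lemma connected_slit_disc:
  assumes "0 < r"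
  shows "connected (ball 0 r - \<real>\<^sub>\<le>\<^sub>0 :: complex set)"
proof (rule starlike_imp_connected)
  let ?B = "ball 0 r - \<real>\<^sub>\<le>\<^sub>0 :: complex set"
  let ?a = "complex_of_real (r / 2)"
  have a: "?a \<in> ?B" using assms by (auto simp: complex_nonpos_Reals_iff)
  have "closed_segment ?a x \<subseteq> ?B" if x: "x \<in> ?B" for x
  proof
    fix y assume "y \<in> closed_segment ?a x"
    then obtain v where v: "0 \<le> v" "v \<le> 1" "y = (1 - v) *\<^sub>R ?a + v *\<^sub>R x"
      by (auto simp: closed_segment_def)
    have "closed_segment ?a x \<subseteq> ball 0 r"
      using a x by (intro closed_segment_subset) auto
    then have "y \<in> ball 0 r" using \<open>y \<in> closed_segment ?a x\<close> by blast
    moreover have "y \<notin> \<real>\<^sub>\<le>\<^sub>0"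
    proof
      assume "y \<in> \<real>\<^sub>\<le>\<^sub>0"
      then have y: "(1 - v) * (r / 2) + v * Re x \<le> 0" "v * Im x = 0"
        using v(3) by (auto simp: complex_nonpos_Reals_iff)
      show False
      proof (cases "v = 0")
        case True then show ?thesis using y assms by simp
      next
        case False
        then have "Im x = 0" using y by simp
        then have "0 < Re x" using x by (auto simp: complex_nonpos_Reals_iff)
        then have "0 < v * Re x" using False v by simp
        moreover have "0 \<le> (1 - v) * (r / 2)" using v assms by simp
        ultimately show ?thesis using y by simp
      qed
    qed
    ultimately show "y \<in> ?B" by blast
  qed
  then show "starlike ?B" unfolding starlike_def using a by blast
qed

text \<open>
  Shrinking towards the origin along a ray stays in the domain and reaches a small product of slit
  discs, which is connected.
\<close>
lemma connected_K2_domain: "connected K2_domain"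
proof -
  define B where "B = (ball 0 small - \<real>\<^sub>\<le>\<^sub>0 :: complex set)"
  define W where "W = B \<times> B \<times> B \<times> B"
  have all: "(\<forall>i. Q i) \<longleftrightarrow> Q VX \<and> Q VY \<and> Q VZ \<and> Q VT" for Q
    by (metis var.exhaust)
  have W: "P \<in> W \<longleftrightarrow> (\<forall>i. norm (coord i P) < small \<and> coord i P \<notin> \<real>\<^sub>\<le>\<^sub>0)" for P
    unfolding all by (cases P) (auto simp: W_def B_def)
  have "connected B" unfolding B_def using connected_slit_disc[OF small_pos] .
  then have cW: "connected W" unfolding W_def by (intro connected_Times)
  have WD: "W \<subseteq> K2_domain"
    using small_region by (auto simp: W K2_domain_eq simp del: split_paired_All)
  define w0 :: c4 where "w0 = (of_real (small / 2), of_real (small / 2), of_real (small / 2), of_real (small / 2))"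
  have w0: "w0 \<in> W"
    unfolding w0_def W_def B_def by (auto simp: small_def complex_nonpos_Reals_iff)
  define G where "G = (\<lambda>P. (\<lambda>s. cscale (of_real s) P) ` {0<..1})"
  have scaled: "coord i (cscale s P) = s * coord i P" for i s P
    by (cases P; cases i) (simp_all add: cscale_def)
  have cG: "connected (G P)" for P
    unfolding G_def by (intro connected_continuous_image continuous_intros) auto
  have GD: "G P \<subseteq> K2_domain" if P: "P \<in> K2_domain" for P
  proof
    fix Q assume "Q \<in> G P"
    then obtain s where s: "0 < s" "s \<le> 1" "Q = cscale (of_real s) P" by (auto simp: G_def)
    have "K2_gauge Q = s * K2_gauge P"
      using s(1) by (cases P)
        (simp add: s(3) cscale_def K2_gauge_def norm_mult real_sqrt_mult distrib_left[symmetric] power_mult_distrib del: distrib_left_numeral)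
    also have "\<dots> \<le> K2_gauge P" using s K2_gauge_nonneg[of P] by (simp add: mult_left_le_one_le)
    also have "\<dots> < 1" using P by (simp add: K2_domain_eq K2_region_def)
    finally have "Q \<in> K2_region" by (simp add: K2_region_def)
    moreover have "coord i Q \<notin> \<real>\<^sub>\<le>\<^sub>0" for i
      using coord_not_nonpos[OF P, of i] s
      by (auto simp: scaled complex_nonpos_Reals_iff mult_le_0_iff)
    ultimately show "Q \<in> K2_domain" by (simp add: K2_domain_eq)
  qed
  have meet: "W \<inter> G P \<noteq> {}" if P: "P \<in> K2_domain" for P
  proof -
    define s where "s = small / (2 * (1 + norm P))"
    have pos: "0 < 1 + norm P" by (simp add: add_pos_nonneg)
    have s: "0 < s" "s \<le> 1"
      using pos by (auto simp: s_def small_def field_simps add_pos_nonneg)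
    have "norm (coord i (cscale (of_real s) P)) < small" for i
    proof -
      obtain x y z t where PP: "P = (x, y, z, t)" by (metis prod.exhaust)
      have "norm (coord i P) \<le> norm P"
        unfolding PP using norm_fst_le[of x "(y, z, t)"] norm_snd_le[of "(y, z, t)" x]
          norm_fst_le[of y "(z, t)"] norm_snd_le[of "(z, t)" y] norm_fst_le[of z t] norm_snd_le[of t z]
        by (cases i) auto
      then have "s * norm (coord i P) \<le> s * norm P" using s by simp
      also have "\<dots> < s * (1 + norm P)" using s by simp
      also have "\<dots> = small / 2" using pos by (simp add: s_def field_simps)
      also have "\<dots> < small" using small_pos by simp
      finally show ?thesis using s by (simp add: scaled norm_mult)
    qed
    moreover have "cscale (of_real s) P \<in> G P" using s by (auto simp: G_def)
    moreover have "coord i (cscale (of_real s) P) \<notin> \<real>\<^sub>\<le>\<^sub>0" for i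
      using GD[OF P] calculation(2) coord_not_nonpos by blast
    ultimately show ?thesis using W by blast
  qed
  have in_G: "P \<in> G P" for P
    unfolding G_def by (rule image_eqI[of _ _ 1]) (cases P, simp_all add: cscale_def)
  have "K2_domain = \<Union> ((\<lambda>P. W \<union> G P) ` K2_domain)"
    using WD GD in_G by blast
  moreover have "connected (\<Union> ((\<lambda>P. W \<union> G P) ` K2_domain))"
  proof (rule connected_Union)
    show "connected t" if "t \<in> (\<lambda>P. W \<union> G P) ` K2_domain" for t
      using that connected_Un[OF cW cG meet] by blast
    show "\<Inter> ((\<lambda>P. W \<union> G P) ` K2_domain) \<noteq> {}" using w0 by blast
  qed
  ultimately show ?thesis by simp
qed

text \<open>
  Approaching a negative number from above and from below gives two different values of
  \<open>s powr \<mu>\<close>, namely \<open>exp (\<plusminus>\<i>\<pi>\<mu>) |s| powr \<mu>\<close>, while \<open>g0\<close> and \<open>g1\<close> extend continuously across the slit. The two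
  resulting relations force both to vanish on the slit, hence at \<open>0\<close>.
\<close>
lemma slit_separation:
  fixes g0 g1 :: "complex \<Rightarrow> complex"
  assumes "0 < r" "continuous_on (ball 0 r) g0" "continuous_on (ball 0 r) g1" "\<mu> \<notin> \<int>"
    and zero: "\<And>s. s \<in> ball 0 r \<Longrightarrow> s \<notin> \<real>\<^sub>\<le>\<^sub>0 \<Longrightarrow> g0 s + s powr \<mu> * g1 s = 0"
  shows "g0 0 = 0" "g1 0 = 0"
proof -
  have side: "g0 (- of_real \<rho>) + exp (\<epsilon> * \<i> * pi * \<mu>) * of_real \<rho> powr \<mu> * g1 (- of_real \<rho>) = 0"
    if \<rho>: "0 < \<rho>" "\<rho> < r" and \<epsilon>: "\<epsilon> = 1 \<or> \<epsilon> = -1" for \<rho> \<epsilon> :: real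
  proof -
    \<comment> \<open>\<open>p h\<close> tends to \<open>- \<rho>\<close> from the upper (\<open>\<epsilon> = 1\<close>) or lower (\<open>\<epsilon> = -1\<close>) half plane; \<open>H\<close> rewrites the relation by the branch of the power that is continuous there.\<close>
    define p where "p = (\<lambda>h::real. - of_real \<rho> + \<i> * of_real (\<epsilon> * h))"
    define H where "H = (\<lambda>h. g0 (p h) + exp (\<epsilon> * \<i> * pi * \<mu>) * (- p h) powr \<mu> * g1 (p h))"
    have cp: "(p \<longlongrightarrow> p 0) (at_right 0)"
      unfolding p_def by (intro tendsto_intros)
    have p0: "p 0 = - of_real \<rho>" by (simp add: p_def)
    have "isCont g0 (p 0)" "isCont g1 (p 0)"
      using assms(2,3) \<rho> by (auto simp: p0 continuous_on_eq_continuous_at)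
    then have cg: "((\<lambda>h. g0 (p h)) \<longlongrightarrow> g0 (p 0)) (at_right 0)" "((\<lambda>h. g1 (p h)) \<longlongrightarrow> g1 (p 0)) (at_right 0)"
      using cp isCont_tendsto_compose by blast+
    have "- p 0 \<notin> \<real>\<^sub>\<le>\<^sub>0" using \<rho> by (simp add: p0)
    then have pw: "((\<lambda>h. (- p h) powr \<mu>) \<longlongrightarrow> (- p 0) powr \<mu>) (at_right 0)"
      by (intro tendsto_powr_complex tendsto_minus cp tendsto_const)
    have lim: "(H \<longlongrightarrow> H 0) (at_right 0)"
      unfolding H_def by (intro tendsto_add tendsto_mult tendsto_const cg pw)
    have near_p: "\<forall>\<^sub>F h in at_right 0. norm (p h) < r"
    proof -
      have "((\<lambda>h. norm (p h)) \<longlongrightarrow> norm (p 0)) (at_right 0)" by (intro tendsto_intros cp)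
      then show ?thesis using order_tendstoD(2)[of _ "norm (p 0)" _ r] \<rho> by (simp add: p0)
    qed
    have "\<forall>\<^sub>F h in at_right 0. H h = 0"
      using near_p eventually_at_right_less[of "0::real"]
    proof eventually_elim
      case (elim h)
      have im: "Im (p h) = \<epsilon> * h" by (simp add: p_def)
      have nz: "p h \<noteq> 0" and np: "p h \<notin> \<real>\<^sub>\<le>\<^sub>0"
        using im elim \<epsilon> by (auto simp: complex_nonpos_Reals_iff)
      have L: "Ln (p h) = Ln (- p h) + \<epsilon> * \<i> * pi"
        using Ln_minus[OF nz] im elim \<epsilon> by (auto simp: mult.commute)
      have "p h powr \<mu> = exp (\<mu> * (Ln (- p h) + \<epsilon> * \<i> * pi))"
        using nz by (simp only: powr_def L[symmetric]) simp
      also have "\<dots> = exp (\<epsilon> * \<i> * pi * \<mu>) * exp (\<mu> * Ln (- p h))"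
        unfolding exp_add[symmetric] by (simp add: algebra_simps)
      finally have "p h powr \<mu> = exp (\<epsilon> * \<i> * pi * \<mu>) * (- p h) powr \<mu>"
        using nz by (simp add: powr_def)
      then show ?case using zero[of "p h"] elim np by (simp add: H_def)
    qed
    then have "(H \<longlongrightarrow> 0) (at_right 0)" by (rule tendsto_eventually)
    then have "H 0 = 0" using tendsto_unique[OF _ lim] by simp
    then show ?thesis by (simp add: H_def p0)
  qed
  have both: "g0 (- of_real \<rho>) = 0 \<and> g1 (- of_real \<rho>) = 0" if "0 < \<rho>" "\<rho> < r" for \<rho> :: real
  proof -
    let ?E = "exp (\<i> * pi * \<mu>)"
    have m: "exp (- (\<i> * pi * \<mu>)) = inverse ?E" by (simp add: exp_minus)
    have 1: "g0 (- of_real \<rho>) + ?E * of_real \<rho> powr \<mu> * g1 (- of_real \<rho>) = 0"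
      using side[OF that, of 1] by simp
    have 2: "g0 (- of_real \<rho>) + inverse ?E * of_real \<rho> powr \<mu> * g1 (- of_real \<rho>) = 0"
      using side[OF that, of "-1"] by (simp add: m)
    have E: "?E \<noteq> inverse ?E"
    proof
      assume "?E = inverse ?E"
      then have "?E * ?E = 1" by (metis exp_not_eq_zero right_inverse)
      then have "exp (2 * \<i> * pi * \<mu>) = 1" by (simp add: exp_add[symmetric] algebra_simps)
      then obtain n :: int where "2 * \<i> * pi * \<mu> = of_int (2 * n) * pi * \<i>"
        unfolding exp_eq_1 by (auto simp: complex_eq_iff)
      then have "\<mu> = of_int n" by (simp add: field_simps)
      then show False using assms(4) by simp
    qed
    have "(?E - inverse ?E) * (of_real \<rho> powr \<mu> * g1 (- of_real \<rho>)) = 0"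
      using 1 2 by (simp add: algebra_simps add_eq_0_iff)
    then have "g1 (- of_real \<rho>) = 0" using E that by simp
    then show ?thesis using 1 by simp
  qed
  have at0: "g 0 = 0" if g: "continuous_on (ball 0 r) g" "\<And>\<rho>::real. 0 < \<rho> \<Longrightarrow> \<rho> < r \<Longrightarrow> g (- of_real \<rho>) = 0"
    for g :: "complex \<Rightarrow> complex"
  proof -
    have "isCont g 0" using g(1) assms(1) by (simp add: continuous_on_eq_continuous_at)
    moreover have "((\<lambda>\<rho>::real. - of_real \<rho> :: complex) \<longlongrightarrow> 0) (at_right 0)"
      by (auto intro!: tendsto_eq_intros)
    ultimately have lim: "((\<lambda>\<rho>::real. g (- of_real \<rho>)) \<longlongrightarrow> g 0) (at_right 0)"
      by (rule isCont_tendsto_compose)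
    have "\<forall>\<^sub>F \<rho> in at_right 0. g (- of_real \<rho>) = 0"
      using eventually_at_right_real[OF assms(1)] by eventually_elim (auto intro: g(2))
    then have "((\<lambda>\<rho>::real. g (- of_real \<rho>)) \<longlongrightarrow> 0) (at_right 0)" by (rule tendsto_eventually)
    then show ?thesis using tendsto_unique[OF _ lim] by simp
  qed
  show "g0 0 = 0" by (rule at0[OF assms(2)]) (use both in blast)
  show "g1 0 = 0" by (rule at0[OF assms(3)]) (use both in blast)
qed

text \<open>
  The power series part of a branch, which is regular at the origin and across the slits.
\<close>
definition branch_factor where
  "branch_factor a b c e S = (let \<nu> = exps e S in
     exton_K2 (Aexp a \<nu>) (BCexp b c VX \<nu>) (BCexp b c VZ \<nu>)
       (e VX + 2 * \<nu> VX) (e VY + 2 * \<nu> VY) (e VZ + 2 * \<nu> VZ) (e VT + 2 * \<nu> VT))"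

lemma branch_eq_prod:
  assumes "P \<in> K2_domain"
  shows "branch a b c e S P = (\<Prod>i\<in>S. coord i P powr (1 - e i)) * branch_factor a b c e S P"
proof -
  have "cmonomial (exps e S) P = (\<Prod>i\<in>UNIV. coord i P powr exps e S i)"
    by (simp add: cmonomial_def UNIV_var mult.assoc)
  also have "\<dots> = (\<Prod>i\<in>S. coord i P powr exps e S i)"
    by (rule prod.mono_neutral_right) (auto simp: exps_def coord_nonzero[OF assms])
  also have "\<dots> = (\<Prod>i\<in>S. coord i P powr (1 - e i))"
    by (rule prod.cong) (auto simp: exps_def)
  finally show ?thesis
    by (simp add: K2_branch_def branch_factor_def Let_def)
qed

lemma branch_factor_series:
  "branch_factor a b c e S P = (\<Sum>\<^sub>\<infinity>k. branch_coeff a b c e (exps e S) k * power4 k P)"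
  unfolding branch_factor_def branch_coeff_def Let_def
  using exton_K2_eq[of _ _ _ "\<lambda>i. e i + 2 * exps e S i"] by simp

lemma branch_factor_continuous:
  assumes "\<And>i. e i \<notin> \<int>"
  shows "continuous_on K2_region (branch_factor a b c e S)"
proof -
  have "loc_summable (\<lambda>k P. branch_coeff a b c e (exps e S) k * power4 k P) K2_region"
    unfolding branch_coeff_def
    by (rule loc_summable_K2_terms[of "\<lambda>i. e i + 2 * exps e S i"]) (rule exps_nonint[OF assms])
  from holomorphic4_continuous[OF loc_summable_holomorphic[OF open_K2_region this]]
  show ?thesis by (simp only: branch_factor_series[symmetric])
qed

lemma branch_factor_zero: "branch_factor a b c e S 0 = 1"
proof -
  let ?f = "\<lambda>k. branch_coeff a b c e (exps e S) k * power4 k 0"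
  have z: "?f k = 0" if "k \<noteq> (0, 0, 0, 0)" for k
    using that by (cases k) (auto simp: power4_def zero_prod_def)
  have "(\<Sum>\<^sub>\<infinity>k. ?f k) = (\<Sum>\<^sub>\<infinity>k\<in>{(0, 0, 0, 0)}. ?f k)"
    by (rule infsum_cong_neutral) (use z in auto)
  also have "\<dots> = 1"
    by (simp add: branch_coeff_def K2_coeff_def power4_def zero_prod_def)
  finally show ?thesis by (simp add: branch_factor_series)
qed

lemma coord_line: "coord j (P + cscale s (unit_vec i)) = (if i = j then coord j P + s else coord j P)"
  by (cases P; cases i; cases j) (simp_all add: cscale_def)

text \<open>
  The variables in \<open>U\<close> have been separated and set to \<open>0\<close>, and \<open>R\<close> records which of their powers
  the remaining terms carried. Each step splits the sum according to whether the
  factor of the next variable is present and applies the separation lemma in that variable.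
\<close>
lemma branch_peeling:
  fixes k :: "var set \<Rightarrow> complex"
  assumes e: "\<And>i. e i \<notin> \<int>"
    and zero: "\<And>P. P \<in> K2_domain \<Longrightarrow> (\<Sum>S\<in>UNIV. k S * branch a b c e S P) = 0"
    and "finite U"
  shows "\<And>P R. (\<And>i. norm (coord i P) < small) \<Longrightarrow> (\<And>i. i \<in> U \<Longrightarrow> coord i P = 0) \<Longrightarrow>
      (\<And>i. i \<notin> U \<Longrightarrow> coord i P \<notin> \<real>\<^sub>\<le>\<^sub>0) \<Longrightarrow> R \<subseteq> U \<Longrightarrow>
    (\<Sum>S\<in>Pow (- U). k (S \<union> R) * ((\<Prod>i\<in>S. coord i P powr (1 - e i)) * branch_factor a b c e (S \<union> R) P)) = 0"
  using \<open>finite U\<close>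
proof (induction U rule: finite_induct)
  case empty
  have "P \<in> K2_domain"
    using small_region[OF empty(1)] empty(3) by (simp add: K2_domain_eq)
  from zero[OF this] show ?case
    using empty(4) by (simp add: branch_eq_prod[OF \<open>P \<in> K2_domain\<close>])
next
  case (insert i U)
  define T where "T = - (insert i U)"
  have T: "- U = insert i T" "i \<notin> T" using insert.hyps by (auto simp: T_def)
  define F where "F = branch_factor a b c e"
  define w where "w = (\<lambda>S. \<Prod>j\<in>S. coord j P powr (1 - e j))"
  define g where "g = (\<lambda>R s. \<Sum>S\<in>Pow T. k (S \<union> R) * (w S * F (S \<union> R) (P + cscale s (unit_vec i))))"
  have Pi: "coord i P = 0" using insert.prems(2) by simp
  have box: "norm (coord j (P + cscale s (unit_vec i))) < small" if "s \<in> ball 0 small" for s j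
    using that insert.prems(1)[of j] Pi by (auto simp: coord_line)
  have cont: "continuous_on (ball 0 small) (g R)" for R
    unfolding g_def F_def
    by (intro continuous_intros continuous_on_compose2[OF branch_factor_continuous[OF e]])
       (use small_region box in blast)
  have wT: "(\<Prod>j\<in>S. coord j (P + cscale s (unit_vec i)) powr (1 - e j)) = w S" if "S \<in> Pow T" for S s
    unfolding w_def by (rule prod.cong) (use that T(2) in \<open>auto simp: coord_line\<close>)
  have fin: "finite S" for S :: "var set" by simp
  have sep: "g R0 0 = 0" "g (insert i R0) 0 = 0" if "R0 \<subseteq> U" for R0
  proof -
    have z: "g R0 s + s powr (1 - e i) * g (insert i R0) s = 0" if s: "s \<in> ball 0 small" "s \<notin> \<real>\<^sub>\<le>\<^sub>0" for s
    proof -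
      let ?Q = "P + cscale s (unit_vec i)"
      have "(\<Sum>S\<in>Pow (- U). k (S \<union> R0) * ((\<Prod>j\<in>S. coord j ?Q powr (1 - e j)) * F (S \<union> R0) ?Q)) = 0"
        unfolding F_def
      proof (rule insert.IH[OF box[OF s(1)] _ _ \<open>R0 \<subseteq> U\<close>])
        show "coord j ?Q = 0" if "j \<in> U" for j
          using that insert.prems(2)[of j] insert.hyps by (auto simp: coord_line)
        show "coord j ?Q \<notin> \<real>\<^sub>\<le>\<^sub>0" if "j \<notin> U" for j
          using that insert.prems(3)[of j] s(2) Pi by (auto simp: coord_line)
      qed
      also have "(\<Sum>S\<in>Pow (- U). k (S \<union> R0) * ((\<Prod>j\<in>S. coord j ?Q powr (1 - e j)) * F (S \<union> R0) ?Q)) =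
        (\<Sum>S\<in>Pow T. k (S \<union> R0) * ((\<Prod>j\<in>S. coord j ?Q powr (1 - e j)) * F (S \<union> R0) ?Q)) +
        (\<Sum>S\<in>insert i ` Pow T. k (S \<union> R0) * ((\<Prod>j\<in>S. coord j ?Q powr (1 - e j)) * F (S \<union> R0) ?Q))"
        unfolding T(1) Pow_insert by (rule sum.union_disjoint) (use T(2) in auto)
      also have "(\<Sum>S\<in>Pow T. k (S \<union> R0) * ((\<Prod>j\<in>S. coord j ?Q powr (1 - e j)) * F (S \<union> R0) ?Q)) = g R0 s"
        unfolding g_def by (rule sum.cong) (simp_all only: wT)
      also have "(\<Sum>S\<in>insert i ` Pow T. k (S \<union> R0) * ((\<Prod>j\<in>S. coord j ?Q powr (1 - e j)) * F (S \<union> R0) ?Q)) =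
        (\<Sum>S\<in>Pow T. k (insert i S \<union> R0) * ((\<Prod>j\<in>insert i S. coord j ?Q powr (1 - e j)) * F (insert i S \<union> R0) ?Q))"
        by (subst sum.reindex) (use T(2) in \<open>auto simp: inj_on_def\<close>)
      also have "\<dots> = s powr (1 - e i) * g (insert i R0) s"
        unfolding g_def sum_distrib_left
      proof (rule sum.cong[OF refl])
        fix S assume S: "S \<in> Pow T"
        then have "i \<notin> S" using T(2) by blast
        then have "(\<Prod>j\<in>insert i S. coord j ?Q powr (1 - e j)) = s powr (1 - e i) * w S"
          using wT[OF S] Pi by (simp add: prod.insert[OF fin] coord_line)
        then show "k (insert i S \<union> R0) * ((\<Prod>j\<in>insert i S. coord j ?Q powr (1 - e j)) * F (insert i S \<union> R0) ?Q) =
          s powr (1 - e i) * (k (S \<union> insert i R0) * (w S * F (S \<union> insert i R0) ?Q))"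
          by (simp add: mult_ac)
      qed
      finally show ?thesis .
    qed
    have ni: "1 - e i \<notin> \<int>" using Ints_diff[OF Ints_1, of "1 - e i"] e[of i] by auto
    show "g R0 0 = 0" by (rule slit_separation(1)[OF small_pos cont cont ni z])
    show "g (insert i R0) 0 = 0" by (rule slit_separation(2)[OF small_pos cont cont ni z])
  qed
  have "g R 0 = 0"
  proof (cases "i \<in> R")
    case True
    then have "R = insert i (R - {i})" "R - {i} \<subseteq> U" using insert.prems(4) by auto
    then show ?thesis using sep(2) by metis
  next
    case False
    then show ?thesis using sep(1)[of R] insert.prems(4) by blast
  qed
  then show ?case by (simp add: g_def w_def F_def T_def)
qed

lemma branches_independent_full:
  fixes k :: "var set \<Rightarrow> complex"
  assumes "\<And>i. e i \<notin> \<int>"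
    and "\<And>P. P \<in> K2_domain \<Longrightarrow> (\<Sum>S\<in>UNIV. k S * branch a b c e S P) = 0"
  shows "k R = 0"
proof -
  have c0: "coord i 0 = 0" for i by (cases i) (simp_all add: zero_prod_def)
  have "(\<Sum>S\<in>Pow (- UNIV). k (S \<union> R) * ((\<Prod>i\<in>S. coord i 0 powr (1 - e i)) * branch_factor a b c e (S \<union> R) 0)) = 0"
    by (rule branch_peeling[OF assms(1) assms(2) finite]) (auto simp: c0 small_pos)
  then show ?thesis by (simp add: branch_factor_zero)
qed

section \<open>The solution space\<close>

lemma solution_span:
  fixes k :: "var set \<Rightarrow> complex"
  assumes "\<And>i. e i \<notin> \<int>" "open D" "D \<subseteq> K2_domain"
  shows "holomorphic4_on (\<lambda>P. \<Sum>S\<in>UNIV. k S * branch a b c e S P) D"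
    and "P \<in> D \<Longrightarrow> diff_op (K2_eq a b c e i) (\<lambda>P. \<Sum>S\<in>UNIV. k S * branch a b c e S P) P = 0"
    and "P \<in> D \<Longrightarrow> word_deriv w (\<lambda>P. \<Sum>S\<in>UNIV. k S * branch a b c e S P) P = (\<Sum>S\<in>UNIV. k S * word_deriv w (branch a b c e S) P)"
proof -
  have h: "holomorphic4_on (branch a b c e S) D" for S
    by (rule holomorphic4_subset[OF branch_holomorphic[OF assms(1)] assms(3)])
  show "holomorphic4_on (\<lambda>P. \<Sum>S\<in>UNIV. k S * branch a b c e S P) D"
    by (rule holomorphic4_lincomb[OF h])
  show "P \<in> D \<Longrightarrow> word_deriv w (\<lambda>P. \<Sum>S\<in>UNIV. k S * branch a b c e S P) P = (\<Sum>S\<in>UNIV. k S * word_deriv w (branch a b c e S) P)"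
    by (rule word_deriv_lincomb[OF assms(2) h])
  show "diff_op (K2_eq a b c e i) (\<lambda>P. \<Sum>S\<in>UNIV. k S * branch a b c e S P) P = 0" if "P \<in> D"
  proof -
    have "P \<in> K2_domain" using that assms(3) by blast
    then show ?thesis
      by (simp add: diff_op_lincomb[OF assms(2) h that] branch_equation[OF assms(1)])
  qed
qed

text \<open>
  A relation between the squarefree jets at one point is a relation between the functions on the whole
  of \<open>K2_domain\<close>. So the sixteen jets are linearly independent, which gives independence on every
  smaller domain and, by counting dimensions, that they span all possible initial data.
\<close>
lemma branches_independent_jet:
  fixes k :: "var set \<Rightarrow> complex"
  assumes "\<And>i. e i \<notin> \<int>" "P0 \<in> K2_domain"
    and "\<And>S'. (\<Sum>S\<in>UNIV. k S * word_deriv (sqfree_word S') (branch a b c e S) P0) = 0"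
  shows "k R = 0"
proof (rule branches_independent_full[OF assms(1)])
  note sp = solution_span[OF assms(1) open_K2_domain subset_refl]
  fix P assume P: "P \<in> K2_domain"
  show "(\<Sum>S\<in>UNIV. k S * branch a b c e S P) = 0"
    by (rule jet_determines[OF open_K2_domain connected_K2_domain subset_refl sp(1) sp(2) assms(2) _ P])
       (simp_all add: sp(3)[OF assms(2)] assms(3))
qed

lemma branches_independent:
  fixes k :: "var set \<Rightarrow> complex"
  assumes "\<And>i. e i \<notin> \<int>" "open D" "D \<subseteq> K2_domain" "P0 \<in> D"
    and zero: "\<And>P. P \<in> D \<Longrightarrow> (\<Sum>S\<in>UNIV. k S * branch a b c e S P) = 0"
  shows "k R = 0"
proof (rule branches_independent_jet[OF assms(1)])
  show "P0 \<in> K2_domain" using assms by blast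
  show "(\<Sum>S\<in>UNIV. k S * word_deriv (sqfree_word S') (branch a b c e S) P0) = 0" for S'
  proof -
    have "word_deriv (sqfree_word S') (\<lambda>P. \<Sum>S\<in>UNIV. k S * branch a b c e S P) P0 = word_deriv (sqfree_word S') (\<lambda>P. 0) P0"
      by (rule word_deriv_cong[OF assms(2) zero assms(4)])
    then show ?thesis
      by (simp add: solution_span(3)[OF assms(1-4)] word_deriv_zero)
  qed
qed

lemma solution_is_combination:
  assumes e: "\<And>i. e i \<notin> \<int>" and D: "open D" "connected D" "D \<subseteq> K2_domain" "P0 \<in> D"
    and u: "holomorphic4_on u D" "\<And>P i. P \<in> D \<Longrightarrow> diff_op (K2_eq a b c e i) u P = 0"
  shows "\<exists>k. \<forall>P\<in>D. u P = (\<Sum>S\<in>UNIV. k S * branch a b c e S P)"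
proof -
  \<comment> \<open>The square matrix of squarefree jets of the branches is injective, hence surjective.\<close>
  define A :: "complex ^ var set ^ var set" where
    "A = (\<chi> S' S. word_deriv (sqfree_word S') (branch a b c e S) P0)"
  have PK: "P0 \<in> K2_domain" using D by blast
  have "x = 0" if "A *v x = 0" for x
  proof -
    have "(\<Sum>S\<in>UNIV. x $ S * word_deriv (sqfree_word S') (branch a b c e S) P0) = 0" for S'
      using arg_cong[OF that, of "\<lambda>v. v $ S'"] by (simp add: A_def matrix_vector_mult_def mult.commute)
    from branches_independent_jet[OF e PK this] show ?thesis by (simp add: vec_eq_iff)
  qed
  then have "\<exists>B. B ** A = mat 1"
    unfolding matrix_left_invertible_ker by blast
  then have "surj ((*v) A)"
    using matrix_left_right_inverse matrix_right_invertible_surjective by metis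
  then obtain x where x: "A *v x = (\<chi> S'. word_deriv (sqfree_word S') u P0)"
    by (metis surjD)
  have jet: "(\<Sum>S\<in>UNIV. x $ S * word_deriv (sqfree_word S') (branch a b c e S) P0) = word_deriv (sqfree_word S') u P0" for S'
    using arg_cong[OF x, of "\<lambda>v. v $ S'"] by (simp add: A_def matrix_vector_mult_def mult.commute)
  define v where "v = (\<lambda>P. \<Sum>S\<in>UNIV. x $ S * branch a b c e S P)"
  note sp = solution_span[where e = e and k = "\<lambda>S. x $ S" and a = a and b = b and c = c, OF e D(1,3), folded v_def]
  \<comment> \<open>The difference \<open>u - v\<close> as a linear combination indexed by \<open>bool\<close>.\<close>
  define f where "f = (\<lambda>j::bool. if j then u else v)"
  define s where "s = (\<lambda>j::bool. if j then 1 else - 1 :: complex)"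
  have f: "holomorphic4_on (f j) D" for j using u(1) sp(1) by (simp add: f_def)
  define d where "d = (\<lambda>P. \<Sum>j\<in>UNIV. s j * f j P)"
  have d: "d P = u P - v P" for P by (simp add: d_def s_def f_def UNIV_bool)
  have "d P = 0" if "P \<in> D" for P
  proof (rule jet_determines[OF D(1-3) _ _ D(4) _ that])
    show "holomorphic4_on d D"
      unfolding d_def by (rule holomorphic4_lincomb[OF f])
    show "diff_op (K2_eq a b c e i) d Q = 0" if "Q \<in> D" for Q i
      unfolding d_def diff_op_lincomb[OF D(1) f that]
      using u(2)[OF that] sp(2)[OF that] by (simp add: UNIV_bool f_def s_def)
    show "word_deriv (sqfree_word S) d P0 = 0" for S
      unfolding d_def word_deriv_lincomb[OF D(1) f D(4)]
      using sp(3)[OF D(4)] jet[of S] by (simp add: UNIV_bool f_def s_def)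
  qed
  then have "u P = (\<Sum>S\<in>UNIV. x $ S * branch a b c e S P)" if "P \<in> D" for P
    using d[of P] that by (simp add: v_def)
  then show ?thesis by blast
qed

text \<open>
  The subsets of variables in the order in which the sixteen functions are enumerated.
\<close>
definition branch_list :: "var set list" where
  "branch_list = [{}, {VX}, {VY}, {VZ}, {VT}, {VX, VY}, {VX, VZ}, {VX, VT}, {VY, VZ}, {VY, VT}, {VZ, VT},
     {VX, VY, VZ}, {VX, VY, VT}, {VX, VZ, VT}, {VY, VZ, VT}, {VX, VY, VZ, VT}]"

lemma K2_sol_branch:
  assumes "P \<in> K2_domain" "j \<in> {1..16}"
  shows "K2_sol a b c e1 e2 e3 e4 j P = branch a b c (by_var e1 e2 e3 e4) (branch_list ! (j - 1)) P"
proof -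
  obtain x y z t where P: "P = (x, y, z, t)" by (metis prod.exhaust)
  have nz: "x \<noteq> 0" "y \<noteq> 0" "z \<noteq> 0" "t \<noteq> 0"
    using coord_nonzero[OF assms(1), of VX] coord_nonzero[OF assms(1), of VY] coord_nonzero[OF assms(1), of VZ]
      coord_nonzero[OF assms(1), of VT] by (simp_all add: P)
  have "K2_sol a b c e1 e2 e3 e4 j P = map (\<lambda>S. branch a b c (by_var e1 e2 e3 e4) S P) branch_list ! (j - 1)"
    unfolding K2_sol_def P prod.case
    by (rule arg_cong[of _ _ "\<lambda>l. l ! (j - 1)"])
      (simp add: branch_list_def K2_branch_def exps_def cmonomial_def nz Aexp_def BCexp_def algebra_simps)
  also have "\<dots> = branch a b c (by_var e1 e2 e3 e4) (branch_list ! (j - 1)) P"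
    using assms(2) by (intro nth_map) (auto simp: branch_list_def)
  finally show ?thesis .
qed

lemma bij_branch_list: "bij_betw (\<lambda>j. branch_list ! (j - 1)) {1..16} UNIV"
proof -
  have U: "(UNIV :: var set set) = Pow {VX, VY, VZ, VT}"
    unfolding UNIV_var[symmetric] by simp
  have s: "set branch_list = UNIV"
    unfolding U branch_list_def by (simp add: Pow_insert insert_commute)
  have "(\<lambda>j. branch_list ! (j - 1)) ` {1..16} = set branch_list"
  proof -
    have "(\<lambda>j. branch_list ! (j - 1)) ` {1..16} = (\<lambda>j. branch_list ! j) ` {..<length branch_list}"
    proof -
      have "{..<length branch_list} = (\<lambda>j. j - 1) ` {1..16}"
        unfolding branch_list_def by (auto simp: image_iff intro!: bexI[of _ "Suc _"])
      then show ?thesis by (simp add: image_image)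
    qed
    also have "\<dots> = set branch_list" by (auto simp: set_conv_nth)
    finally show ?thesis .
  qed
  then have im: "(\<lambda>j. branch_list ! (j - 1)) ` {1..16} = UNIV" using s by simp
  have "card (UNIV :: var set set) = card {1..16::nat}"
    unfolding U by (simp add: card_Pow)
  then have "inj_on (\<lambda>j. branch_list ! (j - 1)) {1..16}"
    by (intro eq_card_imp_inj_on finite_atLeastAtMost) (simp only: im)
  then show ?thesis using im by (simp add: bij_betw_def)
qed

theorem mainTheorem1:
  fixes a b c e1 e2 e3 e4 :: complex and D :: "c4 set"
  assumes "e1 \<notin> \<int>" and "e2 \<notin> \<int>" and "e3 \<notin> \<int>" and "e4 \<notin> \<int>"
    and "open D" and "connected D" and "D \<noteq> {}" and "D \<subseteq> K2_domain"
  shows "(\<forall>j\<in>{1..16}. K2_system_solution a b c e1 e2 e3 e4 D (K2_sol a b c e1 e2 e3 e4 j)) \<and>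
         lin_indep_on D {1..16} (K2_sol a b c e1 e2 e3 e4) \<and>
         (\<forall>u. K2_system_solution a b c e1 e2 e3 e4 D u \<longleftrightarrow>
            (\<exists>k :: nat \<Rightarrow> complex. \<forall>P\<in>D. u P = (\<Sum>j = 1..16. k j * K2_sol a b c e1 e2 e3 e4 j P)))"
proof -
  define e where "e = by_var e1 e2 e3 e4"
  define \<phi> where "\<phi> = (\<lambda>j. branch_list ! (j - 1))"
  have \<phi>: "bij_betw \<phi> {1..16} UNIV" unfolding \<phi>_def by (rule bij_branch_list)
  define \<psi> where "\<psi> = the_inv_into {1..16} \<phi>"
  have \<psi>: "\<psi> (\<phi> j) = j" if "j \<in> {1..16}" for j
    unfolding \<psi>_def using the_inv_into_f_f bij_betw_imp_inj_on[OF \<phi>] that by metis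
  have e: "e i \<notin> \<int>" for i using assms by (cases i) (simp_all add: e_def)
  obtain P0 where P0: "P0 \<in> D" using assms by blast
  have sys: "K2_system_solution a b c e1 e2 e3 e4 D u \<longleftrightarrow>
    holomorphic4_on u D \<and> (\<forall>P\<in>D. \<forall>i. diff_op (K2_eq a b c e i) u P = 0)" for u
    unfolding e_def by (rule system_iff)
  have sol: "K2_sol a b c e1 e2 e3 e4 j P = branch a b c e (\<phi> j) P" if "P \<in> D" "j \<in> {1..16}" for j P
    unfolding e_def \<phi>_def using that assms(8) by (intro K2_sol_branch) auto
  have sum: "(\<Sum>j = 1..16. k j * K2_sol a b c e1 e2 e3 e4 j P) = (\<Sum>S\<in>UNIV. k (\<psi> S) * branch a b c e S P)"
    if "P \<in> D" for k P
  proof -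
    have "(\<Sum>j = 1..16. k j * K2_sol a b c e1 e2 e3 e4 j P) = (\<Sum>j = 1..16. k (\<psi> (\<phi> j)) * branch a b c e (\<phi> j) P)"
      by (rule sum.cong) (simp_all add: \<psi> sol that)
    also have "\<dots> = (\<Sum>S\<in>UNIV. k (\<psi> S) * branch a b c e S P)"
      by (rule sum.reindex_bij_betw[OF \<phi>])
    finally show ?thesis .
  qed
  have comb: "K2_system_solution a b c e1 e2 e3 e4 D u"
    if uk: "\<And>P. P \<in> D \<Longrightarrow> u P = (\<Sum>S\<in>UNIV. k S * branch a b c e S P)" for u k
  proof -
    note sp = solution_span[where e = e and k = k and a = a and b = b and c = c, OF e assms(5,8)]
    have "holomorphic4_on u D"
      by (rule holomorphic4_cong[OF assms(5) _ sp(1)]) (rule uk[symmetric])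
    moreover have "diff_op (K2_eq a b c e i) u P = 0" if P: "P \<in> D" for P i
    proof -
      have "diff_op (K2_eq a b c e i) u P = diff_op (K2_eq a b c e i) (\<lambda>P. \<Sum>S\<in>UNIV. k S * branch a b c e S P) P"
        by (rule diff_op_cong[OF assms(5) _ P]) (rule uk)
      then show ?thesis using sp(2)[OF P] by simp
    qed
    ultimately show ?thesis unfolding sys by blast
  qed
  have 1: "K2_system_solution a b c e1 e2 e3 e4 D (K2_sol a b c e1 e2 e3 e4 j)" if "j \<in> {1..16}" for j
  proof (rule comb)
    fix P assume "P \<in> D"
    have "(\<Sum>S\<in>UNIV. (if S = \<phi> j then 1 else 0) * branch a b c e S P) = (\<Sum>S\<in>UNIV. if S = \<phi> j then branch a b c e S P else 0)"
      by (rule sum.cong) auto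
    then show "K2_sol a b c e1 e2 e3 e4 j P = (\<Sum>S\<in>UNIV. (if S = \<phi> j then 1 else 0) * branch a b c e S P)"
      using sol[OF \<open>P \<in> D\<close> that] by simp
  qed
  have 2: "lin_indep_on D {1..16} (K2_sol a b c e1 e2 e3 e4)"
    unfolding lin_indep_on_def
  proof (intro allI impI ballI)
    fix k :: "nat \<Rightarrow> complex" and j :: nat
    assume z: "\<forall>P\<in>D. (\<Sum>j = 1..16. k j * K2_sol a b c e1 e2 e3 e4 j P) = 0" and j: "j \<in> {1..16}"
    have "k (\<psi> (\<phi> j)) = 0"
    proof (rule branches_independent[OF e assms(5,8) P0])
      show "(\<Sum>S\<in>UNIV. k (\<psi> S) * branch a b c e S P) = 0" if "P \<in> D" for P
        using bspec[OF z that] by (simp only: sum[OF that])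
    qed
    then show "k j = 0" using \<psi>[OF j] by simp
  qed
  have 3: "K2_system_solution a b c e1 e2 e3 e4 D u \<longleftrightarrow>
            (\<exists>k :: nat \<Rightarrow> complex. \<forall>P\<in>D. u P = (\<Sum>j = 1..16. k j * K2_sol a b c e1 e2 e3 e4 j P))" for u
  proof
    assume "K2_system_solution a b c e1 e2 e3 e4 D u"
    then have u: "holomorphic4_on u D" "\<And>P i. P \<in> D \<Longrightarrow> diff_op (K2_eq a b c e i) u P = 0"
      unfolding sys by auto
    have "\<exists>k. \<forall>P\<in>D. u P = (\<Sum>S\<in>UNIV. k S * branch a b c e S P)"
      by (rule solution_is_combination[OF e assms(5,6,8) P0 u])
    then obtain k where k: "\<forall>P\<in>D. u P = (\<Sum>S\<in>UNIV. k S * branch a b c e S P)" ..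
    have "(\<Sum>j = 1..16. k (\<phi> j) * K2_sol a b c e1 e2 e3 e4 j P) = (\<Sum>S\<in>UNIV. k S * branch a b c e S P)" if "P \<in> D" for P
    proof -
      have "(\<Sum>j = 1..16. k (\<phi> j) * K2_sol a b c e1 e2 e3 e4 j P) = (\<Sum>j = 1..16. k (\<phi> j) * branch a b c e (\<phi> j) P)"
        by (rule sum.cong) (simp_all add: sol that)
      also have "\<dots> = (\<Sum>S\<in>UNIV. k S * branch a b c e S P)"
        by (rule sum.reindex_bij_betw[OF \<phi>])
      finally show ?thesis .
    qed
    then show "\<exists>k :: nat \<Rightarrow> complex. \<forall>P\<in>D. u P = (\<Sum>j = 1..16. k j * K2_sol a b c e1 e2 e3 e4 j P)"
      using k by (intro exI[of _ "\<lambda>j. k (\<phi> j)"]) simp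
  next
    assume "\<exists>k :: nat \<Rightarrow> complex. \<forall>P\<in>D. u P = (\<Sum>j = 1..16. k j * K2_sol a b c e1 e2 e3 e4 j P)"
    then obtain k :: "nat \<Rightarrow> complex" where "\<forall>P\<in>D. u P = (\<Sum>j = 1..16. k j * K2_sol a b c e1 e2 e3 e4 j P)"
      by blast
    then show "K2_system_solution a b c e1 e2 e3 e4 D u"
      using sum by (intro comb[of u "\<lambda>S. k (\<psi> S)"]) simp
  qed
  show ?thesis using 1 2 3 by blast
qed

end
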